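(* Let $G$ be a finitely generated virtually nilpotent group, and let $\varphi$ be an equation (in any finite number of variables) over $G$. Then $\mathrm{d}\varphi_M(G)$ is the same for all sequences $M$ of probability measures that measure index uniformly on $G$, and for every such sequence $M=(\mu_n)_{n=1}^\infty$ the $\limsup$ in the definition $\mathrm{d}\varphi_M(G)=\limsup_{n\to\infty}\mathrm{d}\varphi_{\mu_n}(G)$ is actually a limit.
   Context: Groups are discrete. Write $F_k$ for the free group on generators $x_1,\ldots,x_k$. An equation in $k$ variables over $G$ is a word $\varphi\in F_k\ast G$ (free product), viewed as a function $G^k\to G$ by letting $\varphi(g_1,\ldots,g_k)$ be the element of $G$ obtained by replacing each instance of $x_i$ in $\varphi$ by $g_i$. For a probability measure $\mu$ on $G$, $\mathrm{d}\varphi_\mu(G)$ is the probability that $\varphi(g_1,\ldots,g_k)=1$ when $g_1,\ldots,g_k$ are chosen independently according to $\mu$. A sequence $M=(\mu_n)_{n=1}^\infty$ of probability measures on $G$ measures index uniformly if $\mu_n(xH)\to1/[G:H]$ as $n\to\infty$, uniformly over all $x\in G$ and all subgroups $H$ of $G$, where $1/[G:H]=0$ if $[G:H]=\infty$. *)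

theory Defs
  imports
    "HOL-Algebra.Generated_Groups"
    "HOL-Algebra.Left_Coset"
    "HOL-Probability.Probability"
begin

section \<open>Monoids given by generators and relations\<close>

inductive word_cong :: "'x set \<Rightarrow> ('x list \<times> 'x list) set \<Rightarrow> 'x list \<Rightarrow> 'x list \<Rightarrow> bool"
  for L R where
  refl: "w \<in> lists L \<Longrightarrow> word_cong L R w w"
| sym: "word_cong L R v w \<Longrightarrow> word_cong L R w v"
| trans: "word_cong L R u v \<Longrightarrow> word_cong L R v w \<Longrightarrow> word_cong L R u w"
| rel: "(u, v) \<in> R \<Longrightarrow> u \<in> lists L \<Longrightarrow> v \<in> lists L \<Longrightarrow> p \<in> lists L \<Longrightarrow> q \<in> lists L
         \<Longrightarrow> word_cong L R (p @ u @ q) (p @ v @ q)"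

definition word_class :: "'x set \<Rightarrow> ('x list \<times> 'x list) set \<Rightarrow> 'x list \<Rightarrow> 'x list set" where
  "word_class L R w = {v. word_cong L R w v}"

definition presented_monoid :: "'x set \<Rightarrow> ('x list \<times> 'x list) set \<Rightarrow> 'x list set monoid" where
  "presented_monoid L R =
     \<lparr>carrier = word_class L R ` lists L,
      monoid.mult = (\<lambda>A B. \<Union>u\<in>A. \<Union>v\<in>B. word_class L R (u @ v)),
      one = word_class L R []\<rparr>"

definition word_eval :: "('a, 'b) monoid_scheme \<Rightarrow> ('x \<Rightarrow> 'a) \<Rightarrow> 'x list \<Rightarrow> 'a" where
  "word_eval K f w = foldr (\<lambda>x y. f x \<otimes>\<^bsub>K\<^esub> y) w \<one>\<^bsub>K\<^esub>"

text \<open>Evaluation of a class of words; it does not depend on the chosen representative whenever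
  \<open>f\<close> respects the defining relations, see \<open>class_eval_word_class\<close> below.\<close>
definition class_eval :: "('a, 'b) monoid_scheme \<Rightarrow> ('x \<Rightarrow> 'a) \<Rightarrow> 'x list set \<Rightarrow> 'a" where
  "class_eval K f A = word_eval K f (SOME w. w \<in> A)"

lemma word_cong_lists:
  "word_cong L R u v \<Longrightarrow> u \<in> lists L \<and> v \<in> lists L"
  by (induction rule: word_cong.induct) auto

lemma word_cong_append:
  assumes "word_cong L R u v" "p \<in> lists L" "q \<in> lists L"
  shows "word_cong L R (p @ u @ q) (p @ v @ q)"
  using assms
proof (induction rule: word_cong.induct)
  case (refl w)
  then show ?case by (intro word_cong.refl) auto
next
  case (sym v w)
  then show ?case by (blast intro: word_cong.sym)
next
  case (trans u v w)
  then show ?case by (blast intro: word_cong.trans)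
next
  case (rel u v p' q')
  then show ?case using word_cong.rel[of u v R L "p @ p'" "q' @ q"] by auto
qed

lemma word_cong_append2:
  assumes "word_cong L R u u'" "word_cong L R v v'"
  shows "word_cong L R (u @ v) (u' @ v')"
proof -
  have "word_cong L R (u @ v) (u' @ v)"
    using word_cong_append[OF assms(1), of "[]" v] word_cong_lists[OF assms(2)] by simp
  moreover have "word_cong L R (u' @ v) (u' @ v')"
    using word_cong_append[OF assms(2), of u' "[]"] word_cong_lists[OF assms(1)] by simp
  ultimately show ?thesis by (rule word_cong.trans)
qed

lemma word_class_eq_iff:
  assumes "u \<in> lists L"
  shows "word_class L R u = word_class L R v \<longleftrightarrow> word_cong L R u v"
proof
  assume "word_class L R u = word_class L R v"
  moreover have "u \<in> word_class L R u"
    using assms by (simp add: word_class_def word_cong.refl)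
  ultimately have "u \<in> word_class L R v" by blast
  then have "word_cong L R v u" by (simp add: word_class_def)
  then show "word_cong L R u v" by (rule word_cong.sym)
next
  assume "word_cong L R u v"
  then show "word_class L R u = word_class L R v"
    unfolding word_class_def by (intro Collect_cong iffI) (rule word_cong.trans[OF word_cong.sym], assumption+, rule word_cong.trans)
qed

lemma presented_monoid_mult:
  assumes "u \<in> lists L" "v \<in> lists L"
  shows "word_class L R u \<otimes>\<^bsub>presented_monoid L R\<^esub> word_class L R v = word_class L R (u @ v)"
proof -
  let ?c = "word_class L R"
  have uv: "u @ v \<in> lists L" using assms by simp
  have "?c (u' @ v') = ?c (u @ v)" if "u' \<in> ?c u" "v' \<in> ?c v" for u' v'
  proof -
    have "word_cong L R (u @ v) (u' @ v')"
      using that by (intro word_cong_append2) (simp_all add: word_class_def)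
    then show ?thesis using word_class_eq_iff[OF uv, of R "u' @ v'"] by simp
  qed
  then have "(\<Union>u'\<in>?c u. \<Union>v'\<in>?c v. ?c (u' @ v')) = (\<Union>u'\<in>?c u. \<Union>v'\<in>?c v. ?c (u @ v))"
    by (intro SUP_cong HOL.refl)
  moreover have "u \<in> ?c u" "v \<in> ?c v"
    using word_cong.refl[OF assms(1)] word_cong.refl[OF assms(2)] by (simp_all add: word_class_def)
  ultimately have "(\<Union>u'\<in>?c u. \<Union>v'\<in>?c v. ?c (u' @ v')) = ?c (u @ v)" by blast
  then show ?thesis by (simp add: presented_monoid_def)
qed

lemma presented_monoid_carrier:
  "carrier (presented_monoid L R) = word_class L R ` lists L"
  by (simp add: presented_monoid_def)

lemma presented_monoid_one:
  "\<one>\<^bsub>presented_monoid L R\<^esub> = word_class L R []"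
  by (simp add: presented_monoid_def)

lemma group_presented_monoid:
  assumes inv: "\<And>x. x \<in> L \<Longrightarrow> \<exists>y\<in>L. word_cong L R [y, x] []"
  shows "group (presented_monoid L R)"
proof (rule groupI)
  have ex: "\<exists>v\<in>lists L. word_cong L R (v @ w) []" if "w \<in> lists L" for w
    using that
  proof (induction w)
    case Nil
    then show ?case by (intro bexI[of _ "[]"]) (auto intro: word_cong.refl)
  next
    case (Cons x w)
    then obtain v y where vy: "v \<in> lists L" "word_cong L R (v @ w) []"
      "y \<in> L" "word_cong L R [y, x] []"
      using inv by blast
    have "word_cong L R (v @ [y, x] @ w) (v @ [] @ w)"
      by (rule word_cong_append) (use vy Cons in auto)
    with vy show ?case
      by (intro bexI[of _ "v @ [y]"]) (auto intro: word_cong.trans)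
  qed
  fix A assume "A \<in> carrier (presented_monoid L R)"
  then obtain w where w: "w \<in> lists L" "A = word_class L R w"
    by (auto simp: presented_monoid_carrier)
  from ex[OF w(1)] obtain v where v: "v \<in> lists L" "word_cong L R (v @ w) []" by blast
  have "word_class L R v \<otimes>\<^bsub>presented_monoid L R\<^esub> A = \<one>\<^bsub>presented_monoid L R\<^esub>"
    using v w by (simp add: presented_monoid_mult presented_monoid_one word_class_eq_iff)
  then show "\<exists>B\<in>carrier (presented_monoid L R).
      B \<otimes>\<^bsub>presented_monoid L R\<^esub> A = \<one>\<^bsub>presented_monoid L R\<^esub>"
    using v by (auto simp: presented_monoid_carrier)
qed (auto simp: presented_monoid_carrier presented_monoid_mult presented_monoid_one
      simp flip: in_lists_conv_set)

lemma word_eval_closed: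
  assumes "monoid K" "f \<in> L \<rightarrow> carrier K" "w \<in> lists L"
  shows "word_eval K f w \<in> carrier K"
  using assms(3)
proof (induction w)
  case Nil
  then show ?case using assms by (simp add: word_eval_def monoid.one_closed)
next
  case (Cons x w)
  then show ?case using assms by (auto simp: word_eval_def intro!: monoid.m_closed)
qed

lemma word_eval_append:
  assumes "monoid K" "f \<in> L \<rightarrow> carrier K" "u \<in> lists L" "v \<in> lists L"
  shows "word_eval K f (u @ v) = word_eval K f u \<otimes>\<^bsub>K\<^esub> word_eval K f v"
  using assms(3)
proof (induction u)
  case Nil
  then show ?case
    using word_eval_closed[OF assms(1,2,4)] assms(1) by (simp add: word_eval_def monoid.l_one)
next
  case (Cons x u)
  have "f x \<in> carrier K" "word_eval K f u \<in> carrier K" "word_eval K f v \<in> carrier K"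
    using Cons assms by (auto intro!: word_eval_closed[OF assms(1,2)])
  then show ?case
    using Cons assms(1) by (simp add: word_eval_def monoid.m_assoc)
qed

lemma word_eval_cong:
  assumes "word_cong L R u v" "monoid K" "f \<in> L \<rightarrow> carrier K"
    and "\<And>u v. (u, v) \<in> R \<Longrightarrow> u \<in> lists L \<Longrightarrow> v \<in> lists L \<Longrightarrow> word_eval K f u = word_eval K f v"
  shows "word_eval K f u = word_eval K f v"
  using assms(1)
proof (induction rule: word_cong.induct)
  case (rel u v p q)
  then show ?case
    using assms(4)[of u v] by (simp add: word_eval_append[OF assms(2,3)])
qed simp_all

lemma class_eval_word_class:
  assumes "w \<in> lists L" "monoid K" "f \<in> L \<rightarrow> carrier K"
    and "\<And>u v. (u, v) \<in> R \<Longrightarrow> u \<in> lists L \<Longrightarrow> v \<in> lists L \<Longrightarrow> word_eval K f u = word_eval K f v"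
  shows "class_eval K f (word_class L R w) = word_eval K f w"
proof -
  have "word_cong L R w (SOME v. v \<in> word_class L R w)"
    using assms(1) someI[of "\<lambda>v. v \<in> word_class L R w" w]
    by (simp add: word_class_def word_cong.refl)
  from word_eval_cong[OF this assms(2-4)] show ?thesis
    by (simp add: class_eval_def)
qed

lemma class_eval_hom:
  assumes "monoid K" "f \<in> L \<rightarrow> carrier K"
    and "\<And>u v. (u, v) \<in> R \<Longrightarrow> u \<in> lists L \<Longrightarrow> v \<in> lists L \<Longrightarrow> word_eval K f u = word_eval K f v"
  shows "class_eval K f \<in> hom (presented_monoid L R) K"
proof (rule homI)
  fix A B assume "A \<in> carrier (presented_monoid L R)" "B \<in> carrier (presented_monoid L R)"
  then obtain u v where "u \<in> lists L" "v \<in> lists L" "A = word_class L R u" "B = word_class L R v"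
    by (auto simp: presented_monoid_carrier)
  then show "class_eval K f (A \<otimes>\<^bsub>presented_monoid L R\<^esub> B) = class_eval K f A \<otimes>\<^bsub>K\<^esub> class_eval K f B"
    by (simp add: presented_monoid_mult class_eval_word_class[OF _ assms]
        word_eval_append[OF assms(1,2)])
next
  fix A assume "A \<in> carrier (presented_monoid L R)"
  then obtain w where "w \<in> lists L" "A = word_class L R w"
    by (auto simp: presented_monoid_carrier)
  then show "class_eval K f A \<in> carrier K"
    using class_eval_word_class[OF _ assms] word_eval_closed[OF assms(1,2)] by metis
qed


section \<open>Free groups, free products, and equations over a group\<close>

text \<open>The letter \<open>(x, True)\<close> stands for the generator \<open>x\<close>, and \<open>(x, False)\<close> for its inverse.\<close>

definition free_letters :: "'x set \<Rightarrow> ('x \<times> bool) set" where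
  "free_letters S = S \<times> UNIV"

definition free_relations :: "(('x \<times> bool) list \<times> ('x \<times> bool) list) set" where
  "free_relations = {([(x, b), (x, \<not> b)], []) | x b. True}"

definition free_group :: "'x set \<Rightarrow> ('x \<times> bool) list set monoid" where
  "free_group S = presented_monoid (free_letters S) free_relations"

definition free_group_gen :: "'x set \<Rightarrow> 'x \<Rightarrow> ('x \<times> bool) list set" where
  "free_group_gen S x = word_class (free_letters S) free_relations [(x, True)]"

definition free_group_eval :: "('a, 'b) monoid_scheme \<Rightarrow> ('x \<Rightarrow> 'a) \<Rightarrow> ('x \<times> bool) list set \<Rightarrow> 'a" where
  "free_group_eval K g = class_eval K (\<lambda>(x, b). if b then g x else inv\<^bsub>K\<^esub> (g x))"

definition coprod_letters :: "('a, 'm) monoid_scheme \<Rightarrow> ('b, 'n) monoid_scheme \<Rightarrow> ('a + 'b) set" where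
  "coprod_letters G H = Inl ` carrier G \<union> Inr ` carrier H"

definition coprod_relations ::
  "('a, 'm) monoid_scheme \<Rightarrow> ('b, 'n) monoid_scheme \<Rightarrow> (('a + 'b) list \<times> ('a + 'b) list) set" where
  "coprod_relations G H =
     {([Inl \<one>\<^bsub>G\<^esub>], []), ([Inr \<one>\<^bsub>H\<^esub>], [])}
     \<union> {([Inl x, Inl y], [Inl (x \<otimes>\<^bsub>G\<^esub> y)]) | x y. x \<in> carrier G \<and> y \<in> carrier G}
     \<union> {([Inr x, Inr y], [Inr (x \<otimes>\<^bsub>H\<^esub> y)]) | x y. x \<in> carrier H \<and> y \<in> carrier H}"

definition free_product ::
  "('a, 'm) monoid_scheme \<Rightarrow> ('b, 'n) monoid_scheme \<Rightarrow> ('a + 'b) list set monoid" where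
  "free_product G H = presented_monoid (coprod_letters G H) (coprod_relations G H)"

definition free_product_inl ::
  "('a, 'm) monoid_scheme \<Rightarrow> ('b, 'n) monoid_scheme \<Rightarrow> 'a \<Rightarrow> ('a + 'b) list set" where
  "free_product_inl G H x = word_class (coprod_letters G H) (coprod_relations G H) [Inl x]"

definition free_product_inr ::
  "('a, 'm) monoid_scheme \<Rightarrow> ('b, 'n) monoid_scheme \<Rightarrow> 'b \<Rightarrow> ('a + 'b) list set" where
  "free_product_inr G H y = word_class (coprod_letters G H) (coprod_relations G H) [Inr y]"

definition free_product_eval ::
  "('c, 'k) monoid_scheme \<Rightarrow> ('a \<Rightarrow> 'c) \<Rightarrow> ('b \<Rightarrow> 'c) \<Rightarrow> ('a + 'b) list set \<Rightarrow> 'c" where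
  "free_product_eval K f h = class_eval K (case_sum f h)"

type_synonym 'a equation = "((nat \<times> bool) list set + 'a) list set"

definition equations :: "('a, 'b) monoid_scheme \<Rightarrow> nat \<Rightarrow> 'a equation set" where
  "equations G k = carrier (free_product (free_group {1..k}) G)"

text \<open>The element of \<open>G\<close> obtained from an equation by substituting \<open>g i\<close> for the variable \<open>x\<^sub>i\<close>;
  by \<open>eqn_eval_hom\<close>, \<open>eqn_eval_var\<close> and \<open>eqn_eval_const\<close> below it is the homomorphism that is the
  identity on \<open>G\<close> and maps \<open>x\<^sub>i\<close> to \<open>g i\<close>.\<close>
definition eqn_eval :: "('a, 'b) monoid_scheme \<Rightarrow> 'a equation \<Rightarrow> (nat \<Rightarrow> 'a) \<Rightarrow> 'a" where
  "eqn_eval G \<phi> g = free_product_eval G (free_group_eval G g) (\<lambda>x. x) \<phi>"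

lemma group_free_group: "group (free_group S)"
  unfolding free_group_def
proof (rule group_presented_monoid)
  fix z :: "'a \<times> bool" assume z: "z \<in> free_letters S"
  obtain x b where [simp]: "z = (x, b)" by force
  have "([(x, \<not> b), (x, b)], []) \<in> free_relations"
    by (auto simp: free_relations_def)
  from word_cong.rel[OF this, of "free_letters S" "[]" "[]"] z
  show "\<exists>y\<in>free_letters S. word_cong (free_letters S) free_relations [y, z] []"
    by (intro bexI[of _ "(x, \<not> b)"]) (auto simp: free_letters_def)
qed

lemma free_group_eval_facts:
  assumes "group K" "g \<in> S \<rightarrow> carrier K"
  shows free_group_eval_hom: "free_group_eval K g \<in> hom (free_group S) K"
    and free_group_eval_gen: "x \<in> S \<Longrightarrow> free_group_eval K g (free_group_gen S x) = g x"
proof -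
  interpret K: group K by fact
  let ?f = "\<lambda>(x, b). if b then g x else inv\<^bsub>K\<^esub> (g x)"
  have f: "?f \<in> free_letters S \<rightarrow> carrier K"
    using assms(2) by (auto simp: free_letters_def Pi_iff)
  have R: "word_eval K ?f u = word_eval K ?f v"
    if "(u, v) \<in> free_relations" "u \<in> lists (free_letters S)" "v \<in> lists (free_letters S)" for u v
  proof -
    from that obtain x b where "u = [(x, b), (x, \<not> b)]" "v = []" "x \<in> S"
      by (auto simp: free_relations_def free_letters_def)
    moreover have "g x \<in> carrier K" using \<open>x \<in> S\<close> assms(2) by auto
    ultimately show ?thesis by (cases b) (auto simp: word_eval_def)
  qed
  show "free_group_eval K g \<in> hom (free_group S) K"
    unfolding free_group_def free_group_eval_def
    by (rule class_eval_hom[OF K.monoid_axioms f R])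
  show "free_group_eval K g (free_group_gen S x) = g x" if "x \<in> S"
  proof -
    have "[(x, True)] \<in> lists (free_letters S)" using that by (auto simp: free_letters_def)
    from class_eval_word_class[OF this K.monoid_axioms f R] show ?thesis
      using that assms(2) by (auto simp: free_group_eval_def free_group_gen_def word_eval_def Pi_iff)
  qed
qed

lemma group_free_product:
  assumes "group G" "group H"
  shows "group (free_product G H)"
  unfolding free_product_def
proof (rule group_presented_monoid)
  interpret G: group G by fact
  interpret H: group H by fact
  let ?L = "coprod_letters G H" and ?R = "coprod_relations G H"
  have rel: "word_cong ?L ?R u v" if "(u, v) \<in> ?R" "u \<in> lists ?L" "v \<in> lists ?L" for u v
    using word_cong.rel[OF that, of "[]" "[]"] by simp
  fix z assume "z \<in> ?L"
  then consider x where "z = Inl x" "x \<in> carrier G" | y where "z = Inr y" "y \<in> carrier H"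
    by (auto simp: coprod_letters_def)
  then show "\<exists>y\<in>?L. word_cong ?L ?R [y, z] []"
  proof cases
    case 1
    have "([Inl (inv\<^bsub>G\<^esub> x), Inl x], [Inl (inv\<^bsub>G\<^esub> x \<otimes>\<^bsub>G\<^esub> x)]) \<in> ?R"
      using 1 unfolding coprod_relations_def by (blast intro: G.inv_closed)
    then have "word_cong ?L ?R [Inl (inv\<^bsub>G\<^esub> x), z] [Inl \<one>\<^bsub>G\<^esub>]"
      using 1 by (intro rel) (auto simp: coprod_letters_def)
    moreover have "word_cong ?L ?R [Inl \<one>\<^bsub>G\<^esub>] []"
      by (rule rel) (auto simp: coprod_letters_def coprod_relations_def)
    ultimately show ?thesis
      using 1 by (intro bexI[of _ "Inl (inv\<^bsub>G\<^esub> x)"]) (auto simp: coprod_letters_def intro: word_cong.trans)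
  next
    case 2
    have "([Inr (inv\<^bsub>H\<^esub> y), Inr y], [Inr (inv\<^bsub>H\<^esub> y \<otimes>\<^bsub>H\<^esub> y)]) \<in> ?R"
      using 2 unfolding coprod_relations_def by (blast intro: H.inv_closed)
    then have "word_cong ?L ?R [Inr (inv\<^bsub>H\<^esub> y), z] [Inr \<one>\<^bsub>H\<^esub>]"
      using 2 by (intro rel) (auto simp: coprod_letters_def)
    moreover have "word_cong ?L ?R [Inr \<one>\<^bsub>H\<^esub>] []"
      by (rule rel) (auto simp: coprod_letters_def coprod_relations_def)
    ultimately show ?thesis
      using 2 by (intro bexI[of _ "Inr (inv\<^bsub>H\<^esub> y)"]) (auto simp: coprod_letters_def intro: word_cong.trans)
  qed
qed

lemma free_product_eval_facts:
  assumes "group G" "group H" "group K" "f \<in> hom G K" "h \<in> hom H K"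
  shows free_product_eval_hom: "free_product_eval K f h \<in> hom (free_product G H) K"
    and free_product_eval_inl:
      "x \<in> carrier G \<Longrightarrow> free_product_eval K f h (free_product_inl G H x) = f x"
    and free_product_eval_inr:
      "y \<in> carrier H \<Longrightarrow> free_product_eval K f h (free_product_inr G H y) = h y"
proof -
  interpret K: group K by fact
  interpret f: group_hom G K f using assms by (simp add: group_hom_def group_hom_axioms_def)
  interpret h: group_hom H K h using assms by (simp add: group_hom_def group_hom_axioms_def)
  let ?c = "case_sum f h"
  have c: "?c \<in> coprod_letters G H \<rightarrow> carrier K"
    by (auto simp: coprod_letters_def)
  have R: "word_eval K ?c u = word_eval K ?c v"
    if "(u, v) \<in> coprod_relations G H" "u \<in> lists (coprod_letters G H)"
      "v \<in> lists (coprod_letters G H)" for u v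
    using that(1) by (auto simp: coprod_relations_def word_eval_def)
  show "free_product_eval K f h \<in> hom (free_product G H) K"
    unfolding free_product_def free_product_eval_def
    by (rule class_eval_hom[OF K.monoid_axioms c R])
  note eval = class_eval_word_class[OF _ K.monoid_axioms c R]
  show "free_product_eval K f h (free_product_inl G H x) = f x" if "x \<in> carrier G"
    using that eval[of "[Inl x]"]
    by (auto simp: free_product_eval_def free_product_inl_def word_eval_def coprod_letters_def)
  show "free_product_eval K f h (free_product_inr G H y) = h y" if "y \<in> carrier H"
    using that eval[of "[Inr y]"]
    by (auto simp: free_product_eval_def free_product_inr_def word_eval_def coprod_letters_def)
qed

lemma free_group_gen_closed: "x \<in> S \<Longrightarrow> free_group_gen S x \<in> carrier (free_group S)"
  by (auto simp: free_group_gen_def free_group_def presented_monoid_carrier free_letters_def)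

lemma eqn_eval_facts:
  assumes "group G" "g \<in> {1..k} \<rightarrow> carrier G"
  shows eqn_eval_hom: "(\<lambda>\<phi>. eqn_eval G \<phi> g) \<in> hom (free_product (free_group {1..k}) G) G"
    and eqn_eval_var: "i \<in> {1..k} \<Longrightarrow>
      eqn_eval G (free_product_inl (free_group {1..k}) G (free_group_gen {1..k} i)) g = g i"
    and eqn_eval_const: "x \<in> carrier G \<Longrightarrow>
      eqn_eval G (free_product_inr (free_group {1..k}) G x) g = x"
proof -
  have id: "(\<lambda>x. x) \<in> hom G G" by (auto simp: hom_def)
  note facts = free_product_eval_facts[OF group_free_group assms(1) assms(1)
      free_group_eval_hom[OF assms] id]
  show "(\<lambda>\<phi>. eqn_eval G \<phi> g) \<in> hom (free_product (free_group {1..k}) G) G"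
    unfolding eqn_eval_def using facts(1) .
  show "eqn_eval G (free_product_inl (free_group {1..k}) G (free_group_gen {1..k} i)) g = g i"
    if "i \<in> {1..k}"
    unfolding eqn_eval_def
    using facts(2)[OF free_group_gen_closed[OF that]] free_group_eval_gen[OF assms that] by simp
  show "eqn_eval G (free_product_inr (free_group {1..k}) G x) g = x" if "x \<in> carrier G"
    unfolding eqn_eval_def using facts(3)[OF that] .
qed


section \<open>Finitely generated virtually nilpotent groups\<close>

definition finitely_generated_group :: "('a, 'b) monoid_scheme \<Rightarrow> bool" where
  "finitely_generated_group G \<longleftrightarrow>
     group G \<and> (\<exists>S. finite S \<and> S \<subseteq> carrier G \<and> generate G S = carrier G)"

primrec lower_central :: "('a, 'b) monoid_scheme \<Rightarrow> nat \<Rightarrow> 'a set" where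
  "lower_central G 0 = carrier G"
| "lower_central G (Suc n) =
     generate G {h \<otimes>\<^bsub>G\<^esub> g \<otimes>\<^bsub>G\<^esub> inv\<^bsub>G\<^esub> h \<otimes>\<^bsub>G\<^esub> inv\<^bsub>G\<^esub> g | h g. h \<in> lower_central G n \<and> g \<in> carrier G}"

definition nilpotent_group :: "('a, 'b) monoid_scheme \<Rightarrow> bool" where
  "nilpotent_group G \<longleftrightarrow> group G \<and> (\<exists>n. lower_central G n = {\<one>\<^bsub>G\<^esub>})"

definition virtually_nilpotent_group :: "('a, 'b) monoid_scheme \<Rightarrow> bool" where
  "virtually_nilpotent_group G \<longleftrightarrow>
     group G \<and>
     (\<exists>H. subgroup H G \<and> finite (lcosets\<^bsub>G\<^esub> H) \<and> nilpotent_group (G\<lparr>carrier := H\<rparr>))"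


section \<open>Measures on a group and the degree of satisfaction of an equation\<close>

text \<open>Finitely generated groups are countable, so the probability measures on the discrete group
  \<open>G\<close> are given by probability mass functions supported on \<open>carrier G\<close>.\<close>
definition prob_measures_on :: "('a, 'b) monoid_scheme \<Rightarrow> 'a pmf set" where
  "prob_measures_on G = {\<mu>. set_pmf \<mu> \<subseteq> carrier G}"

definition inverse_index :: "('a, 'b) monoid_scheme \<Rightarrow> 'a set \<Rightarrow> real" where
  "inverse_index G H = (if finite (lcosets\<^bsub>G\<^esub> H) then 1 / real (card (lcosets\<^bsub>G\<^esub> H)) else 0)"

definition measures_index_uniformly :: "('a, 'b) monoid_scheme \<Rightarrow> (nat \<Rightarrow> 'a pmf) \<Rightarrow> bool" where
  "measures_index_uniformly G M \<longleftrightarrow>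
     (\<forall>n. M n \<in> prob_measures_on G) \<and>
     uniform_limit (carrier G \<times> {H. subgroup H G})
       (\<lambda>n (x, H). measure_pmf.prob (M n) (x <#\<^bsub>G\<^esub> H))
       (\<lambda>(x, H). inverse_index G H) sequentially"

text \<open>Coordinates outside \<open>{1..k}\<close> are filled with the dummy value \<open>\<one>\<^bsub>G\<^esub>\<close> by \<open>Pi_pmf\<close>.\<close>
definition eqn_degree :: "('a, 'b) monoid_scheme \<Rightarrow> nat \<Rightarrow> 'a equation \<Rightarrow> 'a pmf \<Rightarrow> real" where
  "eqn_degree G k \<phi> \<mu> =
     measure_pmf.prob (Pi_pmf {1..k} \<one>\<^bsub>G\<^esub> (\<lambda>_. \<mu>)) {g. eqn_eval G \<phi> g = \<one>\<^bsub>G\<^esub>}"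

definition eqn_degree_seq ::
  "('a, 'b) monoid_scheme \<Rightarrow> nat \<Rightarrow> 'a equation \<Rightarrow> (nat \<Rightarrow> 'a pmf) \<Rightarrow> ereal" where
  "eqn_degree_seq G k \<phi> M = limsup (\<lambda>n. ereal (eqn_degree G k \<phi> (M n)))"

end

theory Submission
  imports Defs "HOL-Algebra.Multiplicative_Group" "HOL-Algebra.Elementary_Groups"
begin

text \<open>
  Let \<open>N\<close> be a nilpotent normal subgroup of finite index. On a coset of \<open>N\<^sup>k\<close> the equation is a polynomial
  map into \<open>G\<close> in the sense of Leibman, with respect to a filtration of \<open>G\<close> that runs through the lower
  central series of \<open>N\<close>. As long as its values lie in a term \<open>C a\<close> of that series, it induces a polynomial
  map \<open>f\<close> into the abelian group \<open>C a / C (a + 1)\<close>. The values of \<open>f\<close> generate a finitely generated group.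
  If that group is finite, then \<open>f\<close> is periodic modulo a subgroup of finite index and one passes to the
  cosets on which \<open>f\<close> is trivial, now with values in \<open>C (a + 1)\<close>. If it is infinite, then it has a nonzero
  homomorphism to the integers, and the zero set of a nonzero integer-valued polynomial map has density zero
  in the profinite completion. Thus the solution set is, up to a set of arbitrarily small upper density, a
  finite union of cosets of subgroups of finite index, and the measures of these converge.
\<close>

no_notation subset_mset (infix "<#" 50)

section \<open>Subgroups of finite index\<close>

text \<open>The hypothesis on the measures speaks of cosets in \<open>G\<close> only, and
  independence of the coordinates turns it into information about boxes in \<open>G^k\<close>. Every
  finite-index subgroup of \<open>G^k\<close> contains a box of finite index, so all its cosets get
  the same limiting measure. This is why a negligible set can be recognised by counting the cosets
  that meet it.

  The obstacle is that the coefficients of the equation and the coset representatives lie in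
  \<open>G\<close> and not in \<open>N\<close>, so they need not commute with anything. The
  filtration therefore has \<open>G\<close> itself at index 0 and \<open>N\<close> at index 1: a
  constant from \<open>G\<close> has level 0, and conjugation by it does no harm because all terms
  are normal in \<open>G\<close>. A variable restricted to a coset of \<open>N\<close> is such a
  constant times a homomorphism into \<open>N\<close>, which behaves like a polynomial of degree
  1.\<close>

definition finite_index :: "('a, 'b) monoid_scheme \<Rightarrow> 'a set \<Rightarrow> bool" where
  "finite_index G K \<longleftrightarrow> subgroup K G \<and> finite (lcosets\<^bsub>G\<^esub> K)"

context group
begin

lemma inv_cancel_left [simp]:
  "x \<in> carrier G \<Longrightarrow> y \<in> carrier G \<Longrightarrow> inv x \<otimes> (x \<otimes> y) = y"
  "x \<in> carrier G \<Longrightarrow> y \<in> carrier G \<Longrightarrow> x \<otimes> (inv x \<otimes> y) = y"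
  by (simp_all flip: m_assoc)

lemma l_coset_eq_iff:
  assumes "subgroup K G" "x \<in> carrier G" "y \<in> carrier G"
  shows "x <# K = y <# K \<longleftrightarrow> inv x \<otimes> y \<in> K"
proof
  assume "x <# K = y <# K"
  then have "y \<in> x <# K" using lcos_self assms by blast
  then show "inv x \<otimes> y \<in> K" using subgroup.lcos_module_imp[OF assms(1) group_axioms] assms by blast
next
  assume "inv x \<otimes> y \<in> K"
  then have "y \<in> x <# K" using subgroup.lcos_module_rev[OF assms(1) group_axioms] assms by blast
  then show "x <# K = y <# K" using l_repr_independence assms by blast
qed

text \<open>A map with finitely many values that separates the left cosets suffices. It need not be
  constant on them, so one point is chosen for each value and its coset is taken.\<close>

lemma finite_indexI:
  assumes "subgroup K G" "finite (c ` carrier G)"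
    and "\<And>x y. x \<in> carrier G \<Longrightarrow> y \<in> carrier G \<Longrightarrow> c x = c y \<Longrightarrow> inv x \<otimes> y \<in> K"
  shows "finite_index G K"
proof -
  let ?r = "\<lambda>v. SOME x. x \<in> carrier G \<and> c x = v"
  have "lcosets K \<subseteq> (\<lambda>v. ?r v <# K) ` c ` carrier G"
  proof
    fix C assume "C \<in> lcosets K"
    then obtain x where x: "x \<in> carrier G" "C = x <# K" by (auto simp: LCOSETS_def)
    have "?r (c x) \<in> carrier G \<and> c (?r (c x)) = c x"
      by (rule someI[of _ x]) (use x in auto)
    then have "?r (c x) <# K = x <# K"
      using l_coset_eq_iff assms x by blast
    then show "C \<in> (\<lambda>v. ?r v <# K) ` c ` carrier G" using x by auto
  qed
  with assms(1,2) show ?thesis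
    unfolding finite_index_def by (meson finite_imageI finite_subset)
qed

lemma l_coset_in_lcosets [simp]: "x \<in> carrier G \<Longrightarrow> x <# K \<in> lcosets K"
  by (auto simp: LCOSETS_def)

lemma finite_index_restrict:
  assumes "finite_index G K" "K \<subseteq> H" "subgroup H G"
  shows "finite_index (G\<lparr>carrier := H\<rparr>) K"
proof -
  interpret H: group "G\<lparr>carrier := H\<rparr>" using assms subgroup_imp_group by blast
  have K: "subgroup K (G\<lparr>carrier := H\<rparr>)"
    using assms subgroup_incl by (auto simp: finite_index_def)
  have "finite ((\<lambda>x. x <# K) ` carrier (G\<lparr>carrier := H\<rparr>))"
    by (rule finite_subset[of _ "lcosets K"])
      (use assms subgroup.subset[OF assms(3)] in \<open>auto simp: finite_index_def\<close>)
  then show ?thesis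
    by (rule H.finite_indexI[OF K])
      (use assms subgroup.subset[OF assms(3)] in \<open>auto simp: finite_index_def l_coset_eq_iff subset_iff\<close>)
qed

lemma finite_index_trans:
  assumes "finite_index G H" "finite_index (G\<lparr>carrier := H\<rparr>) K"
  shows "finite_index G K"
proof -
  have H: "subgroup H G" and KH: "subgroup K (G\<lparr>carrier := H\<rparr>)"
    using assms by (auto simp: finite_index_def)
  then have K: "subgroup K G" using incl_subgroup by blast
  let ?r = "\<lambda>C. SOME x. x \<in> carrier G \<and> x <# H = C"
  \<comment> \<open>The coset of \<open>H\<close> that contains \<open>x\<close>, and the coset of
    \<open>K\<close> in \<open>H\<close> that contains \<open>x\<close> after it is moved into
    \<open>H\<close> by the chosen representative.\<close>
  let ?c = "\<lambda>x. (x <# H, (inv (?r (x <# H)) \<otimes> x) <# K)"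
  have r: "?r (x <# H) \<in> carrier G \<and> ?r (x <# H) <# H = x <# H" if "x \<in> carrier G" for x
    by (rule someI[of _ x]) (use that in auto)
  have rH: "inv (?r (x <# H)) \<otimes> x \<in> H" if "x \<in> carrier G" for x
    using r[OF that] l_coset_eq_iff[OF H] that by blast
  have "?c ` carrier G \<subseteq> (lcosets H) \<times> (lcosets\<^bsub>G\<lparr>carrier := H\<rparr>\<^esub> K)"
    using rH by (auto simp: LCOSETS_def)
  then have "finite (?c ` carrier G)"
    by (rule finite_subset) (use assms in \<open>auto simp: finite_index_def\<close>)
  then show ?thesis
  proof (rule finite_indexI[OF K])
    fix x y assume xy: "x \<in> carrier G" "y \<in> carrier G" "?c x = ?c y"
    define r where "r = ?r (x <# H)"
    have rc: "r \<in> carrier G" using r xy unfolding r_def by blast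
    have e: "x <# H = y <# H" using xy by simp
    have "(inv r \<otimes> x) <# K = (inv r \<otimes> y) <# K"
      using xy(3) unfolding r_def e by simp
    then have "inv (inv r \<otimes> x) \<otimes> (inv r \<otimes> y) \<in> K"
      using l_coset_eq_iff[OF K] rc xy by simp
    then show "inv x \<otimes> y \<in> K"
      using rc xy by (simp add: inv_mult_group m_assoc)
  qed
qed

text \<open>\<open>N\<close> is the kernel of the action on the left cosets of \<open>H\<close>, so
  its index is bounded by the number of self-maps of a finite set.\<close>

lemma finite_index_core:
  assumes "finite_index G H"
  obtains N where "N \<lhd> G" "N \<subseteq> H" "finite_index G N"
proof -
  have H: "subgroup H G" using assms by (simp add: finite_index_def)
  note Hc = subgroup.mem_carrier[OF H]
  define N where "N = {g \<in> carrier G. \<forall>x\<in>carrier G. inv x \<otimes> g \<otimes> x \<in> H}"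
  have N: "subgroup N G"
  proof (rule subgroupI)
    show "N \<noteq> {}" using subgroup.one_closed[OF H] unfolding N_def by (intro ex_in_conv[THEN iffD1] exI[of _ \<one>]) auto
    fix a assume a: "a \<in> N"
    { fix x assume x: "x \<in> carrier G"
      have "inv (inv x \<otimes> a \<otimes> x) \<in> H" using subgroup.m_inv_closed[OF H] a x by (auto simp: N_def)
      then have "inv x \<otimes> inv a \<otimes> x \<in> H" using a x by (simp add: N_def inv_mult_group m_assoc) }
    then show "inv a \<in> N" using a by (auto simp: N_def)
    fix b assume b: "b \<in> N"
    { fix x assume x: "x \<in> carrier G"
      have "(inv x \<otimes> a \<otimes> x) \<otimes> (inv x \<otimes> b \<otimes> x) \<in> H"
        using subgroup.m_closed[OF H] a b x by (auto simp: N_def)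
      then have "inv x \<otimes> (a \<otimes> b) \<otimes> x \<in> H" using a b x by (simp add: N_def m_assoc) }
    then show "a \<otimes> b \<in> N" using a b by (auto simp: N_def)
  qed (auto simp: N_def)
  have norm: "N \<lhd> G"
    unfolding normal_inv_iff
  proof (intro conjI N ballI)
    fix x h assume x: "x \<in> carrier G" and h: "h \<in> N"
    { fix y assume y: "y \<in> carrier G"
      have "inv (inv x \<otimes> y) \<otimes> h \<otimes> (inv x \<otimes> y) \<in> H" using h x y by (auto simp: N_def)
      then have "inv y \<otimes> (x \<otimes> h \<otimes> inv x) \<otimes> y \<in> H" using h x y by (simp add: N_def inv_mult_group m_assoc) }
    then show "x \<otimes> h \<otimes> inv x \<in> N" using h x by (auto simp: N_def)
  qed
  have sub: "N \<subseteq> H"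
  proof
    fix g assume g: "g \<in> N"
    then have "inv \<one> \<otimes> g \<otimes> \<one> \<in> H" unfolding N_def by blast
    then show "g \<in> H" using g by (simp add: N_def)
  qed
  let ?c = "\<lambda>g. (\<lambda>C\<in>lcosets H. inv g <# C)"
  have c: "inv g <# (x <# H) = (inv g \<otimes> x) <# H" if "g \<in> carrier G" "x \<in> carrier G" for g x
    using that subgroup.subset[OF H] by (simp add: lcos_m_assoc)
  have "inv g <# C \<in> lcosets H" if g: "g \<in> carrier G" and C: "C \<in> lcosets H" for g C
  proof -
    obtain x where "x \<in> carrier G" "C = x <# H" using C by (auto simp: LCOSETS_def)
    with c g show ?thesis by simp
  qed
  then have "?c ` carrier G \<subseteq> (lcosets H) \<rightarrow>\<^sub>E (lcosets H)"
    by auto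
  then have "finite (?c ` carrier G)"
    by (rule finite_subset) (use assms in \<open>auto simp: finite_index_def intro!: finite_PiE\<close>)
  then have "finite_index G N"
  proof (rule finite_indexI[OF N])
    fix g h assume g: "g \<in> carrier G" and h: "h \<in> carrier G" and eq: "?c g = ?c h"
    { fix x assume x: "x \<in> carrier G"
      \<comment> \<open>This coset is sent to the coset of \<open>x\<close> by \<open>inv g\<close>,
        hence also by \<open>inv h\<close>.\<close>
      have "?c g ((g \<otimes> x) <# H) = ?c h ((g \<otimes> x) <# H)" by (simp only: eq)
      then have "x <# H = (inv h \<otimes> (g \<otimes> x)) <# H" using g h x by (simp add: c)
      then have "inv x \<otimes> (inv h \<otimes> (g \<otimes> x)) \<in> H" using g h x by (simp add: l_coset_eq_iff[OF H])
      then have "inv (inv x \<otimes> (inv h \<otimes> (g \<otimes> x))) \<in> H" using subgroup.m_inv_closed[OF H] by blast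
      then have "inv x \<otimes> (inv g \<otimes> h) \<otimes> x \<in> H" using g h x by (simp add: inv_mult_group m_assoc) }
    then show "inv g \<otimes> h \<in> N" using g h by (auto simp: N_def)
  qed
  with norm sub that show thesis by blast
qed

text \<open>Induction along words read from left to right. The starting point \<open>x\<close> is
  arbitrary because in a product \<open>h1 \<otimes> h2\<close> the second factor is applied at
  \<open>x \<otimes> h1\<close>.\<close>

lemma generate_subset_closed:
  assumes "S \<subseteq> carrier G" "g \<in> generate G S" "x \<in> carrier G" "P x"
    and "\<And>x s. x \<in> carrier G \<Longrightarrow> s \<in> S \<Longrightarrow> P x \<Longrightarrow> P (x \<otimes> s)"
    and "\<And>x s. x \<in> carrier G \<Longrightarrow> s \<in> S \<Longrightarrow> P x \<Longrightarrow> P (x \<otimes> inv s)"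
  shows "P (x \<otimes> g)"
  using assms(2-4)
proof (induction g arbitrary: x rule: generate.induct)
  case (eng h1 h2)
  then have "P (x \<otimes> h1)" by blast
  moreover have "h1 \<in> carrier G" "h2 \<in> carrier G" using eng generate_in_carrier assms(1) by blast+
  ultimately have "P (x \<otimes> h1 \<otimes> h2)" using eng by blast
  then show ?case using eng \<open>h1 \<in> carrier G\<close> \<open>h2 \<in> carrier G\<close> by (simp add: m_assoc)
qed (use assms(5,6) in auto)

text \<open>Schreier's generators \<open>t s r(ts)\<inverse>\<close>, where \<open>r\<close> picks representatives of the right cosets.\<close>
lemma finite_index_finitely_generated:
  assumes K: "finite_index G K" and S: "finite S" "S \<subseteq> carrier G" "generate G S = carrier G"
  obtains U where "finite U" "U \<subseteq> K" "generate G U = K"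
proof -
  have sK: "subgroup K G" using K by (simp add: finite_index_def)
  \<comment> \<open>\<open>r x\<close> represents the right coset of \<open>x\<close>, being the
    inverse of a representative of the left coset of \<open>inv x\<close>. The value
    \<open>\<one>\<close> on \<open>K\<close> matters at the end: a representative that lies in
    \<open>K\<close> must be \<open>\<one>\<close>.\<close>
  define r where "r x = (if x \<in> K then \<one> else inv (SOME y. y \<in> carrier G \<and> y <# K = inv x <# K))" for x
  have r: "r x \<in> carrier G \<and> x \<otimes> inv (r x) \<in> K" if x: "x \<in> carrier G" for x
  proof (cases "x \<in> K")
    case False
    define y where "y = (SOME y. y \<in> carrier G \<and> y <# K = inv x <# K)"
    have y: "y \<in> carrier G \<and> y <# K = inv x <# K"
      unfolding y_def by (rule someI[of _ "inv x"]) (use x in auto)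
    then have "inv (inv x) \<otimes> y \<in> K" using l_coset_eq_iff[OF sK, of "inv x" y] x by auto
    then show ?thesis using y False x by (simp add: r_def y_def[symmetric])
  qed (auto simp: r_def x)
  have "r ` carrier G \<subseteq> insert \<one> ((\<lambda>C. inv (SOME y. y \<in> carrier G \<and> y <# K = C)) ` (lcosets K))"
    by (auto simp: r_def)
  then have fr: "finite (r ` carrier G)"
    by (rule finite_subset) (use K in \<open>auto simp: finite_index_def\<close>)
  define T where "T = r ` carrier G"
  define S' where "S' = S \<union> m_inv G ` S"
  define U where "U = (\<lambda>(t, s). t \<otimes> s \<otimes> inv (r (t \<otimes> s))) ` (T \<times> S')"
  have Tc: "T \<subseteq> carrier G" using r by (auto simp: T_def)
  have S'c: "S' \<subseteq> carrier G" using S by (auto simp: S'_def)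
  have fU: "finite U" using fr S by (auto simp: U_def T_def S'_def)
  have UK: "U \<subseteq> K" using r Tc S'c by (auto simp: U_def subset_iff)
  then have Uc: "U \<subseteq> carrier G" using subgroup.subset[OF sK] by blast
  have gU: "subgroup (generate G U) G" using generate_is_subgroup[OF Uc] .
  have gUK: "generate G U \<subseteq> K" using generate_subgroup_incl[OF UK sK] .
  \<comment> \<open>The products \<open>h \<otimes> t\<close> are stable under right multiplication
    by \<open>S'\<close>, since \<open>h\<close> absorbs the generator \<open>t s r(ts)^-1\<close>
    and \<open>r(ts)\<close> is the new \<open>t\<close>.\<close>
  define P where "P x \<longleftrightarrow> (\<exists>h\<in>generate G U. \<exists>t\<in>T. x = h \<otimes> t)" for x
  have step: "P (x \<otimes> s)" if "P x" "s \<in> S'" for x s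
  proof -
    obtain h t where ht: "h \<in> generate G U" "t \<in> T" "x = h \<otimes> t" using \<open>P x\<close> by (auto simp: P_def)
    have c: "h \<in> carrier G" "t \<in> carrier G" "s \<in> carrier G"
      using subgroup.mem_carrier[OF gU ht(1)] ht(2) that(2) Tc S'c by auto
    then have rc: "r (t \<otimes> s) \<in> carrier G" using r m_closed by blast
    have "t \<otimes> s \<otimes> inv (r (t \<otimes> s)) \<in> generate G U"
      by (rule generate.incl) (use ht that in \<open>auto simp: U_def\<close>)
    then have "h \<otimes> (t \<otimes> s \<otimes> inv (r (t \<otimes> s))) \<in> generate G U" using ht generate.eng by metis
    moreover have "x \<otimes> s = h \<otimes> (t \<otimes> s \<otimes> inv (r (t \<otimes> s))) \<otimes> r (t \<otimes> s)"
      using c rc ht by (simp add: m_assoc)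
    moreover have "r (t \<otimes> s) \<in> T" using c by (auto simp: T_def)
    ultimately show ?thesis unfolding P_def by blast
  qed
  have "P \<one>"
  proof -
    have "r \<one> = \<one>" using subgroup.one_closed[OF sK] by (simp add: r_def)
    then have "\<one> \<in> T" by (metis T_def imageI one_closed)
    then show ?thesis unfolding P_def by (intro bexI[of _ \<one>]) (auto intro: generate.one)
  qed
  have all: "P x" if "x \<in> carrier G" for x
  proof -
    have "P (\<one> \<otimes> x)"
      by (rule generate_subset_closed[of S]) (use S that \<open>P \<one>\<close> step in \<open>auto simp: S'_def\<close>)
    then show ?thesis using that by simp
  qed
  have "K \<subseteq> generate G U"
  proof
    fix x assume x: "x \<in> K"
    then have xc: "x \<in> carrier G" using subgroup.mem_carrier[OF sK] by blast
    obtain h t where ht: "h \<in> generate G U" "t \<in> T" "x = h \<otimes> t" using all[OF xc] by (auto simp: P_def)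
    have c: "h \<in> carrier G" "t \<in> carrier G"
      using subgroup.mem_carrier[OF gU ht(1)] ht(2) Tc by auto
    have "t = inv h \<otimes> x" using c ht by simp
    then have "t \<in> K" using x ht gUK subgroup.m_closed[OF sK] subgroup.m_inv_closed[OF sK] by blast
    obtain y where y: "y \<in> carrier G" "t = r y" using ht by (auto simp: T_def)
    have "y \<otimes> inv t \<in> K" using r y by auto
    then have "y \<otimes> inv t \<otimes> t \<in> K" using \<open>t \<in> K\<close> subgroup.m_closed[OF sK] by blast
    then have "y \<in> K" using y c by (simp add: m_assoc)
    then have "t = \<one>" using y by (simp add: r_def)
    then show "x \<in> generate G U" using ht c by simp
  qed
  with gUK have "generate G U = K" by blast
  with fU UK that show thesis by blast
qed

end

section \<open>Polynomial maps into abelian groups\<close>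

text \<open>The order of the factors matters for nonabelian targets, to which the same derivative is
  applied in \<open>filtered_poly_rderiv\<close>.\<close>

definition rderiv :: "('l, 'm) monoid_scheme \<Rightarrow> ('a, 'b) monoid_scheme \<Rightarrow> 'l \<Rightarrow> ('l \<Rightarrow> 'a) \<Rightarrow> 'l \<Rightarrow> 'a" where
  "rderiv L A h f = (\<lambda>x. inv\<^bsub>A\<^esub> (f x) \<otimes>\<^bsub>A\<^esub> f (x \<otimes>\<^bsub>L\<^esub> h))"

text \<open>All \<open>n\<close>-fold derivatives of the map are trivial, so that its degree is less than \<open>n\<close>.\<close>
primrec poly_map :: "('l, 'm) monoid_scheme \<Rightarrow> ('a, 'b) monoid_scheme \<Rightarrow> nat \<Rightarrow> ('l \<Rightarrow> 'a) \<Rightarrow> bool" where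
  "poly_map L A 0 f \<longleftrightarrow> (\<forall>x\<in>carrier L. f x = \<one>\<^bsub>A\<^esub>)"
| "poly_map L A (Suc n) f \<longleftrightarrow>
     f \<in> carrier L \<rightarrow> carrier A \<and> (\<forall>h\<in>carrier L. poly_map L A n (rderiv L A h f))"

text \<open>Products of fewer than \<open>n\<close> elements of \<open>S\<close>, without inverses.
  If \<open>S\<close> generates \<open>L\<close>, a polynomial map of degree less than
  \<open>n\<close> is determined by its values there.\<close>

primrec deg_ball :: "('l, 'm) monoid_scheme \<Rightarrow> 'l set \<Rightarrow> nat \<Rightarrow> 'l set" where
  "deg_ball L S 0 = {}"
| "deg_ball L S (Suc n) =
     insert \<one>\<^bsub>L\<^esub> (deg_ball L S n \<union> (\<lambda>(x, s). x \<otimes>\<^bsub>L\<^esub> s) ` (deg_ball L S n \<times> S))"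

text \<open>Translation permutes the polynomial maps of bounded degree, so the periods common to all
  of them form a normal subgroup; those of a single map need not.\<close>

definition common_periods :: "('l, 'm) monoid_scheme \<Rightarrow> ('a, 'b) monoid_scheme \<Rightarrow> nat \<Rightarrow> 'l set" where
  "common_periods L A n =
     {h \<in> carrier L. \<forall>f. poly_map L A n f \<longrightarrow> (\<forall>x\<in>carrier L. f (x \<otimes>\<^bsub>L\<^esub> h) = f x)}"

lemma common_periodsD:
  assumes "h \<in> common_periods L A n" "poly_map L A n f" "x \<in> carrier L"
  shows "f (x \<otimes>\<^bsub>L\<^esub> h) = f x"
  using assms unfolding common_periods_def by blast

lemma finite_deg_ball: "finite S \<Longrightarrow> finite (deg_ball L S n)"
  by (induction n) auto

lemma deg_ball_closed: "group L \<Longrightarrow> S \<subseteq> carrier L \<Longrightarrow> deg_ball L S n \<subseteq> carrier L"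
proof (induction n)
  case (Suc n)
  then interpret group L by simp
  from Suc show ?case by auto
qed simp

locale poly_maps = L: group L + A: comm_group A
  for L :: "('l, 'm) monoid_scheme" and A :: "('a, 'b) monoid_scheme"
begin

lemma poly_map_cong:
  "(\<And>x. x \<in> carrier L \<Longrightarrow> f x = g x) \<Longrightarrow> poly_map L A n f \<longleftrightarrow> poly_map L A n g"
proof (induction n arbitrary: f g)
  case (Suc n)
  have "poly_map L A n (rderiv L A h f) \<longleftrightarrow> poly_map L A n (rderiv L A h g)" if "h \<in> carrier L" for h
    by (rule Suc.IH) (use Suc.prems that in \<open>auto simp: rderiv_def\<close>)
  with Suc.prems show ?case by (auto simp: Pi_iff)
qed simp

lemma poly_map_closed: "poly_map L A n f \<Longrightarrow> x \<in> carrier L \<Longrightarrow> f x \<in> carrier A"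
  by (cases n) auto

lemma poly_map_Suc: "poly_map L A n f \<Longrightarrow> poly_map L A (Suc n) f"
proof (induction n arbitrary: f)
  case 0
  then show ?case by (auto simp: rderiv_def)
qed auto

lemma poly_map_mono: "poly_map L A n f \<Longrightarrow> n \<le> m \<Longrightarrow> poly_map L A m f"
  by (induction m) (auto simp: le_Suc_eq simp del: poly_map.simps intro: poly_map_Suc)

lemma poly_map_mult:
  "poly_map L A n f \<Longrightarrow> poly_map L A n g \<Longrightarrow> poly_map L A n (\<lambda>x. f x \<otimes>\<^bsub>A\<^esub> g x)"
proof (induction n arbitrary: f g)
  case (Suc n)
  have "poly_map L A n (rderiv L A h (\<lambda>x. f x \<otimes>\<^bsub>A\<^esub> g x))" if h: "h \<in> carrier L" for h
  proof -
    have 1: "poly_map L A n (\<lambda>x. rderiv L A h f x \<otimes>\<^bsub>A\<^esub> rderiv L A h g x)"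
      using Suc h by simp
    have 2: "rderiv L A h f x \<otimes>\<^bsub>A\<^esub> rderiv L A h g x = rderiv L A h (\<lambda>x. f x \<otimes>\<^bsub>A\<^esub> g x) x"
      if "x \<in> carrier L" for x
      using that h Suc.prems[THEN poly_map_closed]
      by (simp add: rderiv_def A.inv_mult A.m_ac)
    show ?thesis by (rule poly_map_cong[THEN iffD1, OF 2 1])
  qed
  with Suc.prems show ?case by (auto simp: Pi_iff)
qed simp

lemma poly_map_inv:
  "poly_map L A n f \<Longrightarrow> poly_map L A n (\<lambda>x. inv\<^bsub>A\<^esub> f x)"
proof (induction n arbitrary: f)
  case (Suc n)
  have "poly_map L A n (rderiv L A h (\<lambda>x. inv\<^bsub>A\<^esub> f x))" if h: "h \<in> carrier L" for h
  proof -
    have 1: "poly_map L A n (\<lambda>x. inv\<^bsub>A\<^esub> rderiv L A h f x)"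
      using Suc h by simp
    have 2: "inv\<^bsub>A\<^esub> rderiv L A h f x = rderiv L A h (\<lambda>x. inv\<^bsub>A\<^esub> f x) x"
      if "x \<in> carrier L" for x
      using that h Suc.prems[THEN poly_map_closed]
      by (simp add: rderiv_def A.inv_mult A.m_ac)
    show ?thesis by (rule poly_map_cong[THEN iffD1, OF 2 1])
  qed
  with Suc.prems show ?case by (auto simp: Pi_iff)
qed simp

text \<open>As \<open>L\<close> need not be abelian, the direction has to be conjugated:
  \<open>x h k = (x k) (k^-1 h k)\<close>.\<close>

lemma poly_map_translate:
  "poly_map L A n f \<Longrightarrow> k \<in> carrier L \<Longrightarrow> poly_map L A n (\<lambda>x. f (x \<otimes>\<^bsub>L\<^esub> k))"
proof (induction n arbitrary: f)
  case (Suc n)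
  have "poly_map L A n (rderiv L A h (\<lambda>x. f (x \<otimes>\<^bsub>L\<^esub> k)))" if h: "h \<in> carrier L" for h
  proof -
    let ?h = "inv\<^bsub>L\<^esub> k \<otimes>\<^bsub>L\<^esub> h \<otimes>\<^bsub>L\<^esub> k"
    have 1: "poly_map L A n (\<lambda>x. rderiv L A ?h f (x \<otimes>\<^bsub>L\<^esub> k))"
      using Suc h by simp
    have 2: "rderiv L A ?h f (x \<otimes>\<^bsub>L\<^esub> k) = rderiv L A h (\<lambda>x. f (x \<otimes>\<^bsub>L\<^esub> k)) x"
      if "x \<in> carrier L" for x
      using that h Suc.prems by (simp add: rderiv_def L.m_assoc)
    show ?thesis by (rule poly_map_cong[THEN iffD1, OF 2 1])
  qed
  with Suc.prems show ?case by (auto simp: Pi_iff)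
qed simp

lemma poly_map_hom:
  assumes "comm_group B" "\<psi> \<in> hom A B"
  shows "poly_map L A n f \<Longrightarrow> poly_map L B n (\<lambda>x. \<psi> (f x))"
proof (induction n arbitrary: f)
  case 0
  then show ?case using hom_one[OF assms(2)] assms(1) by (simp add: comm_group.axioms)
next
  case (Suc n)
  interpret B: poly_maps L B using assms(1) by (simp add: poly_maps_def L.is_group comm_group.axioms)
  interpret h: group_hom A B \<psi>
    by unfold_locales (use assms in auto)
  have "poly_map L B n (rderiv L B h (\<lambda>x. \<psi> (f x)))" if h: "h \<in> carrier L" for h
  proof -
    have 1: "poly_map L B n (\<lambda>x. \<psi> (rderiv L A h f x))"
      using Suc h by simp
    have 2: "\<psi> (rderiv L A h f x) = rderiv L B h (\<lambda>x. \<psi> (f x)) x"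
      if "x \<in> carrier L" for x
      using that h Suc.prems[THEN poly_map_closed] by (simp add: rderiv_def)
    show ?thesis by (rule B.poly_map_cong[THEN iffD1, OF 2 1])
  qed
  with Suc.prems show ?case by (auto simp: Pi_iff)
qed

text \<open>By induction, the derivative along a generator has values in the group generated by its
  values on the smaller ball, and these are quotients of values of \<open>f\<close> on the larger
  one. A walk from \<open>\<one>\<close> to \<open>x\<close> along generators then never leaves the
  group.\<close>

lemma poly_map_values:
  assumes S: "S \<subseteq> carrier L" "generate L S = carrier L"
  shows "poly_map L A n f \<Longrightarrow> x \<in> carrier L \<Longrightarrow> f x \<in> generate A (f ` deg_ball L S n)"
proof (induction n arbitrary: f x)
  case 0
  then show ?case by (simp add: generate.one)
next
  case (Suc n)
  let ?H = "generate A (f ` deg_ball L S (Suc n))"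
  have B: "deg_ball L S (Suc n) \<subseteq> carrier L" using deg_ball_closed[OF L.is_group S(1)] .
  note fc = poly_map_closed[OF Suc.prems(1)]
  have "f ` deg_ball L S (Suc n) \<subseteq> carrier A" using B fc by blast
  then have H: "subgroup ?H A" by (rule A.generate_is_subgroup)
  have d: "rderiv L A s f x \<in> ?H" if s: "s \<in> S" and x: "x \<in> carrier L" for s x
  proof -
    have sc: "s \<in> carrier L" using s S(1) by blast
    then have "rderiv L A s f x \<in> generate A (rderiv L A s f ` deg_ball L S n)"
      using Suc x by simp
    moreover have "rderiv L A s f ` deg_ball L S n \<subseteq> ?H"
    proof
      fix y assume "y \<in> rderiv L A s f ` deg_ball L S n"
      then obtain b where b: "b \<in> deg_ball L S n" "y = inv\<^bsub>A\<^esub> f b \<otimes>\<^bsub>A\<^esub> f (b \<otimes>\<^bsub>L\<^esub> s)"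
        by (auto simp: rderiv_def)
      have "b \<otimes>\<^bsub>L\<^esub> s \<in> deg_ball L S (Suc n)" using b s by force
      then have "f b \<in> ?H" "f (b \<otimes>\<^bsub>L\<^esub> s) \<in> ?H" using b by (auto intro!: generate.incl)
      then show "y \<in> ?H" using b subgroup.m_closed[OF H] subgroup.m_inv_closed[OF H] by blast
    qed
    ultimately show ?thesis using A.generate_subgroup_incl[OF _ H] by blast
  qed
  have "f (\<one>\<^bsub>L\<^esub> \<otimes>\<^bsub>L\<^esub> x) \<in> ?H"
  proof (rule L.generate_subset_closed[of S _ _ "\<lambda>x. f x \<in> ?H"])
    show "f \<one>\<^bsub>L\<^esub> \<in> ?H" by (rule generate.incl) simp
    fix x s assume x: "x \<in> carrier L" and s: "s \<in> S" and fx: "f x \<in> ?H"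
    have sc: "s \<in> carrier L" using s S(1) by blast
    have "f (x \<otimes>\<^bsub>L\<^esub> s) = f x \<otimes>\<^bsub>A\<^esub> rderiv L A s f x"
      using x sc fc by (simp add: rderiv_def)
    then show "f (x \<otimes>\<^bsub>L\<^esub> s) \<in> ?H" using fx d[OF s x] subgroup.m_closed[OF H] by simp
    \<comment> \<open>A step along an inverse generator is undone by the derivative at the point
      where the step ends.\<close>
    have "f (x \<otimes>\<^bsub>L\<^esub> inv\<^bsub>L\<^esub> s) = f x \<otimes>\<^bsub>A\<^esub> inv\<^bsub>A\<^esub> rderiv L A s f (x \<otimes>\<^bsub>L\<^esub> inv\<^bsub>L\<^esub> s)"
      using x sc fc by (simp add: rderiv_def A.inv_mult_group L.m_assoc)
    moreover have "rderiv L A s f (x \<otimes>\<^bsub>L\<^esub> inv\<^bsub>L\<^esub> s) \<in> ?H" using d s x sc by simp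
    ultimately show "f (x \<otimes>\<^bsub>L\<^esub> inv\<^bsub>L\<^esub> s) \<in> ?H"
      using fx subgroup.m_closed[OF H] subgroup.m_inv_closed[OF H] by simp
  qed (use S Suc.prems in auto)
  then show ?case using Suc.prems by simp
qed

text \<open>The quotient of the two maps obeys the same degree bound and is trivial on the ball, so
  \<open>poly_map_values\<close> makes it trivial everywhere.\<close>

lemma poly_map_eqI:
  assumes S: "S \<subseteq> carrier L" "generate L S = carrier L"
    and f: "poly_map L A n f" and g: "poly_map L A n g"
    and eq: "\<And>b. b \<in> deg_ball L S n \<Longrightarrow> f b = g b" and x: "x \<in> carrier L"
  shows "f x = g x"
proof -
  let ?d = "\<lambda>x. f x \<otimes>\<^bsub>A\<^esub> inv\<^bsub>A\<^esub> g x"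
  have c: "f y \<in> carrier A" "g y \<in> carrier A" if "y \<in> carrier L" for y
    using that f g poly_map_closed by blast+
  have "poly_map L A n ?d" using poly_map_mult[OF f poly_map_inv[OF g]] .
  then have "?d x \<in> generate A (?d ` deg_ball L S n)" using poly_map_values[OF S] x by blast
  moreover have "?d ` deg_ball L S n \<subseteq> {\<one>\<^bsub>A\<^esub>}"
    using eq c deg_ball_closed[OF L.is_group S(1)] by (auto simp: subset_iff)
  then have "generate A (?d ` deg_ball L S n) \<subseteq> {\<one>\<^bsub>A\<^esub>}"
    using A.generate_subgroup_incl[OF _ A.triv_subgroup] by blast
  ultimately have "?d x = \<one>\<^bsub>A\<^esub>" by blast
  then show ?thesis using c[OF x] by (metis A.inv_equality A.inv_inv A.inv_closed)
qed

lemma common_periods_normal: "common_periods L A n \<lhd> L"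
proof -
  let ?K = "common_periods L A n"
  have K: "subgroup ?K L"
  proof (rule L.subgroupI)
    have "\<one>\<^bsub>L\<^esub> \<in> ?K" by (simp add: common_periods_def)
    then show "?K \<noteq> {}" by blast
    fix a assume a: "a \<in> ?K"
    { fix f x assume f: "poly_map L A n f" and x: "x \<in> carrier L"
      have "f (x \<otimes>\<^bsub>L\<^esub> inv\<^bsub>L\<^esub> a \<otimes>\<^bsub>L\<^esub> a) = f (x \<otimes>\<^bsub>L\<^esub> inv\<^bsub>L\<^esub> a)"
        using a f x by (simp add: common_periods_def del: L.m_assoc)
      then have "f (x \<otimes>\<^bsub>L\<^esub> inv\<^bsub>L\<^esub> a) = f x" using a x by (simp add: common_periods_def L.m_assoc) }
    then show "inv\<^bsub>L\<^esub> a \<in> ?K" using a by (simp add: common_periods_def)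
    fix b assume b: "b \<in> ?K"
    { fix f x assume f: "poly_map L A n f" and x: "x \<in> carrier L"
      have "f (x \<otimes>\<^bsub>L\<^esub> a \<otimes>\<^bsub>L\<^esub> b) = f (x \<otimes>\<^bsub>L\<^esub> a)"
        using a b f x by (simp add: common_periods_def)
      then have "f (x \<otimes>\<^bsub>L\<^esub> (a \<otimes>\<^bsub>L\<^esub> b)) = f x" using a b f x by (simp add: common_periods_def L.m_assoc) }
    then show "a \<otimes>\<^bsub>L\<^esub> b \<in> ?K" using a b by (simp add: common_periods_def)
  qed (auto simp: common_periods_def)
  show ?thesis
    unfolding L.normal_inv_iff
  proof (intro conjI K ballI)
    fix k h assume k: "k \<in> carrier L" and h: "h \<in> ?K"
    { fix f x assume f: "poly_map L A n f" and x: "x \<in> carrier L"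
      \<comment> \<open>\<open>h\<close> is also a period of the translate of \<open>f\<close> by
        \<open>k^-1\<close>; evaluating that at \<open>x k\<close> gives the conjugate as a period
        of \<open>f\<close>.\<close>
      have "poly_map L A n (\<lambda>x. f (x \<otimes>\<^bsub>L\<^esub> inv\<^bsub>L\<^esub> k))" using f k poly_map_translate by simp
      then have "f ((x \<otimes>\<^bsub>L\<^esub> k) \<otimes>\<^bsub>L\<^esub> h \<otimes>\<^bsub>L\<^esub> inv\<^bsub>L\<^esub> k) = f ((x \<otimes>\<^bsub>L\<^esub> k) \<otimes>\<^bsub>L\<^esub> inv\<^bsub>L\<^esub> k)"
        using common_periodsD[OF h, of "\<lambda>x. f (x \<otimes>\<^bsub>L\<^esub> inv\<^bsub>L\<^esub> k)" "x \<otimes>\<^bsub>L\<^esub> k"] k x by simp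
      then have "f (x \<otimes>\<^bsub>L\<^esub> (k \<otimes>\<^bsub>L\<^esub> h \<otimes>\<^bsub>L\<^esub> inv\<^bsub>L\<^esub> k)) = f x"
        using h k x by (simp add: common_periods_def L.m_assoc) }
    then show "k \<otimes>\<^bsub>L\<^esub> h \<otimes>\<^bsub>L\<^esub> inv\<^bsub>L\<^esub> k \<in> ?K" using h k by (simp add: common_periods_def)
  qed
qed

text \<open>A polynomial map of bounded degree is determined by its restriction to a finite ball \<open>B\<close>, so
  only finitely many of them take values in a finite group, and \<open>L\<close> permutes them by translation.\<close>
lemma finite_index_common_periods:
  assumes "finite (carrier A)" "finite S" "S \<subseteq> carrier L" "generate L S = carrier L"
  shows "finite_index L (common_periods L A n)"
proof -
  define B where "B = deg_ball L S n"
  have B: "finite B" "B \<subseteq> carrier L"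
    unfolding B_def using finite_deg_ball deg_ball_closed L.is_group assms by blast+
  \<comment> \<open>The restrictions to \<open>B\<close> of \<open>f\<close> and of its translate by
    \<open>h\<close>, collected over all \<open>f\<close>. If \<open>c h = c k\<close>, some
    \<open>g\<close> agrees with \<open>f\<close> on \<open>B\<close>, hence everywhere, and
    likewise the translate of \<open>g\<close> by \<open>k\<close> agrees with that of
    \<open>f\<close> by \<open>h\<close>.\<close>
  define c where "c h = (\<lambda>f. (restrict f B, restrict (\<lambda>x. f (x \<otimes>\<^bsub>L\<^esub> h)) B)) ` Collect (poly_map L A n)" for h
  let ?E = "B \<rightarrow>\<^sub>E carrier A"
  have "c h \<subseteq> ?E \<times> ?E" if "h \<in> carrier L" for h
    using B that poly_map_closed by (auto simp: c_def restrict_def PiE_def extensional_def subset_iff)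
  then have "c ` carrier L \<subseteq> Pow (?E \<times> ?E)" by blast
  then have "finite (c ` carrier L)"
    by (rule finite_subset) (use assms(1) B in \<open>auto intro!: finite_PiE\<close>)
  then show ?thesis
  proof (rule L.finite_indexI[OF normal_imp_subgroup[OF common_periods_normal]])
    fix h k assume h: "h \<in> carrier L" and k: "k \<in> carrier L" and eq: "c h = c k"
    { fix f x assume f: "poly_map L A n f" and x: "x \<in> carrier L"
      from f have "(restrict f B, restrict (\<lambda>x. f (x \<otimes>\<^bsub>L\<^esub> h)) B) \<in> c k"
        unfolding eq[symmetric] by (auto simp: c_def)
      then obtain g where g: "poly_map L A n g" "restrict f B = restrict g B"
        "restrict (\<lambda>x. f (x \<otimes>\<^bsub>L\<^esub> h)) B = restrict (\<lambda>x. g (x \<otimes>\<^bsub>L\<^esub> k)) B"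
        by (auto simp: c_def)
      have 1: "f y = g y" if "y \<in> carrier L" for y
        by (rule poly_map_eqI[OF assms(3,4) f g(1) _ that])
          (use g(2) in \<open>metis B_def restrict_apply'\<close>)
      have 2: "f (y \<otimes>\<^bsub>L\<^esub> h) = g (y \<otimes>\<^bsub>L\<^esub> k)" if "y \<in> carrier L" for y
        by (rule poly_map_eqI[OF assms(3,4) poly_map_translate[OF f h] poly_map_translate[OF g(1) k] _ that])
          (use g(3) in \<open>metis (no_types, lifting) B_def restrict_apply'\<close>)
      have "f (x \<otimes>\<^bsub>L\<^esub> inv\<^bsub>L\<^esub> h \<otimes>\<^bsub>L\<^esub> h) = f (x \<otimes>\<^bsub>L\<^esub> inv\<^bsub>L\<^esub> h \<otimes>\<^bsub>L\<^esub> k)"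
        using 1 2 x h k by simp
      then have "f (x \<otimes>\<^bsub>L\<^esub> (inv\<^bsub>L\<^esub> h \<otimes>\<^bsub>L\<^esub> k)) = f x" using x h k by (simp add: L.m_assoc) }
    then show "inv\<^bsub>L\<^esub> h \<otimes>\<^bsub>L\<^esub> k \<in> common_periods L A n"
      using h k by (simp add: common_periods_def)
  qed
qed

end

section \<open>Zeros of integer-valued polynomial maps\<close>

text \<open>Bonferroni's inequality of order two.\<close>

lemma sum_card_le_card_UN:
  fixes r :: nat
  assumes "\<And>i. finite (A i)"
  shows "(\<Sum>i<r. card (A i)) \<le> card (\<Union>i<r. A i) + (\<Sum>j<r. \<Sum>i<j. card (A i \<inter> A j))"
proof (induction r)
  case (Suc r)
  let ?U = "\<Union>i<r. A i"
  have fin: "finite ?U" using assms by blast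
  have "?U \<inter> A r = (\<Union>i<r. A i \<inter> A r)" by blast
  then have "card (?U \<inter> A r) \<le> (\<Sum>i<r. card (A i \<inter> A r))"
    using card_UN_le[of "{..<r}" "\<lambda>i. A i \<inter> A r"] by simp
  moreover have "card ?U + card (A r) = card (?U \<union> A r) + card (?U \<inter> A r)"
    using card_Un_Int[OF fin assms] .
  moreover have "(\<Union>i<Suc r. A i) = ?U \<union> A r" by (auto simp: less_Suc_eq)
  ultimately show ?case using Suc by simp
qed simp

lemma mod_hom: "(\<lambda>z. z mod int m) \<in> hom integer_group (integer_mod_group m)"
  by (cases "m = 0") (auto simp: hom_def carrier_integer_mod_group mod_add_eq)

lemma (in normal) l_coset_r_mult:
  assumes "x \<in> carrier G" "h \<in> carrier G"
  shows "(x <# H) #> h = (x \<otimes> h) <# H"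
  using assms coset_eq coset_mult_assoc[OF subset] m_closed by metis

lemma (in group) inj_on_r_coset:
  assumes "h \<in> carrier G"
  shows "inj_on (\<lambda>C. C #> h) (Pow (carrier G))"
proof (rule inj_on_inverseI)
  fix C assume "C \<in> Pow (carrier G)"
  then show "(C #> h) #> inv h = C"
    using assms by (simp add: coset_mult_assoc)
qed

locale int_poly_maps = L: group L for L :: "('l, 'm) monoid_scheme"
begin

sublocale poly_maps L integer_group
  by (simp add: poly_maps_def L.is_group abelian_integer_group)

text \<open>The derivative in the direction \<open>x\<close> has finite range too, so it is constant
  by induction. Along the powers of \<open>x\<close> the map is then an arithmetic progression, and
  finite range forces the difference to be 0.\<close>

lemma finite_range_poly_map_const:
  "poly_map L integer_group n f \<Longrightarrow> finite (f ` carrier L) \<Longrightarrow> x \<in> carrier L \<Longrightarrow> f x = f \<one>\<^bsub>L\<^esub>"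
proof (induction n arbitrary: f x)
  case (Suc n)
  define g where "g = rderiv L integer_group x f"
  have g: "g y = f (y \<otimes>\<^bsub>L\<^esub> x) - f y" for y by (simp add: g_def rderiv_def)
  have "poly_map L integer_group n g" using Suc.prems by (simp add: g_def)
  moreover have "g ` carrier L \<subseteq> (\<lambda>(a, b). a - b) ` (f ` carrier L \<times> f ` carrier L)"
    using Suc.prems(3) by (force simp: g)
  then have "finite (g ` carrier L)" by (rule finite_subset) (use Suc.prems in auto)
  ultimately have gc: "g y = g \<one>\<^bsub>L\<^esub>" if "y \<in> carrier L" for y using Suc.IH that by blast
  have p: "f (x [^]\<^bsub>L\<^esub> j) = f \<one>\<^bsub>L\<^esub> + int j * g \<one>\<^bsub>L\<^esub>" for j :: nat
  proof (induction j)
    case (Suc j)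
    then show ?case using gc[of "x [^]\<^bsub>L\<^esub> j"] \<open>x \<in> carrier L\<close> by (simp add: g algebra_simps)
  qed simp
  have "g \<one>\<^bsub>L\<^esub> = 0"
  proof (rule ccontr)
    assume "g \<one>\<^bsub>L\<^esub> \<noteq> 0"
    then have "inj (\<lambda>j::nat. f (x [^]\<^bsub>L\<^esub> j))" by (auto simp: p inj_on_def)
    moreover have "range (\<lambda>j::nat. f (x [^]\<^bsub>L\<^esub> j)) \<subseteq> f ` carrier L" using Suc.prems by auto
    ultimately show False using Suc.prems(2) by (meson finite_subset infinite_UNIV_nat finite_imageD)
  qed
  then show ?case using p[of 1] Suc.prems by simp
qed simp

text \<open>\<open>D\<close> is an upper bound for the degree that stays fixed during the density
  estimate, so a map and all its derivatives are periodic modulo \<open>m\<close> with respect to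
  the same subgroup.\<close>

abbreviation periods_mod :: "nat \<Rightarrow> nat \<Rightarrow> 'l set" where
  "periods_mod D m \<equiv> common_periods L (integer_mod_group m) D"

lemma periods_mod_normal: "periods_mod D m \<lhd> L"
  by (rule poly_maps.common_periods_normal) (simp add: poly_maps_def L.is_group)

lemma periods_mod_dvd_iff:
  assumes "poly_map L integer_group D f" "x \<in> carrier L" "y \<in> x <#\<^bsub>L\<^esub> periods_mod D m"
  shows "int m dvd f y \<longleftrightarrow> int m dvd f x"
proof -
  obtain h where h: "h \<in> periods_mod D m" "y = x \<otimes>\<^bsub>L\<^esub> h" using assms(3) by (auto simp: l_coset_def)
  have "poly_map L (integer_mod_group m) D (\<lambda>x. f x mod int m)"
    using poly_map_hom[OF abelian_integer_mod_group mod_hom assms(1)] .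
  from common_periodsD[OF h(1) this assms(2)]
  have "f y mod int m = f x mod int m" by (simp add: h(2))
  then show ?thesis by (simp add: dvd_eq_mod_eq_0)
qed

text \<open>Induction on the degree. Choose \<open>h\<^sub>0, \<dots>, h\<^sub>r\<^sub>-\<^sub>1\<close> such that the values \<open>f h\<^sub>i\<close> are distinct. Then
  the derivatives of \<open>f\<close> in the directions \<open>h\<^sub>i\<inverse> h\<^sub>j\<close> do not vanish identically, so the translates
  of the zero set of \<open>f\<close> modulo \<open>m\<close> by the \<open>h\<^sub>i\<close> are almost disjoint, and hence its density is at most
  about \<open>1/r\<close>.\<close>
lemma poly_map_zero_density:
  assumes S: "finite S" "S \<subseteq> carrier L" "generate L S = carrier L"
  shows "poly_map L integer_group n f \<Longrightarrow> n \<le> D \<Longrightarrow> \<exists>x\<in>carrier L. f x \<noteq> 0 \<Longrightarrow> \<epsilon> > 0 \<Longrightarrow>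
    \<exists>m0>0. \<forall>m>0. m0 dvd m \<longrightarrow>
      real (card {C \<in> lcosets\<^bsub>L\<^esub> (periods_mod D m). \<exists>x\<in>C. int m dvd f x})
        \<le> \<epsilon> * real (card (lcosets\<^bsub>L\<^esub> (periods_mod D m)))"
proof (induction n arbitrary: f \<epsilon>)
  case 0
  then show ?case by auto
next
  case (Suc n)
  define X where "X m = lcosets\<^bsub>L\<^esub> (periods_mod D m)" for m
  define W where "W m f = {C \<in> X m. \<exists>x\<in>C. int m dvd f x}" for m and f :: "'l \<Rightarrow> int"
  have finX: "finite (X m)" if "m > 0" for m
  proof -
    have "finite (carrier (integer_mod_group m))"
      using that by (simp add: carrier_integer_mod_group)
    moreover have "poly_maps L (integer_mod_group m)" by (simp add: poly_maps_def L.is_group)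
    ultimately have "finite_index L (periods_mod D m)"
      using poly_maps.finite_index_common_periods S by blast
    then show ?thesis by (simp add: X_def finite_index_def)
  qed
  have Xsub: "X m \<subseteq> Pow (carrier L)" for m
    unfolding X_def using L.lcosets_subset_PowG normal_imp_subgroup[OF periods_mod_normal] by blast
  show ?case
  proof (cases "finite (f ` carrier L)")
    case True
    define c where "c = f \<one>\<^bsub>L\<^esub>"
    have c: "f x = c" if "x \<in> carrier L" for x
      using finite_range_poly_map_const[OF Suc.prems(1) True that] by (simp add: c_def)
    then have "c \<noteq> 0" using Suc.prems(3) by auto
    \<comment> \<open>The modulus exceeds the absolute value of the nonzero constant
      \<open>c\<close> and cannot divide it.\<close>
    { fix m :: nat assume m: "m > 0" "nat \<bar>c\<bar> + 1 dvd m"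
      then have "nat \<bar>c\<bar> + 1 \<le> m" by (simp add: dvd_imp_le)
      then have "\<not> int m dvd c" using \<open>c \<noteq> 0\<close> dvd_imp_le_int[of c "int m"] by auto
      then have "W m f = {}" using c Xsub by (auto simp: W_def)
      then have "real (card (W m f)) \<le> \<epsilon> * real (card (X m))" using Suc.prems(4) by simp }
    then show ?thesis unfolding W_def X_def by (intro exI[of _ "nat \<bar>c\<bar> + 1"]) auto
  next
    case False
    \<comment> \<open>Chosen such that \<open>1 + r \<epsilon> / 2 \<le> r \<epsilon>\<close>, which
      closes the count at the end.\<close>
    define r where "r = nat \<lceil>2 / \<epsilon>\<rceil> + 1"
    have r: "r > 0" "2 / \<epsilon> \<le> real r" unfolding r_def by linarith+
    obtain V where V: "V \<subseteq> f ` carrier L" "finite V" "card V = r"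
      using infinite_arbitrarily_large[OF False] by blast
    then obtain v where v: "bij_betw v {..<r} V" by (metis ex_bij_betw_nat_finite lessThan_atLeast0)
    then have "\<forall>i<r. \<exists>h\<in>carrier L. f h = v i" using V(1) by (force simp: bij_betw_def)
    then obtain h where h: "\<And>i. i < r \<Longrightarrow> h i \<in> carrier L" "\<And>i. i < r \<Longrightarrow> f (h i) = v i" by metis
    define g where "g i j = rderiv L integer_group (inv\<^bsub>L\<^esub> h i \<otimes>\<^bsub>L\<^esub> h j) f" for i j
    have gv: "g i j (x \<otimes>\<^bsub>L\<^esub> h i) = f (x \<otimes>\<^bsub>L\<^esub> h j) - f (x \<otimes>\<^bsub>L\<^esub> h i)"
      if "x \<in> carrier L" "i < r" "j < r" for x i j
      using that h by (simp add: g_def rderiv_def L.m_assoc)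
    have gp: "poly_map L integer_group n (g i j)" if "i < r" "j < r" for i j
      using Suc.prems(1) that h by (simp add: g_def)
    have gn: "\<exists>x\<in>carrier L. g i j x \<noteq> 0" if "i < r" "j < r" "i \<noteq> j" for i j
    proof (rule bexI[of _ "\<one>\<^bsub>L\<^esub> \<otimes>\<^bsub>L\<^esub> h i"])
      have "v i \<noteq> v j" using v that by (auto simp: bij_betw_def inj_on_def)
      then show "g i j (\<one>\<^bsub>L\<^esub> \<otimes>\<^bsub>L\<^esub> h i) \<noteq> 0"
        using that h by (subst gv) auto
    qed (use that h in auto)
    \<comment> \<open>At most \<open>r^2\<close> pairs overlap, so the overlaps contribute at most
      \<open>r^2 \<eta> = r \<epsilon> / 2\<close> times the number of cosets.\<close>
    define \<eta> where "\<eta> = \<epsilon> / (2 * real r)"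
    have \<eta>: "\<eta> > 0" using Suc.prems(4) r by (simp add: \<eta>_def)
    have "\<exists>m0>0. \<forall>m>0. m0 dvd m \<longrightarrow> real (card (W m (g i j))) \<le> \<eta> * real (card (X m))"
      if "i < r" "j < r" "i \<noteq> j" for i j
      unfolding W_def X_def
      by (rule Suc.IH[OF gp _ gn]) (use that Suc.prems \<eta> in auto)
    then obtain m0 where m0: "\<And>i j. i < r \<Longrightarrow> j < r \<Longrightarrow> i \<noteq> j \<Longrightarrow> m0 i j > 0"
      "\<And>i j m. i < r \<Longrightarrow> j < r \<Longrightarrow> i \<noteq> j \<Longrightarrow> m > 0 \<Longrightarrow> m0 i j dvd m \<Longrightarrow>
        real (card (W m (g i j))) \<le> \<eta> * real (card (X m))" for i j m
      by metis
    \<comment> \<open>A common multiple of the moduli of all pairs; for its sake the claim is made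
      for all multiples of \<open>m0\<close>.\<close>
    define M :: nat where "M = (\<Prod>j<r. \<Prod>i<j. m0 i j)"
    have M: "M > 0" unfolding M_def by (intro prod_pos) (use m0(1) in auto)
    have Md: "m0 i j dvd M" if "j < r" "i < j" for i j
    proof -
      have "m0 i j dvd (\<Prod>i<j. m0 i j)" using that by (intro dvd_prodI) auto
      also have "\<dots> dvd M" unfolding M_def using that by (intro dvd_prodI) auto
      finally show ?thesis .
    qed
    { fix m assume m: "m > 0" "M dvd m"
      interpret K: normal "periods_mod D m" L by (rule periods_mod_normal)
      \<comment> \<open>The zero cosets modulo \<open>m\<close>, translated back by
        \<open>h i\<close>. The period subgroup is normal, so right translation permutes its left
        cosets and every \<open>A i\<close> has the size of \<open>W m f\<close>.\<close>
      define A where "A i = {C \<in> X m. C #>\<^bsub>L\<^esub> h i \<in> W m f}" for i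
      have shift: "(x <#\<^bsub>L\<^esub> periods_mod D m) #>\<^bsub>L\<^esub> h i = (x \<otimes>\<^bsub>L\<^esub> h i) <#\<^bsub>L\<^esub> periods_mod D m"
        if "x \<in> carrier L" "i < r" for x i
        using that h K.l_coset_r_mult by simp
      have shiftX: "C #>\<^bsub>L\<^esub> h i \<in> X m" if C: "C \<in> X m" and i: "i < r" for C i
      proof -
        obtain x where "x \<in> carrier L" "C = x <#\<^bsub>L\<^esub> periods_mod D m"
          using C by (auto simp: X_def LCOSETS_def)
        then show ?thesis using shift i h by (simp add: X_def)
      qed
      have inj: "inj_on (\<lambda>C. C #>\<^bsub>L\<^esub> h i) (X m)" if "i < r" for i
        using inj_on_subset[OF L.inj_on_r_coset Xsub] h that by blast
      have surj: "(\<lambda>C. C #>\<^bsub>L\<^esub> h i) ` X m = X m" if "i < r" for i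
        using endo_inj_surj[OF finX[OF m(1)] _ inj[OF that]] shiftX that by blast
      have cardA: "card (A i) = card (W m f)" if "i < r" for i
      proof -
        have "(\<lambda>C. C #>\<^bsub>L\<^esub> h i) ` A i = {E \<in> (\<lambda>C. C #>\<^bsub>L\<^esub> h i) ` X m. E \<in> W m f}"
          unfolding A_def by blast
        also have "\<dots> = W m f" unfolding surj[OF that] by (auto simp: W_def)
        finally have "(\<lambda>C. C #>\<^bsub>L\<^esub> h i) ` A i = W m f" .
        moreover have "inj_on (\<lambda>C. C #>\<^bsub>L\<^esub> h i) (A i)"
          using inj[OF that] by (rule inj_on_subset) (auto simp: A_def)
        ultimately show ?thesis by (metis card_image)
      qed
      have Wiff: "int m dvd f x" if "x <#\<^bsub>L\<^esub> periods_mod D m \<in> W m f" "x \<in> carrier L" for x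
        using that periods_mod_dvd_iff[OF poly_map_mono[OF Suc.prems(1,2)] that(2)]
        by (auto simp: W_def)
      have cardAA: "real (card (A i \<inter> A j)) \<le> \<eta> * real (card (X m))" if ij: "i < r" "j < r" "i \<noteq> j" "m0 i j dvd m" for i j
      proof -
        \<comment> \<open>If \<open>f\<close> vanishes modulo \<open>m\<close> at
          \<open>x h_i\<close> and at \<open>x h_j\<close>, then \<open>g i j\<close> vanishes
          modulo \<open>m\<close> at \<open>x h_i\<close>.\<close>
        have "(\<lambda>C. C #>\<^bsub>L\<^esub> h i) ` (A i \<inter> A j) \<subseteq> W m (g i j)"
        proof
          fix E assume "E \<in> (\<lambda>C. C #>\<^bsub>L\<^esub> h i) ` (A i \<inter> A j)"
          then obtain C where C: "C \<in> A i" "C \<in> A j" "E = C #>\<^bsub>L\<^esub> h i" by blast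
          then have "C \<in> X m" by (simp add: A_def)
          then obtain x where x: "x \<in> carrier L" "C = x <#\<^bsub>L\<^esub> periods_mod D m"
            by (auto simp: X_def LCOSETS_def)
          have "int m dvd f (x \<otimes>\<^bsub>L\<^esub> h i)" "int m dvd f (x \<otimes>\<^bsub>L\<^esub> h j)"
            using C x ij h by (auto simp: A_def shift intro!: Wiff)
          then have "int m dvd g i j (x \<otimes>\<^bsub>L\<^esub> h i)" using gv x ij by simp
          moreover have "E = (x \<otimes>\<^bsub>L\<^esub> h i) <#\<^bsub>L\<^esub> periods_mod D m"
            using C x shift ij by simp
          moreover have "x \<otimes>\<^bsub>L\<^esub> h i \<in> carrier L" using x h ij by simp
          then have "x \<otimes>\<^bsub>L\<^esub> h i \<in> (x \<otimes>\<^bsub>L\<^esub> h i) <#\<^bsub>L\<^esub> periods_mod D m"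
            using L.lcos_self K.subgroup_axioms by blast
          ultimately show "E \<in> W m (g i j)"
            using \<open>x \<otimes>\<^bsub>L\<^esub> h i \<in> carrier L\<close> by (auto simp: W_def X_def)
        qed
        moreover have "finite (W m (g i j))" using finX m by (simp add: W_def)
        moreover have "inj_on (\<lambda>C. C #>\<^bsub>L\<^esub> h i) (A i \<inter> A j)"
          using inj[OF ij(1)] by (rule inj_on_subset) (auto simp: A_def)
        ultimately have "card (A i \<inter> A j) \<le> card (W m (g i j))"
          using card_inj_on_le by blast
        then have "real (card (A i \<inter> A j)) \<le> real (card (W m (g i j)))" by simp
        also have "\<dots> \<le> \<eta> * real (card (X m))" using m0(2) ij m by blast
        finally show ?thesis .
      qed
      have fA: "finite (A i)" for i using finX m by (simp add: A_def)
      have "real r * real (card (W m f)) = real (\<Sum>i<r. card (A i))" by (simp add: cardA)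
      also have "\<dots> \<le> real (card (\<Union>i<r. A i) + (\<Sum>j<r. \<Sum>i<j. card (A i \<inter> A j)))"
        by (intro of_nat_mono sum_card_le_card_UN fA)
      also have "\<dots> = real (card (\<Union>i<r. A i)) + (\<Sum>j<r. \<Sum>i<j. real (card (A i \<inter> A j)))" by simp
      also have "\<dots> \<le> real (card (X m)) + (\<Sum>j<r. \<Sum>i<r. \<eta> * real (card (X m)))"
      proof (intro add_mono sum_mono)
        show "real (card (\<Union>i<r. A i)) \<le> real (card (X m))"
          using finX m by (auto intro!: card_mono simp: A_def)
        fix j assume j: "j \<in> {..<r}"
        have "(\<Sum>i<j. real (card (A i \<inter> A j))) \<le> (\<Sum>i<j. \<eta> * real (card (X m)))"
          using j cardAA Md m by (intro sum_mono) (auto intro: dvd_trans)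
        also have "\<dots> \<le> (\<Sum>i<r. \<eta> * real (card (X m)))"
          by (rule sum_mono2) (use j \<eta> in auto)
        finally show "(\<Sum>i<j. real (card (A i \<inter> A j))) \<le> (\<Sum>i<r. \<eta> * real (card (X m)))" .
      qed
      also have "\<dots> = (1 + real r * \<epsilon> / 2) * real (card (X m))"
        using r by (simp add: \<eta>_def field_simps)
      also have "\<dots> \<le> (real r * \<epsilon>) * real (card (X m))"
        using r(2) Suc.prems(4) by (intro mult_right_mono) (auto simp: field_simps)
      finally have "real (card (W m f)) \<le> \<epsilon> * real (card (X m))"
        using r(1) by simp }
    then show ?thesis using M unfolding W_def X_def by blast
  qed
qed

end

section \<open>Homomorphisms to the integers\<close>

lemma (in comm_group) subgroup_imp_comm_group:
  assumes "subgroup H G"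
  shows "comm_group (G\<lparr>carrier := H\<rparr>)"
  by (rule group.group_comm_groupI[OF subgroup_imp_group[OF assms]])
    (use subgroup.mem_carrier[OF assms] in \<open>auto intro: m_comm\<close>)

text \<open>Generators are adjoined to \<open>A\<close> until the index becomes finite. At that
  moment \<open>A1\<close>, generated by \<open>A\<close> and \<open>b\<close>, has finite index
  while \<open>A\<close> has not, so \<open>A1\<close> modulo \<open>A\<close> is infinite cyclic.
  With \<open>q\<close> the index of \<open>A1\<close>, the map sends \<open>x\<close> to the
  exponent of \<open>b\<close> in \<open>x^q\<close> modulo \<open>A\<close>.\<close>

lemma (in comm_group) ex_int_hom_extension:
  assumes "finite S"
  shows "S \<subseteq> carrier G \<Longrightarrow> subgroup A G \<Longrightarrow> generate G (A \<union> S) = carrier G \<Longrightarrow> \<not> finite_index G A \<Longrightarrow>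
    \<exists>\<psi>\<in>hom G integer_group. (\<forall>a\<in>A. \<psi> a = 0) \<and> (\<exists>b\<in>carrier G. \<psi> b \<noteq> 0)"
  using assms
proof (induction S arbitrary: A rule: finite_induct)
  case empty
  have "generate G A = A" using generateI[OF empty(2)] by auto
  then have "A = carrier G" using empty(3) by simp
  have "finite_index G (carrier G)"
    by (rule finite_indexI[of _ "\<lambda>_. ()"]) (auto intro: subgroup_self)
  with empty(4) \<open>A = carrier G\<close> show ?case by simp
next
  case (insert b S)
  have A: "subgroup A G" and b: "b \<in> carrier G" using insert.prems by auto
  note Ac = subgroup.mem_carrier[OF A] and Am = subgroup.m_closed[OF A] and Ai = subgroup.m_inv_closed[OF A]
  define A1 where "A1 = generate G (insert b A)"
  have sub: "insert b A \<subseteq> carrier G" using A b Ac by auto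
  have A1: "subgroup A1 G" unfolding A1_def by (rule generate_is_subgroup[OF sub])
  have AA1: "A \<subseteq> A1" "b \<in> A1" unfolding A1_def by (auto intro: generate.incl)
  show ?case
  proof (cases "finite_index G A1")
    case False
    have "generate G (A \<union> insert b S) \<subseteq> generate G (A1 \<union> S)"
      by (rule mono_generate) (use AA1 in auto)
    moreover have "generate G (A1 \<union> S) \<subseteq> carrier G"
      by (rule generate_incl) (use subgroup.subset[OF A1] insert.prems in auto)
    ultimately have "generate G (A1 \<union> S) = carrier G" using insert.prems by simp
    then have "\<exists>\<psi>\<in>hom G integer_group. (\<forall>a\<in>A1. \<psi> a = 0) \<and> (\<exists>b\<in>carrier G. \<psi> b \<noteq> 0)"
      using insert.IH[OF _ A1 _ False] insert.prems(1) by blast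
    with AA1 show ?thesis by blast
  next
    case True
    have rep: "\<exists>n::int. inv (b [^] n) \<otimes> x \<in> A" if "x \<in> A1" for x
      using that unfolding A1_def
    proof (induction x rule: generate.induct)
      case one
      then show ?case by (intro exI[of _ 0]) (simp add: subgroup.one_closed[OF A])
    next
      case (incl h)
      then show ?case
      proof
        assume "h = b"
        then show ?thesis using b by (intro exI[of _ 1]) (simp add: subgroup.one_closed[OF A])
      next
        assume "h \<in> A"
        then show ?thesis using Ac by (intro exI[of _ 0]) simp
      qed
    next
      case (inv h)
      then show ?case
      proof
        assume "h = b"
        then show ?thesis using b
          by (intro exI[of _ "-1"]) (simp add: int_pow_neg subgroup.one_closed[OF A])
      next
        assume "h \<in> A"
        then show ?thesis using Ac Ai by (intro exI[of _ 0]) simp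
      qed
    next
      case (eng x y)
      then obtain n m :: int where nm: "inv (b [^] n) \<otimes> x \<in> A" "inv (b [^] m) \<otimes> y \<in> A" by blast
      have c: "x \<in> carrier G" "y \<in> carrier G" using eng generate_in_carrier[OF sub] by blast+
      have "(inv (b [^] n) \<otimes> x) \<otimes> (inv (b [^] m) \<otimes> y) = inv (b [^] (n + m)) \<otimes> (x \<otimes> y)"
        using c b by (simp add: int_pow_mult inv_mult m_ac)
      then show ?case using Am[OF nm] by (intro exI[of _ "n + m"]) simp
    qed
    \<comment> \<open>If \<open>b^n\<close> with \<open>n \<noteq> 0\<close> lay in
      \<open>A\<close>, the exponents modulo \<open>n\<close> would bound the index of
      \<open>A\<close> in \<open>A1\<close>, and \<open>A\<close> would have finite index in
      \<open>G\<close>.\<close>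
    have indep: "n = 0" if n: "b [^] (n::int) \<in> A" for n
    proof (rule ccontr)
      assume "n \<noteq> 0"
      define j where "j x = (SOME n::int. inv (b [^] n) \<otimes> x \<in> A)" for x
      have j: "inv (b [^] j x) \<otimes> x \<in> A" if "x \<in> A1" for x
        unfolding j_def using someI_ex[OF rep[OF that]] .
      interpret H: group "G\<lparr>carrier := A1\<rparr>" using subgroup_imp_group[OF A1] .
      have "finite ((\<lambda>x. j x mod n) ` carrier (G\<lparr>carrier := A1\<rparr>))"
      proof (rule finite_subset)
        show "(\<lambda>x. j x mod n) ` carrier (G\<lparr>carrier := A1\<rparr>) \<subseteq> {-\<bar>n\<bar>..\<bar>n\<bar>}"
        proof (rule image_subsetI)
          fix x
          show "j x mod n \<in> {-\<bar>n\<bar>..\<bar>n\<bar>}"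
            using abs_mod_less[OF \<open>n \<noteq> 0\<close>, of "j x"] by (simp add: abs_less_iff)
        qed
      qed simp
      then have "finite_index (G\<lparr>carrier := A1\<rparr>) A"
      proof (rule H.finite_indexI[rotated])
        show "subgroup A (G\<lparr>carrier := A1\<rparr>)" using subgroup_incl[OF A A1 AA1(1)] .
        fix x y assume "x \<in> carrier (G\<lparr>carrier := A1\<rparr>)" "y \<in> carrier (G\<lparr>carrier := A1\<rparr>)"
          and eq: "j x mod n = j y mod n"
        then have x: "x \<in> A1" and y: "y \<in> A1" by auto
        have c: "x \<in> carrier G" "y \<in> carrier G" using x y subgroup.mem_carrier[OF A1] by blast+
        obtain q where q: "j y - j x = n * q" using eq by (metis mod_eq_dvd_iff dvd_def)
        have "(b [^] n) [^] q \<in> A" by (rule subgroup_int_pow_closed[OF A n])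
        then have "b [^] (j y - j x) \<in> A" using b by (simp add: q int_pow_pow)
        then have "b [^] (j y - j x) \<otimes> (inv (inv (b [^] j x) \<otimes> x) \<otimes> (inv (b [^] j y) \<otimes> y)) \<in> A"
          using Am Ai j x y by blast
        moreover have "b [^] (j y - j x) \<otimes> (inv (inv (b [^] j x) \<otimes> x) \<otimes> (inv (b [^] j y) \<otimes> y)) = inv x \<otimes> y"
        proof -
          have e: "b [^] (j y - j x) = b [^] j y \<otimes> inv (b [^] j x)"
            using b by (simp add: int_pow_diff)
          show ?thesis
            unfolding e using b c by (simp add: inv_mult m_ac)
        qed
        ultimately show "inv\<^bsub>G\<lparr>carrier := A1\<rparr>\<^esub> x \<otimes>\<^bsub>G\<lparr>carrier := A1\<rparr>\<^esub> y \<in> A"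
          using m_inv_consistent[OF A1 x] by simp
      qed
      then show False using finite_index_trans[OF True] insert.prems(4) by blast
    qed
    define q where "q = Coset.order (G Mod A1)"
    interpret A1: normal A1 G using subgroup_imp_normal[OF A1] .
    interpret Q: group "G Mod A1" by (rule A1.factorgroup_is_group)
    have "carrier (G Mod A1) = lcosets A1"
      using A1.coset_eq by (auto simp: FactGroup_def RCOSETS_def LCOSETS_def)
    then have finQ: "finite (carrier (G Mod A1))" using True by (simp add: finite_index_def)
    have q: "q > 0" unfolding q_def using finQ Q.order_gt_0_iff_finite by blast
    have pow: "x [^] q \<in> A1" if x: "x \<in> carrier G" for x
    proof -
      have "A1 #> x \<in> carrier (G Mod A1)" using x by (auto simp: carrier_FactGroup)
      then have "(A1 #> x) [^]\<^bsub>G Mod A1\<^esub> q = A1" unfolding q_def using Q.pow_order_eq_1 by simp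
      then have "A1 #> (x [^] q) = A1" using A1.FactGroup_pow[OF x] by simp
      then show ?thesis using coset_join1[OF _ _ A1] x by simp
    qed
    \<comment> \<open>The exponent exists by \<open>pow\<close> and \<open>rep\<close>, and it is
      unique by \<open>indep\<close>.\<close>
    define \<psi> where "\<psi> x = (THE n::int. inv (b [^] n) \<otimes> x [^] q \<in> A)" for x
    have uniq: "\<psi> x = n" if x: "x \<in> carrier G" and n: "inv (b [^] n) \<otimes> x [^] q \<in> A" for x and n :: int
      unfolding \<psi>_def
    proof (rule the_equality)
      show "inv (b [^] n) \<otimes> x [^] q \<in> A" by (rule n)
      fix m :: int assume m: "inv (b [^] m) \<otimes> x [^] q \<in> A"
      have "(inv (b [^] n) \<otimes> x [^] q) \<otimes> inv (inv (b [^] m) \<otimes> x [^] q) \<in> A" using Am Ai n m by blast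
      moreover have "(inv (b [^] n) \<otimes> x [^] q) \<otimes> inv (inv (b [^] m) \<otimes> x [^] q) = b [^] (m - n)"
        using b x by (simp add: int_pow_diff inv_mult_group m_assoc m_comm[of "b [^] m"])
      ultimately have "b [^] (m - n) \<in> A" by (simp only:)
      then show "m = n" using indep[of "m - n"] by linarith
    qed
    have ex: "inv (b [^] \<psi> x) \<otimes> x [^] q \<in> A" if x: "x \<in> carrier G" for x
    proof -
      obtain n :: int where n: "inv (b [^] n) \<otimes> x [^] q \<in> A" using rep[OF pow[OF x]] by blast
      with uniq[OF x n] show ?thesis by (simp only:)
    qed
    have "\<psi> \<in> hom G integer_group"
    proof (rule homI)
      fix x y assume x: "x \<in> carrier G" and y: "y \<in> carrier G"
      have "(inv (b [^] \<psi> x) \<otimes> x [^] q) \<otimes> (inv (b [^] \<psi> y) \<otimes> y [^] q) \<in> A" using Am ex x y by blast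
      moreover have "(inv (b [^] \<psi> x) \<otimes> x [^] q) \<otimes> (inv (b [^] \<psi> y) \<otimes> y [^] q)
          = inv (b [^] (\<psi> x + \<psi> y)) \<otimes> (x \<otimes> y) [^] q"
        using b x y by (simp add: int_pow_mult nat_pow_distrib inv_mult m_ac)
      ultimately show "\<psi> (x \<otimes> y) = \<psi> x \<otimes>\<^bsub>integer_group\<^esub> \<psi> y" using uniq x y by simp
    qed simp
    moreover have "\<psi> a = 0" if a: "a \<in> A" for a
    proof (rule uniq)
      have "a [^] int q \<in> A" by (rule subgroup_int_pow_closed[OF A a])
      then show "inv (b [^] (0::int)) \<otimes> a [^] q \<in> A" using Ac[OF a] by (simp add: int_pow_int)
    qed (use a Ac in auto)
    moreover have "\<psi> b = int q"
      by (rule uniq[OF b]) (use b in \<open>simp add: int_pow_int subgroup.one_closed[OF A]\<close>)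
    ultimately show ?thesis using b q by (intro bexI[of _ \<psi>] conjI ballI bexI[of _ b]) simp_all
  qed
qed

text \<open>A homomorphism that vanishes on generators is zero. In the application \<open>S\<close>
  consists of values of a polynomial map, whose composite with \<open>\<psi>\<close> is therefore
  not identically zero.\<close>

lemma (in comm_group) ex_int_hom_nonzero:
  assumes "finite S" "S \<subseteq> carrier G" "generate G S = carrier G" "infinite (carrier G)"
  shows "\<exists>\<psi>\<in>hom G integer_group. \<exists>b\<in>S. \<psi> b \<noteq> 0"
proof -
  have "inj_on (\<lambda>x. x <# {\<one>}) (carrier G)" by (auto simp: inj_on_def l_coset_def)
  then have "infinite ((\<lambda>x. x <# {\<one>}) ` carrier G)" using assms(4) finite_imageD by blast
  then have "infinite (lcosets {\<one>})" unfolding LCOSETS_def by (simp add: UNION_singleton_eq_range)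
  then have "\<not> finite_index G {\<one>}" by (simp add: finite_index_def)
  moreover have "generate G ({\<one>} \<union> S) = carrier G"
    using mono_generate[of S "{\<one>} \<union> S"] generate_incl[of "{\<one>} \<union> S"] assms by auto
  ultimately obtain \<psi> b where \<psi>: "\<psi> \<in> hom G integer_group" "b \<in> carrier G" "\<psi> b \<noteq> 0"
    using ex_int_hom_extension[OF assms(1,2) triv_subgroup] by blast
  interpret \<psi>: group_hom G integer_group \<psi>
    using \<psi>(1) by (simp add: group_hom_def group_hom_axioms_def is_group)
  have "\<exists>b\<in>S. \<psi> b \<noteq> 0"
  proof (rule ccontr)
    assume "\<not> ?thesis"
    then have "S \<subseteq> kernel G integer_group \<psi>" using assms(2) by (auto simp: kernel_def)
    then have "generate G S \<subseteq> kernel G integer_group \<psi>"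
      using generate_subgroup_incl \<psi>.subgroup_kernel by blast
    with assms(3) \<psi> show False by (auto simp: kernel_def)
  qed
  with \<psi> show ?thesis by blast
qed

section \<open>Dichotomy for polynomial maps: periodic, or with null zero set\<close>

lemma (in poly_maps) poly_map_restrict:
  assumes "subgroup H A"
  shows "poly_map L A n f \<Longrightarrow> f \<in> carrier L \<rightarrow> H \<Longrightarrow> poly_map L (A\<lparr>carrier := H\<rparr>) n f"
proof (induction n arbitrary: f)
  case (Suc n)
  interpret H: poly_maps L "A\<lparr>carrier := H\<rparr>"
    using A.subgroup_imp_comm_group[OF assms] by (simp add: poly_maps_def L.is_group)
  have "poly_map L (A\<lparr>carrier := H\<rparr>) n (rderiv L (A\<lparr>carrier := H\<rparr>) h f)" if h: "h \<in> carrier L" for h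
  proof -
    have "rderiv L A h f \<in> carrier L \<rightarrow> H"
      using h Suc.prems(2) subgroup.m_closed[OF assms] subgroup.m_inv_closed[OF assms]
      by (auto simp: rderiv_def Pi_iff)
    then have 1: "poly_map L (A\<lparr>carrier := H\<rparr>) n (rderiv L A h f)" using Suc h by simp
    have 2: "rderiv L A h f x = rderiv L (A\<lparr>carrier := H\<rparr>) h f x" if "x \<in> carrier L" for x
      using that Suc.prems(2) by (auto simp: rderiv_def A.m_inv_consistent[OF assms] Pi_iff)
    show ?thesis by (rule H.poly_map_cong[THEN iffD1, OF 2 1])
  qed
  with Suc.prems show ?case by simp
qed simp

text \<open>The closure of \<open>V\<close> in the profinite completion of \<open>L\<close> has Haar measure zero.\<close>
definition null_set :: "('l, 'm) monoid_scheme \<Rightarrow> 'l set \<Rightarrow> bool" where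
  "null_set L V \<longleftrightarrow> (\<forall>\<epsilon>>0. \<exists>K. finite_index L K \<and>
     real (card {C \<in> lcosets\<^bsub>L\<^esub> K. C \<inter> V \<noteq> {}}) \<le> \<epsilon> * real (card (lcosets\<^bsub>L\<^esub> K)))"

lemma null_set_mono:
  assumes "null_set L V" "U \<subseteq> V"
  shows "null_set L U"
  unfolding null_set_def
proof (intro allI impI)
  fix \<epsilon> :: real assume "\<epsilon> > 0"
  then obtain K where K: "finite_index L K"
    "real (card {C \<in> lcosets\<^bsub>L\<^esub> K. C \<inter> V \<noteq> {}}) \<le> \<epsilon> * real (card (lcosets\<^bsub>L\<^esub> K))"
    using assms(1) unfolding null_set_def by blast
  have "card {C \<in> lcosets\<^bsub>L\<^esub> K. C \<inter> U \<noteq> {}} \<le> card {C \<in> lcosets\<^bsub>L\<^esub> K. C \<inter> V \<noteq> {}}"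
    by (rule card_mono) (use K(1) assms(2) in \<open>auto simp: finite_index_def\<close>)
  then have "real (card {C \<in> lcosets\<^bsub>L\<^esub> K. C \<inter> U \<noteq> {}}) \<le> \<epsilon> * real (card (lcosets\<^bsub>L\<^esub> K))"
    using K(2) by linarith
  with K(1) show "\<exists>K. finite_index L K \<and>
     real (card {C \<in> lcosets\<^bsub>L\<^esub> K. C \<inter> U \<noteq> {}}) \<le> \<epsilon> * real (card (lcosets\<^bsub>L\<^esub> K))"
    by (intro exI[of _ K] conjI)
qed

text \<open>The value 0 is divisible by every modulus, so the cosets that meet the zero set are
  among those counted in \<open>poly_map_zero_density\<close>.\<close>

lemma (in int_poly_maps) null_set_zeros:
  assumes S: "finite S" "S \<subseteq> carrier L" "generate L S = carrier L"
    and f: "poly_map L integer_group n f" "\<exists>x\<in>carrier L. f x \<noteq> 0"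
  shows "null_set L {x. f x = 0}"
  unfolding null_set_def
proof (intro allI impI)
  fix \<epsilon> :: real assume "\<epsilon> > 0"
  from poly_map_zero_density[OF S f(1) order.refl f(2) this]
  obtain m where m: "m > 0" "\<And>k. k > 0 \<Longrightarrow> m dvd k \<Longrightarrow>
      real (card {C \<in> lcosets\<^bsub>L\<^esub> (periods_mod n k). \<exists>x\<in>C. int k dvd f x})
        \<le> \<epsilon> * real (card (lcosets\<^bsub>L\<^esub> (periods_mod n k)))"
    by (elim exE conjE) (rule that, assumption, elim allE impE)
  note m = m(1) m(2)[OF m(1) dvd_refl]
  have "finite (carrier (integer_mod_group m))" using m by (simp add: carrier_integer_mod_group)
  moreover have "poly_maps L (integer_mod_group m)" by (simp add: poly_maps_def L.is_group)
  ultimately have fi: "finite_index L (periods_mod n m)"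
    using poly_maps.finite_index_common_periods S by blast
  have "card {C \<in> lcosets\<^bsub>L\<^esub> (periods_mod n m). C \<inter> {x. f x = 0} \<noteq> {}}
      \<le> card {C \<in> lcosets\<^bsub>L\<^esub> (periods_mod n m). \<exists>x\<in>C. int m dvd f x}"
  proof (intro card_mono subsetI)
    show "finite {C \<in> lcosets\<^bsub>L\<^esub> (periods_mod n m). \<exists>x\<in>C. int m dvd f x}"
      using fi by (simp add: finite_index_def)
    fix C assume "C \<in> {C \<in> lcosets\<^bsub>L\<^esub> (periods_mod n m). C \<inter> {x. f x = 0} \<noteq> {}}"
    then obtain x where "C \<in> lcosets\<^bsub>L\<^esub> (periods_mod n m)" "x \<in> C" "f x = 0" by blast
    moreover from this have "int m dvd f x" by simp
    ultimately show "C \<in> {C \<in> lcosets\<^bsub>L\<^esub> (periods_mod n m). \<exists>x\<in>C. int m dvd f x}" by blast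
  qed
  then have "real (card {C \<in> lcosets\<^bsub>L\<^esub> (periods_mod n m). C \<inter> {x. f x = 0} \<noteq> {}})
      \<le> \<epsilon> * real (card (lcosets\<^bsub>L\<^esub> (periods_mod n m)))" using m(2) by linarith
  with fi show "\<exists>K. finite_index L K \<and>
     real (card {C \<in> lcosets\<^bsub>L\<^esub> K. C \<inter> {x. f x = 0} \<noteq> {}}) \<le> \<epsilon> * real (card (lcosets\<^bsub>L\<^esub> K))"
    by (intro exI[of _ "periods_mod n m"] conjI)
qed

text \<open>\<open>A\<close> itself need not be finitely generated. By
  \<open>poly_map_values\<close> the values of \<open>f\<close> lie in the group \<open>H\<close>
  generated by those on a finite ball, and \<open>f\<close> is regarded as a map into
  \<open>H\<close>.\<close>

lemma (in poly_maps) poly_map_periodic_or_null: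
  assumes S: "finite S" "S \<subseteq> carrier L" "generate L S = carrier L"
    and f: "poly_map L A n f"
  shows "(\<exists>K. finite_index L K \<and> (\<forall>x\<in>carrier L. \<forall>h\<in>K. f (x \<otimes>\<^bsub>L\<^esub> h) = f x)) \<or>
null_set L {x. f x = \<one>\<^bsub>A\<^esub>}"
proof -
  define B where "B = f ` deg_ball L S n"
  have B: "finite B" "B \<subseteq> carrier A"
    unfolding B_def using finite_deg_ball[OF S(1)] deg_ball_closed[OF L.is_group S(2)] poly_map_closed[OF f] by blast+
  define H where "H = generate A B"
  have sH: "subgroup H A" unfolding H_def by (rule A.generate_is_subgroup[OF B(2)])
  define A' where "A' = A\<lparr>carrier := H\<rparr>"
  interpret A': poly_maps L A'
    using A.subgroup_imp_comm_group[OF sH] by (simp add: poly_maps_def L.is_group A'_def)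
  have f': "poly_map L A' n f"
    unfolding A'_def by (rule poly_map_restrict[OF sH f])
      (use poly_map_values[OF S(2,3) f] in \<open>simp add: H_def B_def Pi_iff\<close>)
  show ?thesis
  proof (cases "finite H")
    case True
    then have "finite_index L (common_periods L A' n)"
      using A'.finite_index_common_periods[OF _ S] by (simp add: A'_def)
    with common_periodsD[OF _ f'] show ?thesis by blast
  next
    case False
    have BH: "B \<subseteq> H" unfolding H_def by (auto intro: generate.incl)
    have "generate A' B = carrier A'"
      using A.generate_consistent[OF BH sH] by (simp add: A'_def H_def)
    moreover have "carrier A' = H" by (simp add: A'_def)
    ultimately obtain \<psi> b where \<psi>: "\<psi> \<in> hom A' integer_group" "b \<in> B" "\<psi> b \<noteq> 0"
      using A'.A.ex_int_hom_nonzero[OF B(1)] BH False by blast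
    interpret Z: int_poly_maps L by (simp add: int_poly_maps_def L.is_group)
    let ?g = "\<lambda>x. \<psi> (f x)"
    have g: "poly_map L integer_group n ?g"
      by (rule A'.poly_map_hom[OF abelian_integer_group \<psi>(1) f'])
    have gn: "\<exists>x\<in>carrier L. ?g x \<noteq> 0"
      using \<psi>(2,3) deg_ball_closed[OF L.is_group S(2)] unfolding B_def by blast
    have "\<psi> \<one>\<^bsub>A'\<^esub> = 0"
      using hom_one[OF \<psi>(1) A'.A.is_group group_integer_group] by (simp only: one_integer_group)
    moreover have "\<one>\<^bsub>A'\<^esub> = \<one>\<^bsub>A\<^esub>" by (simp add: A'_def)
    ultimately have "{x. f x = \<one>\<^bsub>A\<^esub>} \<subseteq> {x. ?g x = 0}" by auto
    then show ?thesis using null_set_mono[OF Z.null_set_zeros[OF S g gn]] by blast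
  qed
qed

section \<open>Polynomial maps into filtered groups\<close>

text \<open>\<open>F 1\<close> may be smaller than \<open>F 0\<close>: constants from all of
  \<open>G\<close> have level 0, whereas homomorphisms have to map into \<open>F 1\<close> so that
  their derivatives, which are constant, have level 1.\<close>

locale group_filtration = group G for G :: "('a, 'b) monoid_scheme" (structure) +
  fixes F :: "nat \<Rightarrow> 'a set"
  assumes F_0: "F 0 = carrier G"
    and F_normal: "F i \<lhd> G"
    and F_Suc_subset: "F (Suc i) \<subseteq> F i"
    and F_commutator: "x \<in> F i \<Longrightarrow> y \<in> F j \<Longrightarrow> x \<otimes> y \<otimes> inv x \<otimes> inv y \<in> F (i + j)"

text \<open>\<open>i\<close> is a level: the values lie in \<open>F i\<close>, and each derivative
  adds 1 to it. With a closure that has commutators as a rule of its own, products are free and the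
  derivative is treated by rule induction; in a definition through derivatives, closure under
  products would be the hard part.\<close>

inductive filtered_poly :: "('l, 'm) monoid_scheme \<Rightarrow> ('a, 'b) monoid_scheme \<Rightarrow> (nat \<Rightarrow> 'a set) \<Rightarrow> nat \<Rightarrow> ('l \<Rightarrow> 'a) \<Rightarrow> bool"
  for L G F where
  const: "c \<in> F i \<Longrightarrow> filtered_poly L G F i (\<lambda>_. c)"
| hom: "f \<in> hom L G \<Longrightarrow> f ` carrier L \<subseteq> F 1 \<Longrightarrow> filtered_poly L G F 0 f"
| mult: "filtered_poly L G F i f \<Longrightarrow> filtered_poly L G F i g \<Longrightarrow>
     filtered_poly L G F i (\<lambda>x. f x \<otimes>\<^bsub>G\<^esub> g x)"
| inv: "filtered_poly L G F i f \<Longrightarrow> filtered_poly L G F i (\<lambda>x. inv\<^bsub>G\<^esub> f x)"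
| commutator: "filtered_poly L G F i f \<Longrightarrow> filtered_poly L G F j g \<Longrightarrow>
     filtered_poly L G F (i + j) (\<lambda>x. f x \<otimes>\<^bsub>G\<^esub> g x \<otimes>\<^bsub>G\<^esub> inv\<^bsub>G\<^esub> f x \<otimes>\<^bsub>G\<^esub> inv\<^bsub>G\<^esub> g x)"
| Suc: "filtered_poly L G F (Suc i) f \<Longrightarrow> filtered_poly L G F i f"
| cong: "filtered_poly L G F i f \<Longrightarrow> (\<And>x. x \<in> carrier L \<Longrightarrow> f x = g x) \<Longrightarrow> filtered_poly L G F i g"

context group_filtration
begin

lemma F_subgroup: "subgroup (F i) G"
  using F_normal normal_imp_subgroup by blast

lemma F_carrier: "x \<in> F i \<Longrightarrow> x \<in> carrier G"
  using subgroup.mem_carrier[OF F_subgroup] by blast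

lemma filtered_poly_mem: "filtered_poly L G F i f \<Longrightarrow> x \<in> carrier L \<Longrightarrow> f x \<in> F i"
proof (induction rule: filtered_poly.induct)
  case (hom f)
  then show ?case by (auto simp: F_0 hom_def)
next
  case (mult i f g)
  then show ?case using subgroup.m_closed[OF F_subgroup] by blast
next
  case (inv i f)
  then show ?case using subgroup.m_inv_closed[OF F_subgroup] by blast
next
  case (commutator i f j g)
  then show ?case using F_commutator by blast
next
  case (Suc i f)
  then show ?case using F_Suc_subset by blast
qed auto

lemma filtered_poly_closed: "filtered_poly L G F i f \<Longrightarrow> x \<in> carrier L \<Longrightarrow> f x \<in> carrier G"
  by (rule F_carrier[OF filtered_poly_mem])

lemma filtered_poly_le: "filtered_poly L G F i f \<Longrightarrow> j \<le> i \<Longrightarrow> filtered_poly L G F j f"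
proof (induction i)
  case (Suc i)
  then show ?case by (cases "j = Suc i") (auto intro: filtered_poly.Suc)
qed simp

text \<open>\<open>g^-1 f g = f [f^-1, g^-1]\<close>, and the commutator has level
  \<open>i + j \<ge> i\<close>.\<close>

lemma filtered_poly_conj:
  assumes f: "filtered_poly L G F i f" and g: "filtered_poly L G F j g"
  shows "filtered_poly L G F i (\<lambda>x. inv g x \<otimes> f x \<otimes> g x)"
proof -
  have "filtered_poly L G F (i + j) (\<lambda>x. inv f x \<otimes> inv g x \<otimes> inv (inv f x) \<otimes> inv (inv g x))"
    by (rule filtered_poly.commutator[OF filtered_poly.inv[OF f] filtered_poly.inv[OF g]])
  then have "filtered_poly L G F i (\<lambda>x. inv f x \<otimes> inv g x \<otimes> inv (inv f x) \<otimes> inv (inv g x))"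
    by (rule filtered_poly_le) simp
  from filtered_poly.mult[OF f this]
  have "filtered_poly L G F i (\<lambda>x. f x \<otimes> (inv f x \<otimes> inv g x \<otimes> inv (inv f x) \<otimes> inv (inv g x)))" .
  then show ?thesis
    by (rule filtered_poly.cong) (simp add: filtered_poly_closed[OF f] filtered_poly_closed[OF g] m_assoc)
qed

lemma filtered_poly_conj':
  assumes "filtered_poly L G F i f" "filtered_poly L G F j g"
  shows "filtered_poly L G F i (\<lambda>x. g x \<otimes> f x \<otimes> inv g x)"
  by (rule filtered_poly.cong[OF filtered_poly_conj[OF assms(1) filtered_poly.inv[OF assms(2)]]])
    (simp add: filtered_poly_closed[OF assms(2)])

text \<open>The Lazard--Leibman theorem. The commutator case is the identity
  \<open>[fa, gb] = f[a, gb]f\<inverse> [f, g] g[f, b]g\<inverse>\<close>, where \<open>a\<close> and \<open>b\<close> are the derivatives of \<open>f\<close> and \<open>g\<close>.\<close>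
theorem filtered_poly_rderiv:
  assumes L: "group L" and h: "h \<in> carrier L"
  shows "filtered_poly L G F i f \<Longrightarrow> filtered_poly L G F (Suc i) (rderiv L G h f)"
proof (induction rule: filtered_poly.induct)
  interpret L: group L by (rule L)
  {
    case (const c i)
    have "filtered_poly L G F (Suc i) (\<lambda>_. \<one>)"
      by (rule filtered_poly.const) (rule subgroup.one_closed[OF F_subgroup])
    then show ?case by (rule filtered_poly.cong) (use F_carrier[OF const] in \<open>simp add: rderiv_def\<close>)
  next
    case (hom f)
    then have "filtered_poly L G F (Suc 0) (\<lambda>_. f h)"
      using h by (intro filtered_poly.const) auto
    then show ?case
    proof (rule filtered_poly.cong)
      fix x assume "x \<in> carrier L"
      then show "f h = rderiv L G h f x"
        using h hom_mult[OF hom(1)] hom_in_carrier[OF hom(1)] by (simp add: rderiv_def)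
    qed
  next
    case (mult i f g)
    note c = filtered_poly_closed[OF mult(1)] filtered_poly_closed[OF mult(2)]
    \<comment> \<open>Product rule: \<open>D(fg) = (g^-1 Df g) Dg\<close>.\<close>
    have "filtered_poly L G F (Suc i) (\<lambda>x. (inv g x \<otimes> rderiv L G h f x \<otimes> g x) \<otimes> rderiv L G h g x)"
      by (rule filtered_poly.mult[OF filtered_poly_conj[OF mult(3) mult(2)] mult(4)])
    then show ?case
      by (rule filtered_poly.cong) (use h c in \<open>simp add: rderiv_def m_assoc inv_mult_group\<close>)
  next
    case (inv i f)
    note c = filtered_poly_closed[OF inv(1)]
    \<comment> \<open>\<open>D(f^-1) = f (Df)^-1 f^-1\<close>.\<close>
    have "filtered_poly L G F (Suc i) (\<lambda>x. f x \<otimes> inv (rderiv L G h f x) \<otimes> inv f x)"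
      by (rule filtered_poly_conj'[OF filtered_poly.inv[OF inv(2)] inv(1)])
    then show ?case
      by (rule filtered_poly.cong) (use h c in \<open>simp add: rderiv_def m_assoc inv_mult_group\<close>)
  next
    case (commutator i f j g)
    note c = filtered_poly_closed[OF commutator(1)] filtered_poly_closed[OF commutator(2)]
    define a where "a = rderiv L G h f"
    define b where "b = rderiv L G h g"
    have a: "filtered_poly L G F (Suc i) a" and b: "filtered_poly L G F (Suc j) b"
      using commutator by (simp_all add: a_def b_def)
    note ac = filtered_poly_closed[OF a] and bc = filtered_poly_closed[OF b]
    let ?com = "\<lambda>f g x. f x \<otimes> g x \<otimes> inv f x \<otimes> inv g x"
    have gb: "filtered_poly L G F j (\<lambda>x. g x \<otimes> b x)"
      by (rule filtered_poly.mult[OF commutator(2) filtered_poly.Suc[OF b]])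
    have 1: "filtered_poly L G F (Suc i + j) (?com a (\<lambda>x. g x \<otimes> b x))"
      by (rule filtered_poly.commutator[OF a gb])
    have 2: "filtered_poly L G F (i + Suc j) (?com f b)"
      by (rule filtered_poly.commutator[OF commutator(1) b])
    have com1: "filtered_poly L G F (Suc (i + j)) (?com a (\<lambda>x. g x \<otimes> b x))" using 1 by simp
    have com2: "filtered_poly L G F (Suc (i + j)) (?com f b)" using 2 by simp
    have 3: "filtered_poly L G F (i + j) (?com f g)"
      by (rule filtered_poly.commutator[OF commutator(1,2)])
    \<comment> \<open>The commutator identity is divided on the left by \<open>[f, g]\<close>, which
      turns its first factor into a conjugate by \<open>[f, g]\<close>.\<close>
    have "filtered_poly L G F (Suc (i + j)) (\<lambda>x.
        (inv (?com f g x) \<otimes> (f x \<otimes> ?com a (\<lambda>x. g x \<otimes> b x) x \<otimes> inv f x) \<otimes> ?com f g x) \<otimes>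
        (g x \<otimes> ?com f b x \<otimes> inv g x))"
      by (rule filtered_poly.mult[OF filtered_poly_conj[OF filtered_poly_conj'[OF com1 commutator(1)] 3]
            filtered_poly_conj'[OF com2 commutator(2)]])
    then show ?case
    proof (rule filtered_poly.cong)
      fix x assume x: "x \<in> carrier L"
      have e: "f (x \<otimes>\<^bsub>L\<^esub> h) = f x \<otimes> a x" "g (x \<otimes>\<^bsub>L\<^esub> h) = g x \<otimes> b x"
        using x h c by (simp_all add: a_def b_def rderiv_def)
      show "(inv (?com f g x) \<otimes> (f x \<otimes> ?com a (\<lambda>x. g x \<otimes> b x) x \<otimes> inv f x) \<otimes> ?com f g x) \<otimes>
          (g x \<otimes> ?com f b x \<otimes> inv g x) = rderiv L G h (?com f g) x"
        using c[OF x] ac[OF x] bc[OF x] by (simp add: rderiv_def e m_assoc inv_mult_group)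
    qed
  next
    case (Suc i f)
    show ?case by (rule filtered_poly.Suc[OF Suc(2)])
  next
    case (cong i f g)
    show ?case
      by (rule filtered_poly.cong[OF cong(3)]) (use h cong(2) in \<open>simp add: rderiv_def\<close>)
  }
qed

text \<open>Each derivative raises the level by one; after \<open>n\<close> of them the values lie
  in \<open>F (i + n)\<close> and are trivial modulo \<open>D\<close>.\<close>

lemma filtered_poly_imp_poly_map:
  assumes L: "group L" and C: "subgroup C G" and D: "D \<lhd> G" "D \<subseteq> C"
    and comm: "\<And>x y. x \<in> C \<Longrightarrow> y \<in> C \<Longrightarrow> x \<otimes> y \<otimes> inv x \<otimes> inv y \<in> D"
  shows "comm_group ((G\<lparr>carrier := C\<rparr>) Mod D)"
    and "filtered_poly L G F i f \<Longrightarrow> f \<in> carrier L \<rightarrow> C \<Longrightarrow> F (i + n) \<subseteq> D \<Longrightarrow>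
      poly_map L ((G\<lparr>carrier := C\<rparr>) Mod D) n (\<lambda>x. D #> f x)"
proof -
  let ?C = "G\<lparr>carrier := C\<rparr>"
  interpret L: group L by (rule L)
  interpret D: normal D ?C by (rule normal_restrict_supergroup[OF C D])
  interpret Q: group "?C Mod D" by (rule D.factorgroup_is_group)
  have coset: "D #>\<^bsub>?C\<^esub> x = D #> x" for x by (simp add: r_coset_def)
  have Qmem: "D #> x \<in> carrier (?C Mod D)" if "x \<in> C" for x
    using that coset by (auto simp: carrier_FactGroup)
  have Qmult: "(D #> x) \<otimes>\<^bsub>?C Mod D\<^esub> (D #> y) = D #> (x \<otimes> y)" if "x \<in> C" "y \<in> C" for x y
    using D.rcos_sum[of x y] that by (simp add: coset)
  have Qinv: "inv\<^bsub>?C Mod D\<^esub> (D #> x) = D #> inv x" if "x \<in> C" for x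
    using D.inv_FactGroup[of "D #> x"] D.rcos_inv[of x] Qmem that by (simp add: coset m_inv_consistent[OF C])
  note Cc = subgroup.mem_carrier[OF C] and Cm = subgroup.m_closed[OF C] and Ci = subgroup.m_inv_closed[OF C]
  have Dc: "D \<subseteq> carrier G" using D(2) Cc by blast
  have sD: "subgroup D G" using normal_imp_subgroup[OF D(1)] .
  have Q1: "D #> x = D" if "x \<in> D" for x
    using coset_join2[OF _ sD that] Dc that by blast
  show "comm_group (?C Mod D)"
  proof (rule Q.group_comm_groupI)
    fix X Y assume "X \<in> carrier (?C Mod D)" "Y \<in> carrier (?C Mod D)"
    then obtain x y where xy: "x \<in> C" "y \<in> C" "X = D #> x" "Y = D #> y"
      by (auto simp: carrier_FactGroup coset)
    have "D #> (x \<otimes> y) = (D #> (x \<otimes> y \<otimes> inv x \<otimes> inv y)) #> (y \<otimes> x)"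
      using xy Cc Dc by (simp add: coset_mult_assoc m_assoc)
    also have "\<dots> = D #> (y \<otimes> x)" using Q1[OF comm] xy by simp
    finally show "X \<otimes>\<^bsub>?C Mod D\<^esub> Y = Y \<otimes>\<^bsub>?C Mod D\<^esub> X"
      using xy Qmult by simp
  qed
  then interpret P: poly_maps L "?C Mod D" by (simp add: poly_maps_def L)
  show "filtered_poly L G F i f \<Longrightarrow> f \<in> carrier L \<rightarrow> C \<Longrightarrow> F (i + n) \<subseteq> D \<Longrightarrow>
      poly_map L (?C Mod D) n (\<lambda>x. D #> f x)"
  proof (induction n arbitrary: i f)
    case 0
    then have "f x \<in> D" if "x \<in> carrier L" for x using filtered_poly_mem that by fastforce
    then show ?case using Q1 by simp
  next
    case (Suc n)
    have "poly_map L (?C Mod D) n (rderiv L (?C Mod D) h (\<lambda>x. D #> f x))" if h: "h \<in> carrier L" for h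
    proof -
      have fC: "f x \<in> C" if "x \<in> carrier L" for x using Suc.prems(2) that by blast
      have 1: "poly_map L (?C Mod D) n (\<lambda>x. D #> rderiv L G h f x)"
      proof (rule Suc.IH)
        show "filtered_poly L G F (Suc i) (rderiv L G h f)"
          by (rule filtered_poly_rderiv[OF L h Suc.prems(1)])
        show "rderiv L G h f \<in> carrier L \<rightarrow> C" using fC h Cm Ci by (simp add: rderiv_def)
      qed (use Suc.prems in simp)
      have 2: "D #> rderiv L G h f x = rderiv L (?C Mod D) h (\<lambda>x. D #> f x) x" if "x \<in> carrier L" for x
        using that h fC Qmult Qinv Ci by (simp add: rderiv_def)
      show ?thesis by (rule P.poly_map_cong[THEN iffD1, OF 2 1])
    qed
    with Suc.prems Qmem show ?case by (simp add: Pi_iff)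
  qed
qed

end

text \<open>The \<open>j\<close>-th term for \<open>2\<^sup>a\<^sup>-\<^sup>1 < j \<le> 2\<^sup>a\<close> is \<open>C a\<close>: at this speed \<open>[C a, C 0] \<subseteq> C (a + 1)\<close> is enough
  for the commutators to be compatible with the degrees, and \<open>[C a, C b] \<subseteq> C (a + b + 1)\<close> is not needed.\<close>
definition dyadic_filtration :: "('a, 'b) monoid_scheme \<Rightarrow> (nat \<Rightarrow> 'a set) \<Rightarrow> nat \<Rightarrow> 'a set" where
  "dyadic_filtration G C j = (if j = 0 then carrier G else C (LEAST a. j \<le> 2 ^ a))"

lemma (in group) group_filtration_dyadic:
  assumes C: "\<And>a. C a \<lhd> G" and sub: "\<And>a. C (Suc a) \<subseteq> C a"
    and com: "\<And>a x y. x \<in> C a \<Longrightarrow> y \<in> C 0 \<Longrightarrow> x \<otimes> y \<otimes> inv x \<otimes> inv y \<in> C (Suc a)"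
  shows "group_filtration G (dyadic_filtration G C)"
proof -
  define lev where "lev j = (LEAST a. j \<le> 2 ^ a)" for j :: nat
  let ?F = "dyadic_filtration G C"
  have F: "?F j = (if j = 0 then carrier G else C (lev j))" for j
    by (simp add: dyadic_filtration_def lev_def)
  have lev: "j \<le> 2 ^ lev j" for j
    unfolding lev_def by (rule LeastI[of _ j]) (rule less_imp_le, rule less_exp)
  have lev_le: "lev j \<le> a" if "j \<le> 2 ^ a" for j a
    unfolding lev_def using that by (rule Least_le)
  have anti: "C b \<subseteq> C a" if "a \<le> b" for a b
    using lift_Suc_antimono_le[of C, OF _ that] sub by blast
  note Cm = subgroup.mem_carrier[OF normal_imp_subgroup[OF C]]
  have norm: "?F i \<lhd> G" for i by (simp add: F C normal_self)
  have F0: "?F 0 = carrier G" by (simp add: F)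
  have FS: "?F (Suc i) \<subseteq> ?F i" for i
  proof (cases "i = 0")
    case True
    then show ?thesis using Cm by (auto simp: F)
  next
    case False
    have "lev i \<le> lev (Suc i)" by (rule lev_le) (use lev[of "Suc i"] in simp)
    then show ?thesis using False anti by (simp add: F)
  qed
  have FC: "x \<otimes> y \<otimes> inv x \<otimes> inv y \<in> ?F (i + j)" if x: "x \<in> ?F i" and y: "y \<in> ?F j" for i j x y
  proof -
    have xc: "x \<in> carrier G" and yc: "y \<in> carrier G"
      using x y subgroup.mem_carrier[OF normal_imp_subgroup[OF norm]] by blast+
    \<comment> \<open>A commutator lies in every normal subgroup that contains one of its entries;
      this settles \<open>i = 0\<close> and \<open>j = 0\<close>.\<close>
    have mult_conj: "x \<otimes> y \<otimes> inv x \<otimes> inv y \<in> ?F j"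
      using normal.inv_op_closed2[OF norm xc y] y normal_imp_subgroup[OF norm]
        subgroup.m_closed subgroup.m_inv_closed by metis
    have "x \<otimes> (y \<otimes> inv x \<otimes> inv y) \<in> ?F i"
      using normal.inv_op_closed2[OF norm yc, of "inv x" i] x normal_imp_subgroup[OF norm]
        subgroup.m_closed subgroup.m_inv_closed by metis
    then have mult_conj': "x \<otimes> y \<otimes> inv x \<otimes> inv y \<in> ?F i" using xc yc by (simp add: m_assoc)
    show "x \<otimes> y \<otimes> inv x \<otimes> inv y \<in> ?F (i + j)"
    proof (cases "i = 0 \<or> j = 0")
      case True
      then show ?thesis using mult_conj mult_conj' by auto
    next
      case False
      then have x': "x \<in> C (lev i)" and y': "y \<in> C (lev j)" using x y by (auto simp: F)
      \<comment> \<open>If both indices are at most \<open>2^a\<close>, their sum is at most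
        \<open>2^(a+1)\<close>. Adding indices thus raises the exponent by at most one over the
        larger of the two, and one commutator with \<open>C 0\<close> provides that.\<close>
      have le: "lev (i + j) \<le> Suc a" if "lev i \<le> a" "lev j \<le> a" for a
      proof (rule lev_le)
        have "i \<le> 2 ^ a" "j \<le> 2 ^ a"
          using lev[of i] lev[of j] that power_increasing[of _ a "2::nat"] by (meson le_trans one_le_numeral)+
        then show "i + j \<le> 2 ^ Suc a" by simp
      qed
      have "x \<otimes> y \<otimes> inv x \<otimes> inv y \<in> C (lev (i + j))"
      proof (cases "lev j \<le> lev i")
        case True
        have "y \<in> C 0" using y' anti[of 0] by blast
        then show ?thesis using com[OF x'] anti[OF le[OF order.refl True]] by blast
      next
        case False
        have "x \<in> C 0" using x' anti[of 0] by blast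
        then have "y \<otimes> x \<otimes> inv y \<otimes> inv x \<in> C (Suc (lev j))" using com[OF y'] by blast
        then have "inv (y \<otimes> x \<otimes> inv y \<otimes> inv x) \<in> C (Suc (lev j))"
          using subgroup.m_inv_closed[OF normal_imp_subgroup[OF C]] by blast
        then have "x \<otimes> y \<otimes> inv x \<otimes> inv y \<in> C (Suc (lev j))" using xc yc by (simp add: inv_mult_group m_assoc)
        then show ?thesis using anti[OF le[of "lev j"]] False by auto
      qed
      then show ?thesis using False by (simp add: F)
    qed
  qed
  show ?thesis
    by (intro group_filtration.intro group_filtration_axioms.intro is_group F0 norm FS FC)
qed

section \<open>The lower central series of a subgroup, computed in the ambient group\<close>

lemma (in group) lower_central_restrict_Suc:
  assumes N: "subgroup N G"
  shows "lower_central (G\<lparr>carrier := N\<rparr>) (Suc a) =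
    generate G {x \<otimes> y \<otimes> inv x \<otimes> inv y | x y. x \<in> lower_central (G\<lparr>carrier := N\<rparr>) a \<and> y \<in> N}"
    and "lower_central (G\<lparr>carrier := N\<rparr>) a \<subseteq> N"
proof -
  let ?N = "G\<lparr>carrier := N\<rparr>"
  let ?S = "\<lambda>a. {x \<otimes> y \<otimes> inv x \<otimes> inv y | x y. x \<in> lower_central ?N a \<and> y \<in> N}"
  interpret N: group ?N using subgroup_imp_group[OF N] .
  have step: "lower_central ?N (Suc a) = generate G (?S a) \<and> lower_central ?N (Suc a) \<subseteq> N"
    if sub: "lower_central ?N a \<subseteq> N" for a
  proof -
    have "{h \<otimes>\<^bsub>?N\<^esub> g \<otimes>\<^bsub>?N\<^esub> inv\<^bsub>?N\<^esub> h \<otimes>\<^bsub>?N\<^esub> inv\<^bsub>?N\<^esub> g | h g. h \<in> lower_central ?N a \<and> g \<in> carrier ?N} = ?S a"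
    proof (intro Collect_cong ex_cong1)
      fix z h g
      show "(z = h \<otimes>\<^bsub>?N\<^esub> g \<otimes>\<^bsub>?N\<^esub> inv\<^bsub>?N\<^esub> h \<otimes>\<^bsub>?N\<^esub> inv\<^bsub>?N\<^esub> g \<and> h \<in> lower_central ?N a \<and> g \<in> carrier ?N)
        \<longleftrightarrow> (z = h \<otimes> g \<otimes> inv h \<otimes> inv g \<and> h \<in> lower_central ?N a \<and> g \<in> N)"
      proof (cases "h \<in> lower_central ?N a \<and> g \<in> N")
        case True
        then have "h \<in> N" "g \<in> N" using sub by blast+
        then show ?thesis using m_inv_consistent[OF N] by simp
      qed auto
    qed
    moreover have "?S a \<subseteq> N"
      using sub subgroup.m_closed[OF N] subgroup.m_inv_closed[OF N] by auto
    ultimately show ?thesis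
      using generate_consistent[OF _ N] generate_subgroup_incl[OF _ N] by simp
  qed
  show sub: "lower_central ?N a \<subseteq> N" for a
    by (induction a) (use step in auto)
  show "lower_central ?N (Suc a) = generate G (?S a)"
    using step[OF sub] by blast
qed

lemma (in group) lower_central_restrict_mono:
  assumes "subgroup N G" "subgroup H G" "N \<subseteq> H"
  shows "lower_central (G\<lparr>carrier := N\<rparr>) a \<subseteq> lower_central (G\<lparr>carrier := H\<rparr>) a"
proof (induction a)
  case (Suc a)
  show ?case
    unfolding lower_central_restrict_Suc(1)[OF assms(1)] lower_central_restrict_Suc(1)[OF assms(2)]
    by (rule mono_generate) (use Suc assms(3) in blast)
qed (use assms in simp)

text \<open>The terms are normal in \<open>G\<close> and not just in \<open>N\<close>, because
  conjugation by an element of \<open>G\<close> preserves \<open>N\<close> and permutes the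
  generating commutators.\<close>

lemma (in group) lower_central_restrict_properties:
  assumes N: "N \<lhd> G"
  defines "C \<equiv> lower_central (G\<lparr>carrier := N\<rparr>)"
  shows "C a \<lhd> G" and "C (Suc a) \<subseteq> C a"
    and "x \<in> C a \<Longrightarrow> y \<in> N \<Longrightarrow> x \<otimes> y \<otimes> inv x \<otimes> inv y \<in> C (Suc a)"
proof -
  have sN: "subgroup N G" using N normal_imp_subgroup by blast
  note Nc = subgroup.mem_carrier[OF sN]
  have C_Suc: "C (Suc a) = generate G {x \<otimes> y \<otimes> inv x \<otimes> inv y | x y. x \<in> C a \<and> y \<in> N}" for a
    unfolding C_def by (rule lower_central_restrict_Suc(1)[OF sN])
  have CN: "C a \<subseteq> N" for a unfolding C_def by (rule lower_central_restrict_Suc(2)[OF sN])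
  have norm: "C a \<lhd> G" for a
  proof (induction a)
    case (Suc a)
    show ?case
      unfolding C_Suc
    proof (rule normal_generateI)
      show "{x \<otimes> y \<otimes> inv x \<otimes> inv y | x y. x \<in> C a \<and> y \<in> N} \<subseteq> carrier G"
      proof safe
        fix x y assume "x \<in> C a" "y \<in> N"
        then have "x \<in> carrier G" "y \<in> carrier G" using CN Nc by blast+
        then show "x \<otimes> y \<otimes> inv x \<otimes> inv y \<in> carrier G" by simp
      qed
      fix h g assume "h \<in> {x \<otimes> y \<otimes> inv x \<otimes> inv y | x y. x \<in> C a \<and> y \<in> N}" and g: "g \<in> carrier G"
      then obtain x y where xy: "x \<in> C a" "y \<in> N" "h = x \<otimes> y \<otimes> inv x \<otimes> inv y" by blast
      have c: "x \<in> carrier G" "y \<in> carrier G" using xy CN Nc by blast+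
      let ?x = "g \<otimes> x \<otimes> inv g" and ?y = "g \<otimes> y \<otimes> inv g"
      have "?x \<in> C a" "?y \<in> N" using normal.inv_op_closed2[OF Suc g] normal.inv_op_closed2[OF N g] xy by blast+
      moreover have "g \<otimes> h \<otimes> inv g = ?x \<otimes> ?y \<otimes> inv ?x \<otimes> inv ?y"
        using c g xy by (simp add: m_assoc inv_mult_group)
      ultimately show "g \<otimes> h \<otimes> inv g \<in> {x \<otimes> y \<otimes> inv x \<otimes> inv y | x y. x \<in> C a \<and> y \<in> N}" by blast
    qed
  qed (simp add: C_def N)
  then show "C a \<lhd> G" .
  have sC: "subgroup (C a) G" using normal_imp_subgroup[OF norm] .
  show "C (Suc a) \<subseteq> C a"
    unfolding C_Suc
  proof (rule generate_subgroup_incl[OF _ sC], safe)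
    fix x y assume x: "x \<in> C a" and y: "y \<in> N"
    have c: "x \<in> carrier G" "y \<in> carrier G" using x y CN Nc by blast+
    have "x \<otimes> (y \<otimes> inv x \<otimes> inv y) \<in> C a"
      using normal.inv_op_closed2[OF norm c(2), of "inv x" a] x
        subgroup.m_closed[OF sC] subgroup.m_inv_closed[OF sC] by blast
    then show "x \<otimes> y \<otimes> inv x \<otimes> inv y \<in> C a" using c by (simp add: m_assoc)
  qed
  show "x \<in> C a \<Longrightarrow> y \<in> N \<Longrightarrow> x \<otimes> y \<otimes> inv x \<otimes> inv y \<in> C (Suc a)"
    unfolding C_Suc by (rule generate.incl) blast
qed

section \<open>Powers of a group and limits of measures\<close>

text \<open>Coordinates outside \<open>I\<close> equal \<open>\<one>\<close>, the default value used
  with \<open>Pi_pmf\<close>, so that subgroups and cosets of box form are sets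
  \<open>PiE_dflt\<close>, whose measure is a product.\<close>

definition power_group :: "('a, 'b) monoid_scheme \<Rightarrow> 'i set \<Rightarrow> ('i \<Rightarrow> 'a) monoid" where
  "power_group G I = \<lparr>carrier = PiE_dflt I \<one>\<^bsub>G\<^esub> (\<lambda>_. carrier G),
     monoid.mult = (\<lambda>x y i. x i \<otimes>\<^bsub>G\<^esub> y i), one = (\<lambda>_. \<one>\<^bsub>G\<^esub>)\<rparr>"

definition power_single :: "('a, 'b) monoid_scheme \<Rightarrow> 'i \<Rightarrow> 'a \<Rightarrow> 'i \<Rightarrow> 'a" where
  "power_single G i g = (\<lambda>j. if j = i then g else \<one>\<^bsub>G\<^esub>)"

lemma power_group_simps [simp]:
  "carrier (power_group G I) = PiE_dflt I \<one>\<^bsub>G\<^esub> (\<lambda>_. carrier G)"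
  "(x \<otimes>\<^bsub>power_group G I\<^esub> y) i = x i \<otimes>\<^bsub>G\<^esub> y i"
  "\<one>\<^bsub>power_group G I\<^esub> i = \<one>\<^bsub>G\<^esub>"
  by (simp_all add: power_group_def)

context group
begin

lemma power_group_apply_closed: "x \<in> PiE_dflt I \<one> (\<lambda>_. carrier G) \<Longrightarrow> x i \<in> carrier G"
  by (cases "i \<in> I") (simp_all add: PiE_dflt_def)

lemma group_power_group: "group (power_group G I)"
proof (rule groupI)
  fix x assume x: "x \<in> carrier (power_group G I)"
  then have "x i \<in> carrier G" for i using power_group_apply_closed by simp
  with x show "\<exists>y\<in>carrier (power_group G I). y \<otimes>\<^bsub>power_group G I\<^esub> x = \<one>\<^bsub>power_group G I\<^esub>"
    by (intro bexI[of _ "\<lambda>i. inv x i"]) (auto simp: PiE_dflt_def power_group_def)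
next
  fix x y z
  assume "x \<in> carrier (power_group G I)" "y \<in> carrier (power_group G I)" "z \<in> carrier (power_group G I)"
  then have "x i \<in> carrier G" "y i \<in> carrier G" "z i \<in> carrier G" for i
    using power_group_apply_closed by simp_all
  then show "x \<otimes>\<^bsub>power_group G I\<^esub> y \<otimes>\<^bsub>power_group G I\<^esub> z = x \<otimes>\<^bsub>power_group G I\<^esub> (y \<otimes>\<^bsub>power_group G I\<^esub> z)"
    by (simp add: fun_eq_iff m_assoc)
next
  fix x assume "x \<in> carrier (power_group G I)"
  then have "x i \<in> carrier G" for i using power_group_apply_closed by simp
  then show "\<one>\<^bsub>power_group G I\<^esub> \<otimes>\<^bsub>power_group G I\<^esub> x = x" by (simp add: fun_eq_iff)
qed (auto simp: PiE_dflt_def power_group_def)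

lemma power_group_inv:
  assumes "x \<in> carrier (power_group G I)"
  shows "(inv\<^bsub>power_group G I\<^esub> x) i = inv (x i)"
proof -
  have "inv\<^bsub>power_group G I\<^esub> x = (\<lambda>i. inv (x i))"
  proof (rule group.inv_equality[OF group_power_group _ assms])
    have "x i \<in> carrier G" for i using assms power_group_apply_closed by simp
    then show "(\<lambda>i. inv x i) \<otimes>\<^bsub>power_group G I\<^esub> x = \<one>\<^bsub>power_group G I\<^esub>"
      by (simp add: power_group_def)
    show "(\<lambda>i. inv x i) \<in> carrier (power_group G I)"
      using assms by (auto simp: PiE_dflt_def)
  qed
  then show ?thesis by simp
qed

lemma power_single_hom: "i \<in> I \<Longrightarrow> power_single G i \<in> hom G (power_group G I)"
  by (rule homI) (auto simp: power_single_def power_group_def PiE_dflt_def)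

lemma power_single_group_hom: "i \<in> I \<Longrightarrow> group_hom G (power_group G I) (power_single G i)"
  by (simp add: group_hom_def group_hom_axioms_def power_single_hom group_power_group)

text \<open>An element is the finite product of its coordinates, each placed in its own
  slot.\<close>

lemma power_group_generated:
  assumes "finite I" "subgroup K (power_group G I)" "x \<in> carrier (power_group G I)"
    and single: "\<And>i. i \<in> I \<Longrightarrow> power_single G i (x i) \<in> K"
  shows "x \<in> K"
proof -
  have xc: "x i \<in> carrier G" for i using assms(3) power_group_apply_closed by simp
  have "J \<subseteq> I \<Longrightarrow> (\<lambda>i. if i \<in> J then x i else \<one>) \<in> K" if "finite J" for J
    using that
  proof (induction J rule: finite_induct)
    case empty
    have "\<one>\<^bsub>power_group G I\<^esub> \<in> K" using subgroup.one_closed[OF assms(2)] .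
    then show ?case by (simp add: power_group_def)
  next
    case (insert j J)
    then have "power_single G j (x j) \<otimes>\<^bsub>power_group G I\<^esub> (\<lambda>i. if i \<in> J then x i else \<one>) \<in> K"
      using subgroup.m_closed[OF assms(2)] single by simp
    moreover have "power_single G j (x j) \<otimes>\<^bsub>power_group G I\<^esub> (\<lambda>i. if i \<in> J then x i else \<one>)
        = (\<lambda>i. if i \<in> insert j J then x i else \<one>)"
      using insert.hyps xc by (auto simp: fun_eq_iff power_single_def)
    ultimately show ?case by simp
  qed
  from this[OF assms(1) order.refl] have "(\<lambda>i. if i \<in> I then x i else \<one>) \<in> K" .
  moreover have "(\<lambda>i. if i \<in> I then x i else \<one>) = x"
    using assms(3) by (auto simp: PiE_dflt_def)
  ultimately show ?thesis by simp
qed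

lemma power_group_finitely_generated:
  assumes "finite I" and S: "finite S" "S \<subseteq> carrier G" "generate G S = carrier G"
  obtains S' where "finite S'" "S' \<subseteq> carrier (power_group G I)"
    "generate (power_group G I) S' = carrier (power_group G I)"
proof -
  define S' where "S' = (\<Union>i\<in>I. power_single G i ` S)"
  have S'c: "S' \<subseteq> carrier (power_group G I)"
  proof
    fix x assume "x \<in> S'"
    then obtain i s where i: "i \<in> I" and s: "s \<in> S" "x = power_single G i s" by (auto simp: S'_def)
    then show "x \<in> carrier (power_group G I)"
      using hom_in_carrier[OF power_single_hom[OF i]] S(2) by blast
  qed
  have sub: "subgroup (generate (power_group G I) S') (power_group G I)"
    by (rule group.generate_is_subgroup[OF group_power_group S'c])
  have "carrier (power_group G I) \<subseteq> generate (power_group G I) S'"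
  proof
    fix x assume x: "x \<in> carrier (power_group G I)"
    show "x \<in> generate (power_group G I) S'"
    proof (rule power_group_generated[OF assms(1) sub x])
      fix i assume i: "i \<in> I"
      have "x i \<in> generate G S" using x i S(3) by (simp add: PiE_dflt_def)
      then have "power_single G i (x i) \<in> generate (power_group G I) (power_single G i ` S)"
        using group_hom.generate_img[OF power_single_group_hom[OF i] S(2)] by blast
      moreover have "generate (power_group G I) (power_single G i ` S) \<subseteq> generate (power_group G I) S'"
        by (rule group.mono_generate[OF group_power_group]) (use i in \<open>auto simp: S'_def\<close>)
      ultimately show "power_single G i (x i) \<in> generate (power_group G I) S'" by blast
    qed
  qed
  then have "generate (power_group G I) S' = carrier (power_group G I)"
    using subgroup.subset[OF sub] by blast
  moreover have "finite S'" using assms(1) S(1) by (simp add: S'_def)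
  ultimately show thesis using that S'c by blast
qed

lemma subgroup_PiE_dflt:
  assumes "\<And>i. i \<in> I \<Longrightarrow> subgroup (L i) G"
  shows "subgroup (PiE_dflt I \<one> L) (power_group G I)"
proof (rule group.subgroupI[OF group_power_group])
  show sub: "PiE_dflt I \<one> L \<subseteq> carrier (power_group G I)"
    using subgroup.mem_carrier[OF assms] by (auto simp: PiE_dflt_def)
  have "(\<lambda>_. \<one>) \<in> PiE_dflt I \<one> L" using subgroup.one_closed[OF assms] by (simp add: PiE_dflt_def)
  then show "PiE_dflt I \<one> L \<noteq> {}" by blast
  fix x assume x: "x \<in> PiE_dflt I \<one> L"
  have xc: "x \<in> carrier (power_group G I)" using x sub by blast
  show "inv\<^bsub>power_group G I\<^esub> x \<in> PiE_dflt I \<one> L"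
    using x subgroup.m_inv_closed[OF assms] by (auto simp: PiE_dflt_def power_group_inv[OF xc])
  fix y assume "y \<in> PiE_dflt I \<one> L"
  with x show "x \<otimes>\<^bsub>power_group G I\<^esub> y \<in> PiE_dflt I \<one> L"
    using subgroup.m_closed[OF assms] by (auto simp: PiE_dflt_def)
qed

lemma finite_index_PiE_dflt:
  assumes "finite I" "\<And>i. i \<in> I \<Longrightarrow> finite_index G (L i)"
  shows "finite_index (power_group G I) (PiE_dflt I \<one> L)"
proof -
  have L: "subgroup (L i) G" "finite (lcosets (L i))" if "i \<in> I" for i
    using assms(2)[OF that] by (simp_all add: finite_index_def)
  let ?c = "\<lambda>x. \<lambda>i\<in>I. x i <# L i"
  have "?c ` carrier (power_group G I) \<subseteq> (\<Pi>\<^sub>E i\<in>I. lcosets (L i))"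
    by (auto simp: PiE_dflt_def)
  then have fin: "finite (?c ` carrier (power_group G I))"
    by (rule finite_subset) (use assms(1) L in \<open>auto intro!: finite_PiE\<close>)
  have "subgroup (PiE_dflt I \<one> L) (power_group G I)"
    by (rule subgroup_PiE_dflt) (rule L(1))
  then show ?thesis
  proof (rule group.finite_indexI[OF group_power_group _ fin])
    fix x y assume x: "x \<in> carrier (power_group G I)" and y: "y \<in> carrier (power_group G I)"
      and eq: "?c x = ?c y"
    have "inv (x i) \<otimes> y i \<in> L i" if i: "i \<in> I" for i
    proof -
      have "x i <# L i = y i <# L i" using fun_cong[OF eq, of i] i by simp
      then show ?thesis using l_coset_eq_iff[OF L(1)[OF i]] x y i by (simp add: PiE_dflt_def)
    qed
    then show "inv\<^bsub>power_group G I\<^esub> x \<otimes>\<^bsub>power_group G I\<^esub> y \<in> PiE_dflt I \<one> L"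
      using x y by (auto simp: PiE_dflt_def power_group_inv[OF x])
  qed
qed

lemma l_coset_PiE_dflt:
  assumes x: "x \<in> carrier (power_group G I)" and L: "\<And>i. i \<in> I \<Longrightarrow> subgroup (L i) G"
  shows "x <#\<^bsub>power_group G I\<^esub> PiE_dflt I \<one> L = PiE_dflt I \<one> (\<lambda>i. x i <# L i)"
proof (intro equalityI subsetI)
  fix z assume "z \<in> x <#\<^bsub>power_group G I\<^esub> PiE_dflt I \<one> L"
  then obtain y where "y \<in> PiE_dflt I \<one> L" "z = x \<otimes>\<^bsub>power_group G I\<^esub> y" by (auto simp: l_coset_def)
  with x show "z \<in> PiE_dflt I \<one> (\<lambda>i. x i <# L i)"
    by (auto simp: PiE_dflt_def l_coset_def)
next
  fix z assume z: "z \<in> PiE_dflt I \<one> (\<lambda>i. x i <# L i)"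
  define y where "y i = inv (x i) \<otimes> z i" for i
  have zi: "inv (x i) \<otimes> z i \<in> L i \<and> z i \<in> carrier G" if i: "i \<in> I" for i
  proof -
    have xi: "x i \<in> carrier G" using x i by (simp add: PiE_dflt_def)
    obtain h where h: "h \<in> L i" "z i = x i \<otimes> h" using z i by (auto simp: PiE_dflt_def l_coset_def)
    then have "h \<in> carrier G" using subgroup.mem_carrier[OF L[OF i]] by blast
    then show ?thesis using h xi by simp
  qed
  have "y \<in> PiE_dflt I \<one> L" using x z zi by (auto simp: PiE_dflt_def y_def)
  moreover have "z = x \<otimes>\<^bsub>power_group G I\<^esub> y"
  proof
    fix i show "z i = (x \<otimes>\<^bsub>power_group G I\<^esub> y) i"
      using x z zi[of i] by (cases "i \<in> I") (simp_all add: PiE_dflt_def y_def)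
  qed
  ultimately show "z \<in> x <#\<^bsub>power_group G I\<^esub> PiE_dflt I \<one> L" by (auto simp: l_coset_def)
qed

text \<open>Limits of the measures are directly available for boxes only. \<open>L i\<close> is the
  preimage of \<open>K\<close> under the \<open>i\<close>-th coordinate embedding.\<close>

lemma finite_index_contains_box:
  assumes "finite I" and K: "finite_index (power_group G I) K"
  obtains L where "\<And>i. i \<in> I \<Longrightarrow> finite_index G (L i)" "PiE_dflt I \<one> L \<subseteq> K"
proof -
  interpret P: group "power_group G I" by (rule group_power_group)
  have sK: "subgroup K (power_group G I)" using K by (simp add: finite_index_def)
  define L where "L i = {g \<in> carrier G. power_single G i g \<in> K}" for i
  have sL: "subgroup (L i) G" if i: "i \<in> I" for i
  proof -
    interpret s: group_hom G "power_group G I" "power_single G i" by (rule power_single_group_hom[OF i])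
    show ?thesis
    proof (rule subgroupI)
      have "\<one> \<in> L i" using subgroup.one_closed[OF sK] by (simp add: L_def s.hom_one)
      then show "L i \<noteq> {}" by blast
    qed (use subgroup.m_closed[OF sK] subgroup.m_inv_closed[OF sK] in \<open>auto simp: L_def\<close>)
  qed
  have "finite_index G (L i)" if i: "i \<in> I" for i
  proof (rule finite_indexI[OF sL[OF i]])
    interpret s: group_hom G "power_group G I" "power_single G i" by (rule power_single_group_hom[OF i])
    let ?c = "\<lambda>g. power_single G i g <#\<^bsub>power_group G I\<^esub> K"
    have "?c ` carrier G \<subseteq> lcosets\<^bsub>power_group G I\<^esub> K"
      by (auto simp del: power_group_simps)
    then show "finite (?c ` carrier G)"
      by (rule finite_subset) (use K in \<open>simp add: finite_index_def\<close>)
    fix g h assume g: "g \<in> carrier G" and h: "h \<in> carrier G" and eq: "?c g = ?c h"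
    have "inv\<^bsub>power_group G I\<^esub> power_single G i g \<otimes>\<^bsub>power_group G I\<^esub> power_single G i h \<in> K"
      using P.l_coset_eq_iff[OF sK s.hom_closed[OF g] s.hom_closed[OF h]] eq by blast
    then show "inv g \<otimes> h \<in> L i" using g h by (simp add: L_def)
  qed
  moreover have "PiE_dflt I \<one> L \<subseteq> K"
  proof
    fix x assume x: "x \<in> PiE_dflt I \<one> L"
    show "x \<in> K"
      by (rule power_group_generated[OF assms(1) sK]) (use x in \<open>auto simp: PiE_dflt_def L_def\<close>)
  qed
  ultimately show thesis using that by blast
qed

end

text \<open>One number \<open>l\<close> serves all sequences, so existence of the limit and
  independence of the sequence are proved together.\<close>

definition universal_limit :: "('a, 'b) monoid_scheme \<Rightarrow> nat \<Rightarrow> (nat \<Rightarrow> 'a) set \<Rightarrow> real \<Rightarrow> bool" where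
  "universal_limit G k V l \<longleftrightarrow> (\<forall>M. measures_index_uniformly G M \<longrightarrow>
     (\<lambda>n. measure_pmf.prob (Pi_pmf {1..k} \<one>\<^bsub>G\<^esub> (\<lambda>_. M n)) V) \<longlonglongrightarrow> l)"

lemma universal_limit_empty: "universal_limit G k {} 0"
  by (simp add: universal_limit_def)

context group
begin

lemma measures_index_uniformly_coset:
  assumes "measures_index_uniformly G M" "x \<in> carrier G" "subgroup H G"
  shows "(\<lambda>n. measure_pmf.prob (M n) (x <# H)) \<longlonglongrightarrow> inverse_index G H"
proof -
  have u: "uniform_limit (carrier G \<times> {H. subgroup H G})
       (\<lambda>n (x, H). measure_pmf.prob (M n) (x <# H))
       (\<lambda>(x, H). inverse_index G H) sequentially"
    using assms(1) by (simp add: measures_index_uniformly_def)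
  from tendsto_uniform_limitI[OF u, of "(x, H)"] show ?thesis using assms by simp
qed

lemma universal_limit_box:
  assumes x: "x \<in> carrier (power_group G {1..k})" and L: "\<And>i. i \<in> {1..k} \<Longrightarrow> subgroup (L i) G"
  shows "universal_limit G k (x <#\<^bsub>power_group G {1..k}\<^esub> PiE_dflt {1..k} \<one> L)
    (\<Prod>i=1..k. inverse_index G (L i))"
  unfolding universal_limit_def
proof (intro allI impI)
  fix M assume M: "measures_index_uniformly G M"
  have box: "x <#\<^bsub>power_group G {1..k}\<^esub> PiE_dflt {1..k} \<one> L = PiE_dflt {1..k} \<one> (\<lambda>i. x i <# L i)"
    by (rule l_coset_PiE_dflt[OF x]) (rule L)
  have "(\<lambda>n. \<Prod>i=1..k. measure_pmf.prob (M n) (x i <# L i)) \<longlonglongrightarrow> (\<Prod>i=1..k. inverse_index G (L i))"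
    by (intro tendsto_prod measures_index_uniformly_coset[OF M _ L]) (use x in \<open>auto simp: PiE_dflt_def\<close>)
  then show "(\<lambda>n. measure_pmf.prob (Pi_pmf {1..k} \<one> (\<lambda>_. M n)) (x <#\<^bsub>power_group G {1..k}\<^esub> PiE_dflt {1..k} \<one> L))
      \<longlonglongrightarrow> (\<Prod>i=1..k. inverse_index G (L i))"
    unfolding box by (simp add: measure_Pi_pmf_PiE_dflt)
qed

lemma l_coset_disjoint:
  assumes "x \<in> carrier G" "C \<subseteq> carrier G" "D \<subseteq> carrier G" "C \<inter> D = {}"
  shows "(x <# C) \<inter> (x <# D) = {}"
proof (rule ccontr)
  assume "(x <# C) \<inter> (x <# D) \<noteq> {}"
  then obtain c d where "c \<in> C" "d \<in> D" "x \<otimes> c = x \<otimes> d" by (auto simp: l_coset_def)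
  then have "c = d" using assms by (metis inv_cancel_left(1) subsetD)
  with \<open>c \<in> C\<close> \<open>d \<in> D\<close> assms(4) show False by blast
qed

lemma prob_coset_partition:
  fixes p :: "'a pmf"
  assumes H: "subgroup H G" and K: "finite_index (G\<lparr>carrier := H\<rparr>) K" and x: "x \<in> carrier G"
  shows "measure_pmf.prob p ((x <# H) \<inter> V) =
    (\<Sum>C\<in>lcosets\<^bsub>G\<lparr>carrier := H\<rparr>\<^esub> K. measure_pmf.prob p ((x <# C) \<inter> V))"
proof -
  let ?X = "lcosets\<^bsub>G\<lparr>carrier := H\<rparr>\<^esub> K"
  interpret H: group "G\<lparr>carrier := H\<rparr>" by (rule subgroup_imp_group[OF H])
  have sK: "subgroup K (G\<lparr>carrier := H\<rparr>)" and fin: "finite ?X" using K by (simp_all add: finite_index_def)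
  have U: "\<Union> ?X = H" using H.lcosets_part_G[OF sK] by simp
  have Hc: "H \<subseteq> carrier G" using subgroup.subset[OF H] .
  have "(x <# H) \<inter> V = (\<Union>C\<in>?X. (x <# C) \<inter> V)"
  proof -
    have "x <# \<Union> X = (\<Union>C\<in>X. x <# C)" for X by (auto simp: l_coset_def)
    from this[of ?X] show ?thesis unfolding U by blast
  qed
  also have "measure_pmf.prob p \<dots> = (\<Sum>C\<in>?X. measure_pmf.prob p ((x <# C) \<inter> V))"
  proof (rule measure_pmf.finite_measure_finite_Union[OF fin])
    show "disjoint_family_on (\<lambda>C. (x <# C) \<inter> V) ?X"
      unfolding disjoint_family_on_def
    proof (intro ballI impI)
      fix C D assume CD: "C \<in> ?X" "D \<in> ?X" "C \<noteq> D"
      then have "C \<inter> D = {}" using H.lcos_disjoint[OF sK] by blast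
      moreover have "C \<subseteq> carrier G" "D \<subseteq> carrier G" using CD U Hc by blast+
      ultimately have "(x <# C) \<inter> (x <# D) = {}" using l_coset_disjoint[OF x] by blast
      then show "(x <# C) \<inter> V \<inter> ((x <# D) \<inter> V) = {}" by blast
    qed
  qed auto
  finally show ?thesis .
qed

lemma lcosets_restrictE:
  assumes H: "subgroup H G" and K: "subgroup K G" and x: "x \<in> carrier G"
    and C: "C \<in> lcosets\<^bsub>G\<lparr>carrier := H\<rparr>\<^esub> K"
  obtains t where "t \<in> H" "t \<in> carrier G" "x <# C = (x \<otimes> t) <# K"
proof -
  obtain t where t: "t \<in> H" "C = t <# K" using C by (auto simp: LCOSETS_def)
  then have "t \<in> carrier G" using subgroup.mem_carrier[OF H] by blast
  moreover from this have "x <# C = (x \<otimes> t) <# K"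
    using t x lcos_m_assoc[OF subgroup.subset[OF K]] by simp
  ultimately show thesis using t that by blast
qed

text \<open>\<open>V\<close> may behave differently on the various cosets of \<open>K\<close>; this
  glues the cases of the induction together.\<close>

lemma universal_limit_split:
  assumes H: "subgroup H (power_group G {1..k})"
    and K: "finite_index (power_group G {1..k}\<lparr>carrier := H\<rparr>) K"
    and x: "x \<in> carrier (power_group G {1..k})"
    and C: "\<And>C. C \<in> lcosets\<^bsub>power_group G {1..k}\<lparr>carrier := H\<rparr>\<^esub> K \<Longrightarrow>
      universal_limit G k ((x <#\<^bsub>power_group G {1..k}\<^esub> C) \<inter> V) (l C)"
  shows "universal_limit G k ((x <#\<^bsub>power_group G {1..k}\<^esub> H) \<inter> V)
    (\<Sum>C\<in>lcosets\<^bsub>power_group G {1..k}\<lparr>carrier := H\<rparr>\<^esub> K. l C)"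
  unfolding universal_limit_def
proof (intro allI impI)
  fix M assume M: "measures_index_uniformly G M"
  show "(\<lambda>n. measure_pmf.prob (Pi_pmf {1..k} \<one> (\<lambda>_. M n)) ((x <#\<^bsub>power_group G {1..k}\<^esub> H) \<inter> V))
      \<longlonglongrightarrow> (\<Sum>C\<in>lcosets\<^bsub>power_group G {1..k}\<lparr>carrier := H\<rparr>\<^esub> K. l C)"
    unfolding group.prob_coset_partition[OF group_power_group H K x]
    by (rule tendsto_sum) (use C M in \<open>unfold universal_limit_def, blast\<close>)
qed

text \<open>One \<open>l\<close> works for all \<open>x\<close>: each coset splits into equally many
  cosets of a box inside \<open>K\<close>, and their limit depends on the box only. This
  equidistribution turns the counting of cosets into an estimate of measures.\<close>

lemma universal_limit_coset:
  assumes K: "finite_index (power_group G {1..k}) K"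
  shows "\<exists>l. \<forall>x\<in>carrier (power_group G {1..k}). universal_limit G k (x <#\<^bsub>power_group G {1..k}\<^esub> K) l"
proof -
  let ?P = "power_group G {1..k}"
  interpret P: group ?P by (rule group_power_group)
  obtain L where L: "\<And>i. i \<in> {1..k} \<Longrightarrow> finite_index G (L i)" "PiE_dflt {1..k} \<one> L \<subseteq> K"
    using finite_index_contains_box[OF _ K] by blast
  define B where "B = PiE_dflt {1..k} \<one> L"
  have B: "finite_index ?P B" unfolding B_def using finite_index_PiE_dflt L(1) by blast
  have sK: "subgroup K ?P" using K by (simp add: finite_index_def)
  have sB: "subgroup B ?P" using B by (simp add: finite_index_def)
  have sL: "subgroup (L i) G" if "i \<in> {1..k}" for i using L(1)[OF that] by (simp add: finite_index_def)
  have BK: "finite_index (?P\<lparr>carrier := K\<rparr>) B"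
    using P.finite_index_restrict[OF B _ sK] L(2) by (simp add: B_def)
  let ?l = "\<Sum>C\<in>lcosets\<^bsub>?P\<lparr>carrier := K\<rparr>\<^esub> B. \<Prod>i=1..k. inverse_index G (L i)"
  have "universal_limit G k ((x <#\<^bsub>?P\<^esub> K) \<inter> UNIV) ?l" if x: "x \<in> carrier ?P" for x
  proof (rule universal_limit_split[OF sK BK x])
    fix C assume "C \<in> lcosets\<^bsub>?P\<lparr>carrier := K\<rparr>\<^esub> B"
    then obtain t where t: "t \<in> carrier ?P" "x <#\<^bsub>?P\<^esub> C = (x \<otimes>\<^bsub>?P\<^esub> t) <#\<^bsub>?P\<^esub> B"
      using P.lcosets_restrictE[OF sK sB x] by metis
    show "universal_limit G k ((x <#\<^bsub>?P\<^esub> C) \<inter> UNIV) (\<Prod>i=1..k. inverse_index G (L i))"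
      unfolding t(2) B_def Int_UNIV_right
      by (rule universal_limit_box[OF P.m_closed[OF x t(1)] sL])
  qed
  then show ?thesis by auto
qed

text \<open>The cosets of \<open>K\<close> inside \<open>x <# H\<close> share one limit
  \<open>l\<close> and are disjoint, so \<open>l\<close> is at most the inverse of their number.
  Those that meet \<open>V\<close> are at most an \<open>\<epsilon> / 2\<close> fraction, so their
  total limit is at most \<open>\<epsilon> / 2\<close>; the halving leaves room for a strict
  inequality.\<close>

lemma universal_limit_null:
  assumes H: "finite_index (power_group G {1..k}) H" and x: "x \<in> carrier (power_group G {1..k})"
    and null: "null_set (power_group G {1..k}\<lparr>carrier := H\<rparr>) {y \<in> H. x \<otimes>\<^bsub>power_group G {1..k}\<^esub> y \<in> V}"
  shows "universal_limit G k ((x <#\<^bsub>power_group G {1..k}\<^esub> H) \<inter> V) 0"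
  unfolding universal_limit_def
proof (intro allI impI)
  let ?P = "power_group G {1..k}" and ?H = "power_group G {1..k}\<lparr>carrier := H\<rparr>"
  interpret P: group ?P by (rule group_power_group)
  fix M assume M: "measures_index_uniformly G M"
  define \<nu> where "\<nu> n A = measure_pmf.prob (Pi_pmf {1..k} \<one> (\<lambda>_. M n)) A" for n A
  have sH: "subgroup H ?P" using H by (simp add: finite_index_def)
  interpret H: group ?H by (rule P.subgroup_imp_group[OF sH])
  have "\<forall>\<^sub>F n in sequentially. \<nu> n ((x <#\<^bsub>?P\<^esub> H) \<inter> V) < \<epsilon>" if "\<epsilon> > 0" for \<epsilon> :: real
  proof -
    have "\<epsilon> / 2 > 0" using that by simp
    with null obtain K where K: "finite_index ?H K"
      and card: "real (card {C \<in> lcosets\<^bsub>?H\<^esub> K. C \<inter> {y \<in> H. x \<otimes>\<^bsub>?P\<^esub> y \<in> V} \<noteq> {}}) \<le> \<epsilon> / 2 * real (card (lcosets\<^bsub>?H\<^esub> K))"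
      unfolding null_set_def by blast
    let ?X = "lcosets\<^bsub>?H\<^esub> K"
    define Y where "Y = {C \<in> ?X. C \<inter> {y \<in> H. x \<otimes>\<^bsub>?P\<^esub> y \<in> V} \<noteq> {}}"
    have finX: "finite ?X" and sKH: "subgroup K ?H" using K by (simp_all add: finite_index_def)
    have fK: "finite_index ?P K" by (rule P.finite_index_trans[OF H K])
    then have sK: "subgroup K ?P" by (simp add: finite_index_def)
    obtain l where l: "\<And>z. z \<in> carrier ?P \<Longrightarrow> universal_limit G k (z <#\<^bsub>?P\<^esub> K) l"
      using universal_limit_coset[OF fK] by blast
    have lim: "(\<lambda>n. \<nu> n (x <#\<^bsub>?P\<^esub> C)) \<longlonglongrightarrow> l" if C: "C \<in> ?X" for C
    proof -
      obtain t where t: "t \<in> carrier ?P" "x <#\<^bsub>?P\<^esub> C = (x \<otimes>\<^bsub>?P\<^esub> t) <#\<^bsub>?P\<^esub> K"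
        using P.lcosets_restrictE[OF sH sK x C] by metis
      show ?thesis
        using l[OF P.m_closed[OF x t(1)]] M unfolding t(2) universal_limit_def \<nu>_def by blast
    qed
    have limX: "(\<lambda>n. \<Sum>C\<in>?X. \<nu> n (x <#\<^bsub>?P\<^esub> C)) \<longlonglongrightarrow> (\<Sum>C\<in>?X. l)"
      by (rule tendsto_sum[OF lim])
    have leX: "(\<Sum>C\<in>?X. \<nu> n (x <#\<^bsub>?P\<^esub> C)) \<le> 1" for n
      using P.prob_coset_partition[OF sH K x, of _ UNIV] measure_pmf.prob_le_1
      unfolding \<nu>_def Int_UNIV_right by metis
    have "(\<Sum>C\<in>?X. l) \<le> 1" by (rule LIMSEQ_le_const2[OF limX]) (intro exI allI impI leX)
    then have l1: "real (card ?X) * l \<le> 1" by simp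
    have l0: "l \<ge> 0"
    proof (rule LIMSEQ_le_const)
      show "(\<lambda>n. \<nu> n (x <#\<^bsub>?P\<^esub> K)) \<longlonglongrightarrow> l"
        using l[OF x] M unfolding universal_limit_def \<nu>_def by blast
    qed (simp add: \<nu>_def)
    have le: "\<nu> n ((x <#\<^bsub>?P\<^esub> H) \<inter> V) \<le> (\<Sum>C\<in>Y. \<nu> n (x <#\<^bsub>?P\<^esub> C))" for n
    proof -
      have "\<nu> n ((x <#\<^bsub>?P\<^esub> H) \<inter> V) = (\<Sum>C\<in>?X. \<nu> n ((x <#\<^bsub>?P\<^esub> C) \<inter> V))"
        unfolding \<nu>_def by (rule P.prob_coset_partition[OF sH K x])
      also have "\<dots> = (\<Sum>C\<in>Y. \<nu> n ((x <#\<^bsub>?P\<^esub> C) \<inter> V))"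
      proof (rule sum.mono_neutral_right[OF finX])
        show "Y \<subseteq> ?X" by (simp add: Y_def)
        show "\<forall>C\<in>?X - Y. \<nu> n ((x <#\<^bsub>?P\<^esub> C) \<inter> V) = 0"
        proof
          fix C assume C: "C \<in> ?X - Y"
          then have "C \<subseteq> H" using H.lcosets_part_G[OF sKH] by auto
          with C have "(x <#\<^bsub>?P\<^esub> C) \<inter> V = {}" by (auto simp: Y_def l_coset_def)
          then show "\<nu> n ((x <#\<^bsub>?P\<^esub> C) \<inter> V) = 0" by (simp add: \<nu>_def)
        qed
      qed
      also have "\<dots> \<le> (\<Sum>C\<in>Y. \<nu> n (x <#\<^bsub>?P\<^esub> C))"
        unfolding \<nu>_def by (intro sum_mono measure_pmf.finite_measure_mono) auto
      finally show ?thesis .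
    qed
    have "(\<lambda>n. \<Sum>C\<in>Y. \<nu> n (x <#\<^bsub>?P\<^esub> C)) \<longlonglongrightarrow> (\<Sum>C\<in>Y. l)"
    proof (rule tendsto_sum)
      fix C assume "C \<in> Y"
      then have "C \<in> ?X" unfolding Y_def by blast
      then show "(\<lambda>n. \<nu> n (x <#\<^bsub>?P\<^esub> C)) \<longlonglongrightarrow> l" by (rule lim)
    qed
    moreover have "(\<Sum>C\<in>Y. l) < \<epsilon>"
    proof -
      have "(\<Sum>C\<in>Y. l) = real (card Y) * l" by simp
      also have "\<dots> \<le> (\<epsilon> / 2 * real (card ?X)) * l"
        using card l0 unfolding Y_def by (rule mult_right_mono)
      also have "\<dots> = \<epsilon> / 2 * (real (card ?X) * l)" by simp
      also have "\<dots> \<le> \<epsilon> / 2 * 1" using l1 \<open>\<epsilon> > 0\<close> by (intro mult_left_mono) auto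
      also have "\<dots> < \<epsilon>" using \<open>\<epsilon> > 0\<close> by simp
      finally show ?thesis .
    qed
    ultimately have "\<forall>\<^sub>F n in sequentially. (\<Sum>C\<in>Y. \<nu> n (x <#\<^bsub>?P\<^esub> C)) < \<epsilon>"
      by (rule order_tendstoD(2))
    then show ?thesis by (rule eventually_mono) (use le in \<open>meson le_less_trans\<close>)
  qed
  then show "(\<lambda>n. measure_pmf.prob (Pi_pmf {1..k} \<one> (\<lambda>_. M n)) ((x <#\<^bsub>?P\<^esub> H) \<inter> V)) \<longlonglongrightarrow> 0"
    unfolding \<nu>_def by (intro order_tendstoI) (auto intro: less_le_trans measure_nonneg always_eventually)
qed

end

section \<open>Solutions of equations\<close>

lemma presented_monoid_induct [consumes 1, case_names one letter]:
  assumes "A \<in> carrier (presented_monoid L R)" "P \<one>\<^bsub>presented_monoid L R\<^esub>"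
    and step: "\<And>x B. x \<in> L \<Longrightarrow> B \<in> carrier (presented_monoid L R) \<Longrightarrow> P B \<Longrightarrow>
      P (word_class L R [x] \<otimes>\<^bsub>presented_monoid L R\<^esub> B)"
  shows "P A"
proof -
  have "P (word_class L R w)" if "w \<in> lists L" for w
    using that
  proof (induction w)
    case Nil
    then show ?case using assms(2) by (simp add: presented_monoid_one)
  next
    case (Cons x w)
    have "word_class L R w \<in> carrier (presented_monoid L R)"
      using Cons(2) by (simp add: presented_monoid_carrier)
    with step[OF Cons(1) this Cons(3)] show ?case
      using presented_monoid_mult[of "[x]" L w R] Cons by simp
  qed
  with assms(1) show ?thesis by (auto simp: presented_monoid_carrier)
qed

lemma free_group_letter_closed:
  "x \<in> S \<Longrightarrow> word_class (free_letters S) free_relations [(x, b)] \<in> carrier (free_group S)"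
  by (auto simp: free_group_def presented_monoid_carrier free_letters_def)

text \<open>For \<open>b = False\<close> the value is forced by the relation that makes the letter
  inverse to the generator.\<close>

lemma free_group_eval_letter:
  assumes "group K" "g \<in> S \<rightarrow> carrier K" "x \<in> S"
  shows "free_group_eval K g (word_class (free_letters S) free_relations [(x, b)]) =
    (if b then g x else inv\<^bsub>K\<^esub> g x)"
proof (cases b)
  case True
  then show ?thesis using free_group_eval_gen[OF assms] by (simp add: free_group_gen_def)
next
  case False
  let ?c = "\<lambda>w. word_class (free_letters S) free_relations w"
  interpret K: group K by fact
  interpret h: group_hom "free_group S" K "free_group_eval K g"
    using free_group_eval_hom[OF assms(1,2)]
    by (simp add: group_hom_def group_hom_axioms_def group_free_group assms(1))
  have l: "[(x, b)] \<in> lists (free_letters S)" for b using assms(3) by (simp add: free_letters_def)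
  have "([(x, False), (x, \<not> False)], []) \<in> free_relations" unfolding free_relations_def by blast
  from word_cong.rel[OF this, of "free_letters S" "[]" "[]"]
  have "word_cong (free_letters S) free_relations [(x, False), (x, True)] []"
    using assms(3) by (simp add: free_letters_def)
  then have "?c [(x, False)] \<otimes>\<^bsub>free_group S\<^esub> ?c [(x, True)] = \<one>\<^bsub>free_group S\<^esub>"
    using presented_monoid_mult[OF l[of False] l[of True]] l assms(3)
    by (simp add: free_group_def presented_monoid_one word_class_eq_iff free_letters_def)
  then have "free_group_eval K g (?c [(x, False)]) \<otimes>\<^bsub>K\<^esub> free_group_eval K g (?c [(x, True)]) = \<one>\<^bsub>K\<^esub>"
    using h.hom_mult[OF free_group_letter_closed[OF assms(3)] free_group_letter_closed[OF assms(3)]]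
      h.hom_one by metis
  moreover have "free_group_eval K g (?c [(x, True)]) = g x"
    using free_group_eval_gen[OF assms] by (simp add: free_group_gen_def)
  moreover have "free_group_eval K g (?c [(x, False)]) \<in> carrier K"
    using h.hom_closed[OF free_group_letter_closed[OF assms(3)]] .
  moreover have "g x \<in> carrier K" using assms by blast
  ultimately show ?thesis using False K.inv_equality by auto
qed

context group_filtration
begin

lemma filtered_poly_one: "filtered_poly L G F i (\<lambda>_. \<one>)"
  by (rule filtered_poly.const[OF subgroup.one_closed[OF F_subgroup]])

text \<open>The value is a word in the coordinates \<open>z y i\<close>, their inverses and
  constants, all of level 0. Two inductions are needed because a letter of the free product may
  itself be an element of the free group.\<close>

lemma filtered_poly_eqn_eval:
  assumes z: "\<And>y. y \<in> carrier L \<Longrightarrow> z y \<in> {1..k} \<rightarrow> carrier G"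
    and poly: "\<And>i. i \<in> {1..k} \<Longrightarrow> filtered_poly L G F 0 (\<lambda>y. z y i)"
    and \<phi>: "\<phi> \<in> equations G k"
  shows "filtered_poly L G F 0 (\<lambda>y. eqn_eval G \<phi> (z y))"
proof -
  have free: "filtered_poly L G F 0 (\<lambda>y. free_group_eval G (z y) u)" if "u \<in> carrier (free_group {1..k})" for u
    using that unfolding free_group_def
  proof (induction u rule: presented_monoid_induct)
    case one
    show ?case
    proof (rule filtered_poly.cong[OF filtered_poly_one])
      fix y assume "y \<in> carrier L"
      from hom_one[OF free_group_eval_hom[OF is_group z[OF this]] group_free_group is_group]
      show "\<one> = free_group_eval G (z y) \<one>\<^bsub>presented_monoid (free_letters {1..k}) free_relations\<^esub>"
        by (simp only: free_group_def)
    qed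
  next
    case (letter x B)
    obtain i b where x: "x = (i, b)" "i \<in> {1..k}" using letter(1) by (auto simp: free_letters_def)
    have "filtered_poly L G F 0 (\<lambda>y. if b then z y i else inv (z y i))"
      using poly[OF x(2)] filtered_poly.inv[OF poly[OF x(2)]] by (cases b) simp_all
    from filtered_poly.mult[OF this letter(3)] show ?case
    proof (rule filtered_poly.cong)
      fix y assume "y \<in> carrier L"
      note zy = z[OF this]
      show "(if b then z y i else inv (z y i)) \<otimes> free_group_eval G (z y) B =
        free_group_eval G (z y) (word_class (free_letters {1..k}) free_relations [x]
          \<otimes>\<^bsub>presented_monoid (free_letters {1..k}) free_relations\<^esub> B)"
        using hom_mult[OF free_group_eval_hom[OF is_group zy] free_group_letter_closed[OF x(2), of b], of B]
          letter(2) free_group_eval_letter[OF is_group zy x(2), of b]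
        by (simp only: free_group_def x(1))
    qed
  qed
  let ?P = "free_product (free_group {1..k}) G"
  have gP: "group ?P" by (rule group_free_product[OF group_free_group is_group])
  have id: "(\<lambda>x. x) \<in> hom G G" by (auto simp: hom_def)
  show ?thesis
    using \<phi> unfolding equations_def free_product_def
  proof (induction \<phi> rule: presented_monoid_induct)
    case one
    show ?case
    proof (rule filtered_poly.cong[OF filtered_poly_one])
      fix y assume "y \<in> carrier L"
      from hom_one[OF eqn_eval_hom[OF is_group z[OF this]] gP is_group]
      show "\<one> = eqn_eval G \<one>\<^bsub>presented_monoid (coprod_letters (free_group {1..k}) G) (coprod_relations (free_group {1..k}) G)\<^esub> (z y)"
        by (simp only: free_product_def)
    qed
  next
    case (letter x B)
    let ?c = "word_class (coprod_letters (free_group {1..k}) G) (coprod_relations (free_group {1..k}) G) [x]"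
    have "filtered_poly L G F 0 (\<lambda>y. eqn_eval G ?c (z y))"
    proof (cases x)
      case (Inl u)
      then have u: "u \<in> carrier (free_group {1..k})" using letter(1) by (auto simp: coprod_letters_def)
      show ?thesis
      proof (rule filtered_poly.cong[OF free[OF u]])
        fix y assume "y \<in> carrier L"
        from free_product_eval_inl[OF group_free_group is_group is_group
            free_group_eval_hom[OF is_group z[OF this]] id u]
        show "free_group_eval G (z y) u = eqn_eval G ?c (z y)"
          by (simp only: eqn_eval_def free_product_inl_def Inl)
      qed
    next
      case (Inr a)
      then have a: "a \<in> carrier G" using letter(1) by (auto simp: coprod_letters_def)
      have "filtered_poly L G F 0 (\<lambda>_. a)" by (rule filtered_poly.const) (simp add: F_0 a)
      then show ?thesis
      proof (rule filtered_poly.cong)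
        fix y assume "y \<in> carrier L"
        from eqn_eval_const[OF is_group z[OF this] a]
        show "a = eqn_eval G ?c (z y)" by (simp only: free_product_inr_def Inr)
      qed
    qed
    from filtered_poly.mult[OF this letter(3)] show ?case
    proof (rule filtered_poly.cong)
      fix y assume "y \<in> carrier L"
      have "?c \<in> carrier ?P" using letter(1) by (auto simp: free_product_def presented_monoid_carrier)
      from hom_mult[OF eqn_eval_hom[OF is_group z[OF \<open>y \<in> carrier L\<close>]] this, of B] letter(2)
      show "eqn_eval G ?c (z y) \<otimes> eqn_eval G B (z y) =
        eqn_eval G (?c \<otimes>\<^bsub>presented_monoid (coprod_letters (free_group {1..k}) G) (coprod_relations (free_group {1..k}) G)\<^esub> B) (z y)"
        by (simp only: free_product_def)
    qed
  qed
qed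

end

section \<open>Descent along the lower central series\<close>

locale nilpotent_equation = group G for G :: "('a, 'b) monoid_scheme" (structure) +
  fixes k :: nat and \<phi> :: "'a equation" and N :: "'a set" and s :: nat and S :: "'a set"
  assumes N: "N \<lhd> G" "finite_index G N"
    and nilpotent: "lower_central (G\<lparr>carrier := N\<rparr>) s = {\<one>}"
    and S: "finite S" "S \<subseteq> carrier G" "generate G S = carrier G"
    and \<phi>: "\<phi> \<in> equations G k"
begin

abbreviation "P \<equiv> power_group G {1..k}"
abbreviation "C \<equiv> lower_central (G\<lparr>carrier := N\<rparr>)"
abbreviation "Nbox \<equiv> PiE_dflt {1..k} \<one> (\<lambda>_. N)"
abbreviation "solutions \<equiv> {g. eqn_eval G \<phi> g = \<one>}"

sublocale P: group P by (rule group_power_group)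

sublocale group_filtration G "dyadic_filtration G C"
  by (rule group_filtration_dyadic) (use lower_central_restrict_properties[OF N(1)] in simp_all)

text \<open>\<open>2^a\<close> is the last index whose term is \<open>C a\<close>. Hence
  \<open>2^a + 1\<close> derivatives of a map of level 0 are trivial modulo
  \<open>C (Suc a)\<close>, which is the degree bound in the induction.\<close>

lemma dyadic_filtration_Suc_power: "dyadic_filtration G C (2 ^ a + 1) \<subseteq> C (Suc a)"
proof -
  define b :: nat where "b = (LEAST b. 2 ^ a + 1 \<le> (2::nat) ^ b)"
  have "(2::nat) ^ a + 1 \<le> 2 ^ b"
    unfolding b_def by (rule LeastI[of _ "Suc a"]) simp
  then have "(2::nat) ^ a < 2 ^ b" by linarith
  then have "a < b" by (rule power_less_imp_less_exp[rotated]) simp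
  then have "C b \<subseteq> C (Suc a)"
    using lift_Suc_antimono_le[of C "Suc a" b] lower_central_restrict_properties(2)[OF N(1)] by simp
  then show ?thesis by (simp add: dyadic_filtration_def b_def)
qed

lemma Nbox: "finite_index P Nbox" "subgroup Nbox P"
proof -
  show "finite_index P Nbox" by (rule finite_index_PiE_dflt) (use N(2) in simp_all)
  then show "subgroup Nbox P" by (simp add: finite_index_def)
qed

text \<open>Each variable is the constant \<open>x i\<close> of level 0 times a coordinate
  projection. The projection is admissible as a homomorphism because \<open>H\<close> lies in the
  box, which puts its values into \<open>N\<close>, the term of index 1.\<close>

lemma filtered_poly_translate:
  assumes H: "subgroup H P" "H \<subseteq> Nbox" and x: "x \<in> carrier P"
  shows "filtered_poly (P\<lparr>carrier := H\<rparr>) G (dyadic_filtration G C) 0 (\<lambda>y. eqn_eval G \<phi> (x \<otimes>\<^bsub>P\<^esub> y))"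
proof (rule filtered_poly_eqn_eval[OF _ _ \<phi>])
  have Hc: "y \<in> carrier P" if "y \<in> H" for y using subgroup.mem_carrier[OF H(1) that] .
  show "x \<otimes>\<^bsub>P\<^esub> y \<in> {1..k} \<rightarrow> carrier G" if "y \<in> carrier (P\<lparr>carrier := H\<rparr>)" for y
  proof -
    have "x \<otimes>\<^bsub>P\<^esub> y \<in> carrier P" using x Hc that by (intro P.m_closed) simp_all
    then show ?thesis by (auto simp: PiE_dflt_def)
  qed
  fix i assume i: "i \<in> {1..k}"
  have "x i \<in> carrier G" using x power_group_apply_closed by simp
  then have "filtered_poly (P\<lparr>carrier := H\<rparr>) G (dyadic_filtration G C) 0 (\<lambda>_. x i)"
    by (intro filtered_poly.const) (simp add: F_0)
  moreover have "filtered_poly (P\<lparr>carrier := H\<rparr>) G (dyadic_filtration G C) 0 (\<lambda>y. y i)"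
  proof (rule filtered_poly.hom)
    show "(\<lambda>y. y i) \<in> hom (P\<lparr>carrier := H\<rparr>) G"
    proof (rule homI)
      fix y assume "y \<in> carrier (P\<lparr>carrier := H\<rparr>)"
      then have "y \<in> carrier P" using Hc by simp
      then show "y i \<in> carrier G" using power_group_apply_closed by simp
    qed simp
    have "(LEAST a. (1::nat) \<le> 2 ^ a) = 0" by (rule Least_eq_0) simp
    then show "(\<lambda>y. y i) ` carrier (P\<lparr>carrier := H\<rparr>) \<subseteq> dyadic_filtration G C 1"
      using H(2) i by (auto simp: dyadic_filtration_def PiE_dflt_def)
  qed
  ultimately have "filtered_poly (P\<lparr>carrier := H\<rparr>) G (dyadic_filtration G C) 0 (\<lambda>y. x i \<otimes> y i)"
    by (rule filtered_poly.mult)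
  then show "filtered_poly (P\<lparr>carrier := H\<rparr>) G (dyadic_filtration G C) 0 (\<lambda>y. (x \<otimes>\<^bsub>P\<^esub> y) i)"
    by simp
qed

text \<open>Induction from the bottom of the lower central series: modulo \<open>C (Suc a)\<close> the equation is a
  polynomial map into an abelian group, so either its zero set is null, or it is constant on the cosets of
  a subgroup of finite index. On these cosets its values lie in \<open>C (Suc a)\<close> or are never trivial.\<close>
lemma universal_limit_solutions_coset:
  assumes "a \<le> s"
  shows "\<forall>H x. finite_index P H \<longrightarrow> H \<subseteq> Nbox \<longrightarrow> x \<in> carrier P \<longrightarrow>
    (\<forall>y\<in>H. eqn_eval G \<phi> (x \<otimes>\<^bsub>P\<^esub> y) \<in> C a) \<longrightarrow>
    (\<exists>l. universal_limit G k ((x <#\<^bsub>P\<^esub> H) \<inter> solutions) l)"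
  using assms
proof (induction a rule: inc_induct)
  \<comment> \<open>\<open>C s\<close> is trivial, so every point of the coset is a
    solution.\<close>
  case base
  show ?case
  proof (intro allI impI)
    fix H x assume H: "finite_index P H" and x: "x \<in> carrier P"
      and "\<forall>y\<in>H. eqn_eval G \<phi> (x \<otimes>\<^bsub>P\<^esub> y) \<in> C s"
    then have "(x <#\<^bsub>P\<^esub> H) \<inter> solutions = x <#\<^bsub>P\<^esub> H"
      unfolding nilpotent by (auto simp: l_coset_def)
    then show "\<exists>l. universal_limit G k ((x <#\<^bsub>P\<^esub> H) \<inter> solutions) l"
      using universal_limit_coset[OF H] x by auto
  qed
next
  case (step a)
  show ?case
  proof (intro allI impI)
    fix H x assume H: "finite_index P H" and Hbox: "H \<subseteq> Nbox" and x: "x \<in> carrier P"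
      and vals: "\<forall>y\<in>H. eqn_eval G \<phi> (x \<otimes>\<^bsub>P\<^esub> y) \<in> C a"
    let ?H = "P\<lparr>carrier := H\<rparr>" and ?D = "C (Suc a)"
    have sH: "subgroup H P" using H by (simp add: finite_index_def)
    interpret H: group ?H by (rule P.subgroup_imp_group[OF sH])
    have D: "?D \<lhd> G" "?D \<subseteq> C a" and Ca: "C a \<lhd> G"
      using lower_central_restrict_properties(1,2)[OF N(1)] by blast+
    have sN: "subgroup N G" using N(1) normal_imp_subgroup by blast
    have CN: "C a \<subseteq> N" by (rule lower_central_restrict_Suc(2)[OF sN])
    have com: "y \<otimes> z \<otimes> inv y \<otimes> inv z \<in> ?D" if "y \<in> C a" "z \<in> C a" for y z
      using lower_central_restrict_properties(3)[OF N(1) that(1)] that(2) CN by blast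
    let ?A = "(G\<lparr>carrier := C a\<rparr>) Mod ?D"
    define f where "f y = ?D #> eqn_eval G \<phi> (x \<otimes>\<^bsub>P\<^esub> y)" for y
    note AC = filtered_poly_imp_poly_map[OF H.is_group normal_imp_subgroup[OF Ca] D com]
    interpret A: comm_group ?A by (rule AC(1))
    interpret poly: poly_maps ?H ?A by unfold_locales
    have f: "poly_map ?H ?A (2 ^ a + 1) f"
      unfolding f_def
      by (rule AC(2)[OF _ _ filtered_poly_translate[OF sH Hbox x]])
        (use vals dyadic_filtration_Suc_power in auto)
    have Dmem: "g \<in> ?D" if "?D #> g = ?D" "g \<in> carrier G" for g
      using coset_join1[OF that normal_imp_subgroup[OF D(1)]] .
    have evc: "eqn_eval G \<phi> (x \<otimes>\<^bsub>P\<^esub> y) \<in> carrier G" if "y \<in> H" for y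
      using vals that CN subgroup.mem_carrier[OF sN] by blast
    have D1: "?D #> \<one> = ?D" using normal_imp_subgroup[OF D(1)] subgroup.subset coset_mult_one by blast
    \<comment> \<open>The dichotomy needs a finite generating set of its domain; \<open>H\<close>
      gets one from \<open>P\<close> through Schreier's generators.\<close>
    obtain T where T: "finite T" "T \<subseteq> carrier P" "generate P T = carrier P"
      using power_group_finitely_generated[OF _ S, of "{1..k}"] by blast
    obtain U where U: "finite U" "U \<subseteq> H" "generate P U = H"
      using P.finite_index_finitely_generated[OF H T] by blast
    have genU: "generate ?H U = carrier ?H"
      using P.generate_consistent[OF U(2) sH] U(3) by simp
    consider K where "finite_index ?H K" "\<forall>y\<in>carrier ?H. \<forall>h\<in>K. f (y \<otimes>\<^bsub>?H\<^esub> h) = f y"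
      | "null_set ?H {y. f y = \<one>\<^bsub>?A\<^esub>}"
      using poly.poly_map_periodic_or_null[OF U(1) _ genU f] U(2) by auto
    then show "\<exists>l. universal_limit G k ((x <#\<^bsub>P\<^esub> H) \<inter> solutions) l"
    proof cases
      case (1 K)
      have sKH: "subgroup K ?H" using 1(1) by (simp add: finite_index_def)
      have fK: "finite_index P K" by (rule P.finite_index_trans[OF H 1(1)])
      then have sK: "subgroup K P" by (simp add: finite_index_def)
      have KH: "K \<subseteq> H" using subgroup.subset[OF sKH] by simp
      have "\<exists>l. universal_limit G k ((x <#\<^bsub>P\<^esub> E) \<inter> solutions) l" if E: "E \<in> lcosets\<^bsub>?H\<^esub> K" for E
      proof -
        obtain t where t: "t \<in> H" "t \<in> carrier P" "x <#\<^bsub>P\<^esub> E = (x \<otimes>\<^bsub>P\<^esub> t) <#\<^bsub>P\<^esub> K"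
          using P.lcosets_restrictE[OF sH sK x E] by metis
        have xt: "x \<otimes>\<^bsub>P\<^esub> t \<in> carrier P" using P.m_closed[OF x t(2)] .
        have assoc: "(x \<otimes>\<^bsub>P\<^esub> t) \<otimes>\<^bsub>P\<^esub> h = x \<otimes>\<^bsub>P\<^esub> (t \<otimes>\<^bsub>P\<^esub> h)" if "h \<in> K" for h
          using P.m_assoc[OF x t(2)] subgroup.mem_carrier[OF sK that] by blast
        have th: "t \<otimes>\<^bsub>P\<^esub> h \<in> H" if "h \<in> K" for h
          using subgroup.m_closed[OF sH t(1)] KH that by blast
        have fth: "f (t \<otimes>\<^bsub>P\<^esub> h) = f t" if "h \<in> K" for h
          using 1(2) t(1) that by simp
        show ?thesis
        proof (cases "f t = ?D")
          case True
          have "\<forall>h\<in>K. eqn_eval G \<phi> ((x \<otimes>\<^bsub>P\<^esub> t) \<otimes>\<^bsub>P\<^esub> h) \<in> ?D"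
          proof
            fix h assume h: "h \<in> K"
            show "eqn_eval G \<phi> ((x \<otimes>\<^bsub>P\<^esub> t) \<otimes>\<^bsub>P\<^esub> h) \<in> ?D"
              unfolding assoc[OF h]
              by (rule Dmem[OF _ evc[OF th[OF h]]]) (use fth[OF h] True in \<open>unfold f_def, blast\<close>)
          qed
          moreover have "K \<subseteq> Nbox" using KH Hbox by blast
          ultimately show ?thesis
            unfolding t(3) using step.IH fK xt by blast
        next
          case False
          have "((x \<otimes>\<^bsub>P\<^esub> t) <#\<^bsub>P\<^esub> K) \<inter> solutions = {}"
          proof (rule ccontr)
            assume "((x \<otimes>\<^bsub>P\<^esub> t) <#\<^bsub>P\<^esub> K) \<inter> solutions \<noteq> {}"
            then obtain h where h: "h \<in> K" "eqn_eval G \<phi> ((x \<otimes>\<^bsub>P\<^esub> t) \<otimes>\<^bsub>P\<^esub> h) = \<one>"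
              by (auto simp: l_coset_def)
            then have "f (t \<otimes>\<^bsub>P\<^esub> h) = ?D" unfolding f_def assoc[OF h(1), symmetric] by (simp only: D1)
            with fth[OF h(1)] False show False by simp
          qed
          then show ?thesis unfolding t(3) using universal_limit_empty by metis
        qed
      qed
      then obtain l where "\<And>E. E \<in> lcosets\<^bsub>?H\<^esub> K \<Longrightarrow> universal_limit G k ((x <#\<^bsub>P\<^esub> E) \<inter> solutions) (l E)"
        by metis
      from universal_limit_split[OF sH 1(1) x this] show ?thesis by blast
    next
      case 2
      have "{y \<in> H. x \<otimes>\<^bsub>P\<^esub> y \<in> solutions} \<subseteq> {y. f y = \<one>\<^bsub>?A\<^esub>}"
      proof
        fix y assume "y \<in> {y \<in> H. x \<otimes>\<^bsub>P\<^esub> y \<in> solutions}"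
        then have "eqn_eval G \<phi> (x \<otimes>\<^bsub>P\<^esub> y) = \<one>" by blast
        then show "y \<in> {y. f y = \<one>\<^bsub>?A\<^esub>}" unfolding f_def by (simp only: D1 one_FactGroup mem_Collect_eq)
      qed
      then have "null_set ?H {y \<in> H. x \<otimes>\<^bsub>P\<^esub> y \<in> solutions}" by (rule null_set_mono[OF 2])
      from universal_limit_null[OF H x this] show ?thesis by blast
    qed
  qed
qed

text \<open>The passage from \<open>G\<close> to \<open>N\<close> is of another kind, as the
  quotient need not be abelian. Derivatives of a map of level 0 lie in \<open>N\<close>, so modulo
  \<open>N\<close> the equation is constant on each coset of the box: either there is no solution on
  it, or all values lie in \<open>C 0 = N\<close>.\<close>

lemma universal_limit_solutions: "\<exists>l. universal_limit G k (carrier P \<inter> solutions) l"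
proof -
  let ?H = "P\<lparr>carrier := carrier P\<rparr>"
  have fi: "finite_index ?H Nbox"
    by (rule P.finite_index_restrict[OF Nbox(1) subgroup.subset[OF Nbox(2)] P.subgroup_self])
  \<comment> \<open>The whole group is viewed as its own coset at the unit, the form that
    \<open>universal_limit_split\<close> takes.\<close>
  have "\<exists>l. universal_limit G k ((\<one>\<^bsub>P\<^esub> <#\<^bsub>P\<^esub> E) \<inter> solutions) l" if E: "E \<in> lcosets\<^bsub>?H\<^esub> Nbox" for E
  proof -
    obtain t where t: "t \<in> carrier P" "\<one>\<^bsub>P\<^esub> <#\<^bsub>P\<^esub> E = (\<one>\<^bsub>P\<^esub> \<otimes>\<^bsub>P\<^esub> t) <#\<^bsub>P\<^esub> Nbox"
      using P.lcosets_restrictE[OF P.subgroup_self Nbox(2) P.one_closed E] by metis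
    then have tE: "\<one>\<^bsub>P\<^esub> <#\<^bsub>P\<^esub> E = t <#\<^bsub>P\<^esub> Nbox" using P.l_one[OF t(1)] by simp
    let ?B = "P\<lparr>carrier := Nbox\<rparr>" and ?f = "\<lambda>y. eqn_eval G \<phi> (t \<otimes>\<^bsub>P\<^esub> y)"
    interpret B: group ?B by (rule P.subgroup_imp_group[OF Nbox(2)])
    have poly: "filtered_poly ?B G (dyadic_filtration G C) 0 ?f"
      by (rule filtered_poly_translate[OF Nbox(2) order.refl t(1)])
    have F1: "dyadic_filtration G C (Suc 0) = N"
    proof -
      have "(LEAST a. Suc 0 \<le> 2 ^ a) = 0" by (rule Least_eq_0) simp
      then show ?thesis by (simp add: dyadic_filtration_def)
    qed
    have sN: "subgroup N G" using N(1) normal_imp_subgroup by blast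
    have diff: "inv (?f \<one>\<^bsub>P\<^esub>) \<otimes> ?f y \<in> N" and fc: "?f y \<in> carrier G" if y: "y \<in> Nbox" for y
    proof -
      have "y \<in> carrier ?B" using y by simp
      from filtered_poly_mem[OF filtered_poly_rderiv[OF B.is_group this poly] B.one_closed]
      have "inv (?f \<one>\<^bsub>P\<^esub>) \<otimes> ?f (\<one>\<^bsub>P\<^esub> \<otimes>\<^bsub>P\<^esub> y) \<in> N"
        unfolding F1 rderiv_def by simp
      then show "inv (?f \<one>\<^bsub>P\<^esub>) \<otimes> ?f y \<in> N"
        using P.l_one[OF subgroup.mem_carrier[OF Nbox(2) y]] by (simp only:)
      show "?f y \<in> carrier G" using filtered_poly_closed[OF poly \<open>y \<in> carrier ?B\<close>] .
    qed
    have one: "\<one>\<^bsub>P\<^esub> \<in> Nbox" using subgroup.one_closed[OF Nbox(2)] .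
    have fy: "?f y = ?f \<one>\<^bsub>P\<^esub> \<otimes> (inv (?f \<one>\<^bsub>P\<^esub>) \<otimes> ?f y)" if "y \<in> Nbox" for y
      using fc[OF that] fc[OF one] by (simp only: inv_cancel_left)
    show ?thesis
    proof (cases "?f \<one>\<^bsub>P\<^esub> \<in> N")
      case True
      have "\<forall>y\<in>Nbox. ?f y \<in> C 0"
      proof
        fix y assume y: "y \<in> Nbox"
        have "?f \<one>\<^bsub>P\<^esub> \<otimes> (inv (?f \<one>\<^bsub>P\<^esub>) \<otimes> ?f y) \<in> N"
          using subgroup.m_closed[OF sN True diff[OF y]] .
        then show "?f y \<in> C 0" unfolding fy[OF y, symmetric] by simp
      qed
      then show ?thesis
        unfolding tE using universal_limit_solutions_coset[of 0] Nbox(1) t(1) by blast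
    next
      case False
      have "(t <#\<^bsub>P\<^esub> Nbox) \<inter> solutions = {}"
      proof (rule ccontr)
        assume "(t <#\<^bsub>P\<^esub> Nbox) \<inter> solutions \<noteq> {}"
        then obtain y where y: "y \<in> Nbox" "?f y = \<one>" by (auto simp: l_coset_def)
        have "inv (inv (?f \<one>\<^bsub>P\<^esub>) \<otimes> ?f y) \<in> N" using subgroup.m_inv_closed[OF sN diff[OF y(1)]] .
        then have "?f \<one>\<^bsub>P\<^esub> \<in> N" unfolding y(2) using fc[OF one] by (simp only: r_one inv_closed inv_inv)
        with False show False by blast
      qed
      then show ?thesis unfolding tE using universal_limit_empty by metis
    qed
  qed
  then obtain l where "\<And>E. E \<in> lcosets\<^bsub>?H\<^esub> Nbox \<Longrightarrow> universal_limit G k ((\<one>\<^bsub>P\<^esub> <#\<^bsub>P\<^esub> E) \<inter> solutions) (l E)"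
    by metis
  from universal_limit_split[OF P.subgroup_self fi P.one_closed this]
  have "universal_limit G k ((\<one>\<^bsub>P\<^esub> <#\<^bsub>P\<^esub> carrier P) \<inter> solutions) (\<Sum>E\<in>lcosets\<^bsub>?H\<^esub> Nbox. l E)" .
  moreover have "\<one>\<^bsub>P\<^esub> <#\<^bsub>P\<^esub> carrier P = carrier P" by (rule P.lcos_mult_one) (rule order.refl)
  ultimately show ?thesis by auto
qed

lemma eqn_degree_limit:
  "\<exists>l. \<forall>M. measures_index_uniformly G M \<longrightarrow> (\<lambda>n. eqn_degree G k \<phi> (M n)) \<longlonglongrightarrow> l"
proof -
  obtain l where l: "universal_limit G k (carrier P \<inter> solutions) l"
    using universal_limit_solutions by blast
  have "eqn_degree G k \<phi> (M n) = measure_pmf.prob (Pi_pmf {1..k} \<one> (\<lambda>_. M n)) (carrier P \<inter> solutions)"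
    if M: "measures_index_uniformly G M" for M n
    unfolding eqn_degree_def
  proof (rule measure_pmf.finite_measure_eq_AE)
    \<comment> \<open>The product measure is supported on the carrier of \<open>P\<close>, so other
      functions do not affect the probability.\<close>
    have "set_pmf (M n) \<subseteq> carrier G"
      using M by (simp add: measures_index_uniformly_def prob_measures_on_def)
    then have "set_pmf (Pi_pmf {1..k} \<one> (\<lambda>_. M n)) \<subseteq> carrier P"
      by (auto simp: set_Pi_pmf PiE_dflt_def)
    then show "AE g in measure_pmf (Pi_pmf {1..k} \<one> (\<lambda>_. M n)).
        g \<in> solutions \<longleftrightarrow> g \<in> carrier P \<inter> solutions"
      by (auto simp: AE_measure_pmf_iff simp del: power_group_simps)
  qed simp_all
  with l show ?thesis unfolding universal_limit_def by (intro exI[of _ l]) simp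
qed

end

text \<open>Nilpotency passes to the normal core because the lower central series is monotone in the
  subgroup.\<close>

lemma virtually_nilpotent_normal_core:
  fixes G (structure)
  assumes "virtually_nilpotent_group G"
  obtains N s where "N \<lhd> G" "finite_index G N" "lower_central (G\<lparr>carrier := N\<rparr>) s = {\<one>}"
proof -
  obtain H where H: "subgroup H G" "finite (lcosets\<^bsub>G\<^esub> H)" "nilpotent_group (G\<lparr>carrier := H\<rparr>)"
    and "group G" using assms by (auto simp: virtually_nilpotent_group_def)
  interpret group G by fact
  have "finite_index G H" using H by (simp add: finite_index_def)
  then obtain N where N: "N \<lhd> G" "N \<subseteq> H" "finite_index G N" using finite_index_core by blast
  have sN: "subgroup N G" using N(1) normal_imp_subgroup by blast
  obtain s where s: "lower_central (G\<lparr>carrier := H\<rparr>) s = {\<one>}"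
    using H(3) by (auto simp: nilpotent_group_def)
  have "lower_central (G\<lparr>carrier := N\<rparr>) s \<subseteq> {\<one>}"
    using lower_central_restrict_mono[OF sN H(1) N(2), of s] s by simp
  moreover have "\<one> \<in> lower_central (G\<lparr>carrier := N\<rparr>) s"
    using subgroup.one_closed[OF normal_imp_subgroup[OF lower_central_restrict_properties(1)[OF N(1)]]] .
  ultimately have "lower_central (G\<lparr>carrier := N\<rparr>) s = {\<one>}" by blast
  with N that show thesis by blast
qed

theorem corollary1p14:
  fixes G :: "('a, 'b) monoid_scheme" and k :: nat and \<phi> :: "'a equation"
  assumes "group G"
    and "finitely_generated_group G"
    and "virtually_nilpotent_group G"
    and "\<phi> \<in> equations G k"
  shows "(\<forall>M M'. measures_index_uniformly G M \<and> measures_index_uniformly G M' \<longrightarrow>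
            eqn_degree_seq G k \<phi> M = eqn_degree_seq G k \<phi> M') \<and>
         (\<forall>M. measures_index_uniformly G M \<longrightarrow>
            (\<lambda>n. ereal (eqn_degree G k \<phi> (M n))) \<longlonglongrightarrow> eqn_degree_seq G k \<phi> M)"
proof -
  obtain S where S: "finite S" "S \<subseteq> carrier G" "generate G S = carrier G"
    using assms(2) by (auto simp: finitely_generated_group_def)
  obtain N s where N: "N \<lhd> G" "finite_index G N" "lower_central (G\<lparr>carrier := N\<rparr>) s = {\<one>\<^bsub>G\<^esub>}"
    using virtually_nilpotent_normal_core[OF assms(3)] .
  have "nilpotent_equation G k \<phi> N s S"
    using assms(1,4) S N by (simp add: nilpotent_equation_def nilpotent_equation_axioms_def)
  then obtain l where l: "\<And>M. measures_index_uniformly G M \<Longrightarrow> (\<lambda>n. eqn_degree G k \<phi> (M n)) \<longlonglongrightarrow> l"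
    using nilpotent_equation.eqn_degree_limit by blast
  have lim: "(\<lambda>n. ereal (eqn_degree G k \<phi> (M n))) \<longlonglongrightarrow> ereal l" if "measures_index_uniformly G M" for M
    using l[OF that] by simp
  have "eqn_degree_seq G k \<phi> M = ereal l" if "measures_index_uniformly G M" for M
    unfolding eqn_degree_seq_def by (rule lim_imp_Limsup[OF _ lim[OF that]]) simp
  then show ?thesis using lim by simp
qed

end
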